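(* Let $\alpha,\beta$ be integers different from $1$ with $v_2(\alpha-1)=v_2(\beta-1)=m>1$, and suppose $\ell\ge 2m$, where $\ell=v_2(\alpha-\beta)$ (with $\ell=\infty$ if $\alpha=\beta$). Then $|G_2|=2^{7m-3}$, the nilpotency class of $G_2$ is $5$, $o(a)=o(b)=2^{3m-1}$ and $o(c)=2^{2m}$.
   Context: $G(\alpha,\beta)=\langle A,B\mid A^{[A,B]}=A^{\alpha},\ B^{[B,A]}=B^{\beta}\rangle$ with $[x,y]=x^{-1}y^{-1}xy$, $y^x=x^{-1}yx$, and $C=[A,B]$. The group $G(\alpha,\beta)$ is finite and nilpotent, hence the direct product of its Sylow subgroups; $G_2$ denotes its Sylow $2$-subgroup and $a,b,c$ denote the images of $A,B,C$ under the canonical projection $G(\alpha,\beta)\to G_2$. $v_2$ is the $2$-adic valuation and $o(x)$ the order of $x$. *)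

theory Defs
  imports "HOL-Algebra.Algebra" "HOL-Computational_Algebra.Primes" "HOL-Number_Theory.Cong"
begin

text \<open>Words in A, B and their inverses. A letter is (generator, inverted);
  generator False = A, True = B.\<close>
type_synonym gword = "(bool \<times> bool) list"

definition wA :: gword where "wA = [(False, False)]"
definition wAi :: gword where "wAi = [(False, True)]"
definition wB :: gword where "wB = [(True, False)]"
definition wBi :: gword where "wBi = [(True, True)]"

definition wpow :: "gword \<Rightarrow> gword \<Rightarrow> int \<Rightarrow> gword" where
  "wpow w winv k = (if 0 \<le> k then concat (replicate (nat k) w) else concat (replicate (nat (- k)) winv))"

definition wC :: gword where "wC = wAi @ wBi @ wA @ wB"
definition wCi :: gword where "wCi = wBi @ wAi @ wB @ wA"

inductive peq :: "int \<Rightarrow> int \<Rightarrow> gword \<Rightarrow> gword \<Rightarrow> bool" for \<alpha> \<beta> :: int where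
  refl: "peq \<alpha> \<beta> w w"
| sym: "peq \<alpha> \<beta> u v \<Longrightarrow> peq \<alpha> \<beta> v u"
| trans: "peq \<alpha> \<beta> u v \<Longrightarrow> peq \<alpha> \<beta> v w \<Longrightarrow> peq \<alpha> \<beta> u w"
| cancel: "peq \<alpha> \<beta> [x, (fst x, \<not> snd x)] []"
| rel1: "peq \<alpha> \<beta> (wCi @ wA @ wC) (wpow wA wAi \<alpha>)"
| rel2: "peq \<alpha> \<beta> (wC @ wB @ wCi) (wpow wB wBi \<beta>)"
| cong: "peq \<alpha> \<beta> u v \<Longrightarrow> peq \<alpha> \<beta> (p @ u @ q) (p @ v @ q)"

definition pclass :: "int \<Rightarrow> int \<Rightarrow> gword \<Rightarrow> gword set" where
  "pclass \<alpha> \<beta> w = {v. peq \<alpha> \<beta> w v}"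

text \<open>G(alpha,beta) = <A,B | A^[A,B] = A^alpha, B^[B,A] = B^beta> as the group of
  congruence classes of words.\<close>
definition Gpres :: "int \<Rightarrow> int \<Rightarrow> gword set monoid" where
  "Gpres \<alpha> \<beta> = \<lparr>carrier = range (pclass \<alpha> \<beta>),
     monoid.mult = (\<lambda>S T. {v. \<exists>x\<in>S. \<exists>y\<in>T. peq \<alpha> \<beta> (x @ y) v}),
     one = pclass \<alpha> \<beta> []\<rparr>"

definition sylow2 :: "('a, 'b) monoid_scheme \<Rightarrow> 'a set \<Rightarrow> bool" where
  "sylow2 G P \<longleftrightarrow> subgroup P G \<and> card P = 2 ^ multiplicity (2::nat) (order G)"

text \<open>The 2-component of an element x of finite order n = 2^k r (r odd): x^e with
  e = 1 mod 2^k and e = 0 mod r. In a finite nilpotent group this is the image of x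
  under the canonical projection onto the Sylow 2-subgroup.\<close>
definition two_part :: "('a, 'b) monoid_scheme \<Rightarrow> 'a \<Rightarrow> 'a" where
  "two_part G x = (let n = group.ord G x; k = multiplicity (2::nat) n in
     x [^]\<^bsub>G\<^esub> (SOME e::nat. [e = 1] (mod 2 ^ k) \<and> [e = 0] (mod (n div 2 ^ k))))"

definition gcomm :: "('a, 'b) monoid_scheme \<Rightarrow> 'a \<Rightarrow> 'a \<Rightarrow> 'a" where
  "gcomm G x y = inv\<^bsub>G\<^esub> x \<otimes>\<^bsub>G\<^esub> inv\<^bsub>G\<^esub> y \<otimes>\<^bsub>G\<^esub> x \<otimes>\<^bsub>G\<^esub> y"

definition comm_subgroup :: "('a, 'b) monoid_scheme \<Rightarrow> 'a set \<Rightarrow> 'a set \<Rightarrow> 'a set" where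
  "comm_subgroup G H K = generate G {gcomm G h k | h k. h \<in> H \<and> k \<in> K}"

text \<open>Lower central series of a subgroup P: lcs 0 = P (gamma_1), lcs (i+1) = [lcs i, P].\<close>
fun lcs :: "('a, 'b) monoid_scheme \<Rightarrow> 'a set \<Rightarrow> nat \<Rightarrow> 'a set" where
  "lcs G P 0 = P"
| "lcs G P (Suc i) = comm_subgroup G (lcs G P i) P"

definition nil_class :: "('a, 'b) monoid_scheme \<Rightarrow> 'a set \<Rightarrow> nat" where
  "nil_class G P = (LEAST c. lcs G P c = {\<one>\<^bsub>G\<^esub>})"

end

theory Submission
  imports Defs
begin

text \<open>
  Write \<open>C = [A, B]\<close>. Conjugating \<open>A\<^sup>n\<close> by \<open>B\<close> gives
  \<open>A\<^sup>n B = B C\<^sup>n A\<^sup>e\<close> with \<open>e = \<alpha> + \<dots> + \<alpha>\<^sup>n\<close>, and symmetrically for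
  \<open>B\<^sup>n A\<close>. Hence \<open>G = \<langle>A\<rangle>\<langle>C\<rangle>\<langle>B\<rangle>\<close> as soon as the generators have finite order. Evaluating
  \<open>[A, B\<^sup>\<beta>]\<close> in two ways yields a relation \<open>C\<^sup>t A\<^sup>y = B\<^sup>x\<close>. It makes a nontrivial power of
  \<open>A\<close> central, whence finiteness, and when \<open>\<alpha>, \<beta> > 0\<close> (which may be assumed once \<open>G\<close> is
  finite) the exponents \<open>x\<close> and \<open>y\<close> have 2-adic valuation \<open>2m - 1\<close>. Counting along
  \<open>\<langle>A\<rangle> \<le> \<langle>A\<rangle>\<langle>C\<rangle> \<le> G\<close> then shows that the 2-part of \<open>|G|\<close> divides \<open>2\<^sup>7\<^sup>m\<^sup>-\<^sup>3\<close>; nilpotency of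
  \<open>G\<close> is not needed.

  Conversely, left and right multiplication on normal forms \<open>B\<^sup>-\<^sup>i C\<^sup>j A\<^sup>k\<close> are given by explicit
  formulas on integer triples. They commute modulo a suitable lattice of index \<open>2\<^sup>7\<^sup>m\<^sup>-\<^sup>3\<close>, so the
  left multiplications generate a regular permutation group of that order which satisfies the
  defining relations. The kernel of the map of \<open>G\<close> onto this group has odd order, so the group is
  isomorphic to the Sylow 2-subgroup, and orders and nilpotency class are read off from it.
\<close>

subsection \<open>Geometric sums and 2-adic congruences\<close>

text \<open>The constants come from one congruence: for s = x^j and v_2(x - 1) = m, twice x geom x s
  - x^(j + s) is -j (x - 1)^2 modulo 2^(3m). For j = 1 the doubled value has valuation 2m, so the
  quantity itself has 2m - 1. In the upper bound this quantity is the exponent of A and of B in the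
  relation; in the model, as \<open>defect\<close>, it governs whether left multiplication by A^-1
  commutes with right multiplication by B. The hypothesis on \<alpha> - \<beta> serves both times:
  it makes t divisible by 2^(2m), and it makes the two defects agree modulo 2^(3m-1). Put P =
  2^(2m-1). Up to odd factors in the exponents, B^P lies in <A><C>, C^P lies in <A>, and A^P is
  central, hence killed by \<alpha> - 1. This gives P P (2^m P) = 2^(7m-3). The odd factors stay
  undetermined, so the upper bound is a divisibility throughout. The geometric sums need natural
  lengths n = \<alpha>^r. With r = 2 these are natural for either sign, which is enough for
  finiteness; r = 1 gives the sharp valuation but needs positive exponents, obtained by adding
  multiples of a common period.\<close>

definition geom :: "int \<Rightarrow> nat \<Rightarrow> int" where "geom x n = (\<Sum>i<n. x ^ i)"

lemma geom_0 [simp]: "geom x 0 = 0" and geom_1 [simp]: "geom x (Suc 0) = 1"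
  by (simp_all add: geom_def)

lemma geom_Suc: "geom x (Suc n) = geom x n + x ^ n"
  by (simp add: geom_def)

lemma geom_add: "geom x (m + n) = geom x m + x ^ m * geom x n"
  by (induction n) (simp_all add: geom_Suc algebra_simps power_add)

lemma geom_Suc': "geom x (Suc n) = 1 + x * geom x n"
  using geom_add[of x 1 n] by simp

lemma geom_mult_diff: "(x - 1) * geom x n = x ^ n - 1"
  by (induction n) (simp_all add: geom_Suc algebra_simps)

lemma odd_geom: "odd x \<Longrightarrow> odd n \<Longrightarrow> odd (geom x n)"
  by (simp add: geom_def even_sum_iff)

text \<open>Each squaring contributes one factor 2: in x^(2^(k+1)) - 1 = (x^(2^k) - 1)(x^(2^k) + 1)
  the second factor is even.\<close>

lemma two_power_dvd_power_diff:
  fixes x :: int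
  assumes "2 ^ m dvd x - 1" "m \<ge> 1" "2 ^ k dvd n"
  shows "2 ^ (m + k) dvd x ^ n - 1"
proof -
  have "2 dvd (2::int) ^ m" using assms(2) by simp
  then have "odd x" using assms(1) dvd_trans[of 2 "2 ^ m" "x - 1"] by simp
  have *: "2 ^ (m + k) dvd x ^ (2 ^ k) - 1" for k
  proof (induction k)
    case (Suc k)
    have "even (x ^ 2 ^ k + 1)" using \<open>odd x\<close> by simp
    with Suc have "2 ^ (m + k) * 2 dvd (x ^ 2 ^ k - 1) * (x ^ 2 ^ k + 1)"
      by (rule mult_dvd_mono)
    moreover have "(x ^ 2 ^ k - 1) * (x ^ 2 ^ k + 1) = x ^ 2 ^ Suc k - 1"
      by (simp add: power_mult power2_eq_square algebra_simps)
    ultimately show ?case by (simp add: mult.commute)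
  qed (use assms in simp)
  obtain q where "n = 2 ^ k * q" using assms(3) by blast
  moreover have "y - 1 dvd y ^ q - 1" for y :: int
    using geom_mult_diff[of y q] by (metis dvd_triv_left)
  ultimately show ?thesis using *[of k] by (metis dvd_trans power_mult)
qed

text \<open>Binomial expansion truncated after u^2; doubling clears the denominator of n choose
  2.\<close>

lemma power_mod_cube:
  fixes u :: int
  shows "\<exists>K. 2 * (1 + u) ^ n = 2 + 2 * int n * u + int n * (int n - 1) * u\<^sup>2 + 2 * u ^ 3 * K"
proof (induction n)
  case (Suc n)
  then obtain K where K: "2 * (1 + u) ^ n = 2 + 2 * int n * u + int n * (int n - 1) * u\<^sup>2 + 2 * u ^ 3 * K"
    by blast
  have "even (int n * (int n - 1))" by simp
  then obtain c where c: "int n * (int n - 1) = 2 * c" by (rule evenE)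
  have "2 * (1 + u) ^ Suc n = (1 + u) * (2 * (1 + u) ^ n)" by simp
  also have "\<dots> = (1 + u) * (2 + 2 * int n * u + int n * (int n - 1) * u\<^sup>2 + 2 * u ^ 3 * K)"
    by (simp only: K)
  also have "\<dots> = 2 + 2 * int (Suc n) * u + int (Suc n) * (int (Suc n) - 1) * u\<^sup>2
      + 2 * u ^ 3 * (K + u * K) + (int n * (int n - 1)) * u ^ 3"
    by (simp add: algebra_simps power2_eq_square power3_eq_cube)
  also have "\<dots> = 2 + 2 * int (Suc n) * u + int (Suc n) * (int (Suc n) - 1) * u\<^sup>2
      + 2 * u ^ 3 * (K + u * K + c)"
    unfolding c by (simp add: algebra_simps)
  finally show ?case by blast
qed (auto intro: exI[of _ 0])

text \<open>Summing the previous expansion produces n choose 1, 2 and 3 as coefficients, and the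
  factor 6 clears their denominators.\<close>

lemma geom_mod_cube:
  fixes u :: int
  shows "\<exists>K. 6 * geom (1 + u) n = 6 * int n + 3 * int n * (int n - 1) * u
    + int n * (int n - 1) * (int n - 2) * u\<^sup>2 + 6 * u ^ 3 * K"
proof (induction n)
  case (Suc n)
  then obtain K where K: "6 * geom (1 + u) n = 6 * int n + 3 * int n * (int n - 1) * u
    + int n * (int n - 1) * (int n - 2) * u\<^sup>2 + 6 * u ^ 3 * K" by blast
  obtain L where L: "2 * (1 + u) ^ n = 2 + 2 * int n * u + int n * (int n - 1) * u\<^sup>2 + 2 * u ^ 3 * L"
    using power_mod_cube by blast
  have "6 * geom (1 + u) (Suc n) = 6 * geom (1 + u) n + 3 * (2 * (1 + u) ^ n)"
    by (simp add: geom_Suc)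
  also have "\<dots> = 6 * int (Suc n) + 3 * int (Suc n) * (int (Suc n) - 1) * u
    + int (Suc n) * (int (Suc n) - 1) * (int (Suc n) - 2) * u\<^sup>2 + 6 * u ^ 3 * (K + L)"
    unfolding K L by (simp add: algebra_simps power2_eq_square power3_eq_cube)
  finally show ?case by blast
qed (auto intro: exI[of _ 0])


lemma two_power_dvd_mult_3: "2 ^ k dvd 3 * y \<Longrightarrow> 2 ^ k dvd (y::int)"
  by (simp add: coprime_dvd_mult_right_iff)

text \<open>With x = 1 + u and s = 1 + j u + ..., an expansion modulo u^3 loses its terms of order 0
  and 1 and leaves -j u^2 / 2, which the last summand compensates after doubling.\<close>

lemma two_power_dvd_key_exponent:
  fixes x :: int
  assumes "2 ^ m dvd x - 1" "int s = x ^ j"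
  shows "2 ^ (3 * m) dvd 2 * (x * geom x s - x ^ (j + s)) + int j * (x - 1)\<^sup>2"
proof -
  define u where "u = x - 1"
  then have x: "x = 1 + u" by simp
  obtain E where E: "2 * (1 + u) ^ j = 2 + 2 * int j * u + int j * (int j - 1) * u\<^sup>2 + 2 * u ^ 3 * E"
    using power_mod_cube by blast
  have "even (int j * (int j - 1))" by simp
  then obtain e where e: "int j * (int j - 1) = 2 * e" by (rule evenE)
  \<comment> \<open>Chosen so that x^j = 1 + u w with w = j + u c; then j can be eliminated in
    favour of w.\<close>
  define c where "c = e + u * E"
  define w where "w = int j + u * c"
  have s: "int s = 1 + u * w"
    using E assms(2) unfolding e x c_def w_def by (simp add: algebra_simps power2_eq_square power3_eq_cube)
  obtain K where K: "6 * geom (1 + u) s = 6 * int s + 3 * int s * (int s - 1) * u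
    + int s * (int s - 1) * (int s - 2) * u\<^sup>2 + 6 * u ^ 3 * K"
    using geom_mod_cube by blast
  obtain L where L: "2 * (1 + u) ^ s = 2 + 2 * int s * u + int s * (int s - 1) * u\<^sup>2 + 2 * u ^ 3 * L"
    using power_mod_cube by blast
  define t where "t = int s"
  have j: "int j = w - u * c" by (simp add: w_def)
  have "3 * (2 * (x * geom x s - x ^ (j + s)) + int j * (x - 1)\<^sup>2)
      = (1 + u) * (6 * geom (1 + u) s) - 3 * t * (2 * (1 + u) ^ s) + 3 * int j * u\<^sup>2"
    unfolding power_add assms(2)[symmetric] by (simp add: x t_def algebra_simps)
  also have "\<dots> = u ^ 3 * (- 3 * w\<^sup>2 - 3 * c + 3 * t * w + (1 + u) * (t * w * (u * w - 1) + 6 * K)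
      - 3 * t\<^sup>2 * w - 6 * t * L)"
    unfolding K L j t_def s by (simp add: algebra_simps power2_eq_square power3_eq_cube)
  finally have "u ^ 3 dvd 3 * (2 * (x * geom x s - x ^ (j + s)) + int j * (x - 1)\<^sup>2)" by simp
  moreover have "2 ^ (3 * m) dvd u ^ 3"
    using assms(1) dvd_power_same[of "2 ^ m" u 3] by (simp add: u_def power_mult[symmetric] mult.commute)
  ultimately have "2 ^ (3 * m) dvd 3 * (2 * (x * geom x s - x ^ (j + s)) + int j * (x - 1)\<^sup>2)"
    by (rule dvd_trans[rotated])
  then show ?thesis by (rule two_power_dvd_mult_3)
qed

text \<open>The quadratic term contributes -d u / 2 = -2^(m-1) w d, and as w is odd this equals
  2^(m-1) d modulo 2^m d. So the coefficient is the same for all such x; it is the source of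
  \<open>z\<close> in the model.\<close>

lemma two_power_dvd_geom_diff:
  fixes x :: int
  assumes w: "x - 1 = 2 ^ m * w" "odd w" and m: "m \<ge> 1" and d: "2 ^ (2 * m - 1) dvd d"
  shows "2 ^ (3 * m - 1) dvd geom x d - (1 + 2 ^ (m - 1)) * int d"
proof -
  define u where "u = x - 1"
  obtain q where q: "d = 2 ^ (2 * m - 1) * q" using d by blast
  obtain K where K: "6 * geom (1 + u) d = 6 * int d + 3 * int d * (int d - 1) * u
    + int d * (int d - 1) * (int d - 2) * u\<^sup>2 + 6 * u ^ 3 * K"
    using geom_mod_cube by blast
  obtain v where v: "w = 2 * v + 1" using w(2) by (rule oddE)
  define z :: int where "z = 2 ^ (m - 1)"
  have mz: "2 ^ m = 2 * z" using m by (cases m) (auto simp: z_def)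
  have dz: "int d = 2 * z\<^sup>2 * int q" using m
    by (cases m) (auto simp: z_def q power_even_eq)
  have u: "u = 2 * z * w" using w(1) mz by (simp add: u_def)
  have Mz: "2 ^ (3 * m - 1) = 4 * z ^ 3"
    using m by (cases m) (auto simp: z_def power_add power_mult power3_eq_cube simp flip: power_mult_distrib)
  have "3 * (2 * (geom x d - (1 + z) * int d)) = 6 * geom (1 + u) d - 6 * (1 + z) * int d"
    by (simp add: u_def algebra_simps)
  also have "\<dots> = 3 * int d * int d * u - 3 * int d * (u + 2 * z)
    + int d * (int d - 1) * (int d - 2) * u\<^sup>2 + 6 * u ^ 3 * K"
    unfolding K by (simp add: algebra_simps)
  also have "u + 2 * z = 4 * z * (v + 1)" unfolding u v by (simp add: algebra_simps)
  also have "3 * int d * int d * u - 3 * int d * (4 * z * (v + 1))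
    + int d * (int d - 1) * (int d - 2) * u\<^sup>2 + 6 * u ^ 3 * K
    = (8 * z ^ 3) * (3 * z\<^sup>2 * int q * int q * w - 3 * int q * (v + 1)
       + z * int q * (int d - 1) * (int d - 2) * w\<^sup>2 + 6 * w ^ 3 * K)"
    unfolding dz u by (simp add: algebra_simps power2_eq_square power3_eq_cube)
  finally have "8 * z ^ 3 dvd 3 * (2 * (geom x d - (1 + z) * int d))" by simp
  moreover have "8 * z ^ 3 = 2 ^ (3 + (m - 1) * 3)" by (simp add: z_def power_add power_mult)
  ultimately have "8 * z ^ 3 dvd 2 * (geom x d - (1 + z) * int d)"
    using two_power_dvd_mult_3 by metis
  then have "2 * (4 * z ^ 3) dvd 2 * (geom x d - (1 + z) * int d)" by simp
  then show ?thesis unfolding Mz z_def[symmetric] by (subst (asm) dvd_mult_cancel_left) simp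
qed

text \<open>With n = 2^m dividing u, the term n (n - 1) u / 2 already carries 2^(2m-1), and the
  later ones carry more.\<close>

lemma two_power_dvd_geom_minus:
  fixes x :: int
  assumes "2 ^ m dvd x - 1" "m \<ge> 1"
  shows "2 ^ (2 * m - 1) dvd geom x (2 ^ m) - 2 ^ m"
proof -
  define u where "u = x - 1"
  define n where "n = int (2 ^ m)"
  obtain K where K: "6 * geom (1 + u) (2 ^ m) = 6 * n + 3 * n * (n - 1) * u
    + n * (n - 1) * (n - 2) * u\<^sup>2 + 6 * u ^ 3 * K"
    using geom_mod_cube[of u "2 ^ m"] n_def by blast
  obtain w where w: "u = n * w" using assms(1) by (auto simp: u_def n_def)
  have "3 * (2 * (geom x (2 ^ m) - 2 ^ m)) = 6 * geom (1 + u) (2 ^ m) - 6 * n"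
    by (simp add: u_def n_def)
  also have "\<dots> = n\<^sup>2 * (3 * (n - 1) * w + n * (n - 1) * (n - 2) * w\<^sup>2 + 6 * n * w ^ 3 * K)"
    by (simp only: K) (simp add: w algebra_simps power2_eq_square power3_eq_cube)
  finally have "n\<^sup>2 dvd 3 * (2 * (geom x (2 ^ m) - 2 ^ m))" by simp
  moreover have n: "n\<^sup>2 = 2 ^ (2 * m)" by (simp add: n_def power_mult mult.commute[of 2] flip: power_mult)
  ultimately have "2 ^ (2 * m) dvd 2 * (geom x (2 ^ m) - 2 ^ m)"
    by (metis two_power_dvd_mult_3)
  moreover have "2 * m = Suc (2 * m - 1)" using assms(2) by simp
  ultimately have "2 * 2 ^ (2 * m - 1) dvd 2 * (geom x (2 ^ m) - 2 ^ m)" by (metis power_Suc)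
  then show ?thesis by (subst (asm) dvd_mult_cancel_left) simp
qed

subsection \<open>The Macdonald relations\<close>

context group
begin

lemma l_inv_assoc: "x \<in> carrier G \<Longrightarrow> y \<in> carrier G \<Longrightarrow> inv x \<otimes> (x \<otimes> y) = y"
  by (simp flip: m_assoc)

lemma r_inv_assoc: "x \<in> carrier G \<Longrightarrow> y \<in> carrier G \<Longrightarrow> x \<otimes> (inv x \<otimes> y) = y"
  by (simp flip: m_assoc)

lemma int_pow_mult_assoc:
  "x \<in> carrier G \<Longrightarrow> y \<in> carrier G \<Longrightarrow> x [^] (i::int) \<otimes> (x [^] j \<otimes> y) = x [^] (i + j) \<otimes> y"
  by (simp add: int_pow_mult m_assoc)

lemma int_pow_Suc: "x [^] int (Suc n) = x [^] int n \<otimes> x"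
  by (simp only: int_pow_int nat_pow_Suc)

lemma int_pow_intertwine:
  assumes "x \<otimes> y = y \<otimes> z" and xyz [simp]: "x \<in> carrier G" "y \<in> carrier G" "z \<in> carrier G"
  shows "x [^] (i::int) \<otimes> y = y \<otimes> z [^] i"
proof -
  have nat: "x [^] n \<otimes> y = y \<otimes> z [^] n" for n :: nat
  proof (induction n)
    case (Suc n)
    have "x [^] Suc n \<otimes> y = x [^] n \<otimes> (x \<otimes> y)" by (simp add: m_assoc)
    also have "\<dots> = (x [^] n \<otimes> y) \<otimes> z" by (simp add: assms(1) m_assoc)
    also have "\<dots> = y \<otimes> z [^] Suc n" by (simp add: Suc m_assoc)
    finally show ?case .
  qed simp
  show ?thesis
  proof (cases i rule: int_cases2)
    case (nonneg n)
    then show ?thesis by (simp add: int_pow_int nat)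
  next
    case (nonpos n)
    have "inv (x [^] n) \<otimes> y = y \<otimes> inv (z [^] n)"
      using nat[of n] by (metis inv_closed inv_solve_left inv_solve_right m_assoc m_closed nat_pow_closed xyz)
    then show ?thesis by (simp add: nonpos int_pow_neg int_pow_int)
  qed
qed

lemma commutes_int_pow:
  assumes "x \<otimes> y = y \<otimes> x" and [simp]: "x \<in> carrier G" "y \<in> carrier G"
  shows "x [^] (i::int) \<otimes> y = y \<otimes> x [^] i"
  using int_pow_intertwine[OF assms(1)] by simp

lemma commutes_int_pow2:
  assumes "x \<otimes> y = y \<otimes> x" and [simp]: "x \<in> carrier G" "y \<in> carrier G"
  shows "x [^] (i::int) \<otimes> y [^] (j::int) = y [^] j \<otimes> x [^] i"
  using commutes_int_pow[OF commutes_int_pow[OF assms, of i, symmetric], of j] by simp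

lemma int_pow_commutes_self:
  "x \<in> carrier G \<Longrightarrow> x [^] (i::int) \<otimes> x [^] (j::int) = x [^] j \<otimes> x [^] i"
  by (simp flip: int_pow_mult add: add.commute)

end

text \<open>Since [B, A] is the inverse of C, conjugation of B by [B, A] is C B C^-1, which is the
  left side of \<open>rel_B\<close>.\<close>

locale macdonald = group G for G (structure) +
  fixes A B and \<alpha> \<beta> :: int
  assumes A_closed [simp]: "A \<in> carrier G" and B_closed [simp]: "B \<in> carrier G"
    and rel_A: "inv (gcomm G A B) \<otimes> A \<otimes> gcomm G A B = A [^] \<alpha>"
    and rel_B: "gcomm G A B \<otimes> B \<otimes> inv (gcomm G A B) = B [^] \<beta>"
begin

abbreviation C where "C \<equiv> gcomm G A B"

lemma C_closed [simp]: "C \<in> carrier G"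
  by (simp add: gcomm_def)

lemma gcomm_swap: "gcomm G B A = inv C"
  by (simp add: gcomm_def inv_mult_group m_assoc)

text \<open>Exchanging the roles of A and B inverts C and preserves the relations, so every result
  on A transfers to B.\<close>

lemma swap: "macdonald G B A \<beta> \<alpha>"
  using rel_A rel_B by unfold_locales (simp_all add: gcomm_swap)

lemma A_mult_C: "A \<otimes> C = C \<otimes> A [^] \<alpha>"
  by (simp add: m_assoc r_inv_assoc flip: rel_A)

lemma A_mult_B: "A \<otimes> B = B \<otimes> (A \<otimes> C)"
  by (simp add: gcomm_def m_assoc r_inv_assoc)

text \<open>Only nonnegative powers of C occur: moving A past an inverse of C would require dividing
  its exponent by \<alpha>.\<close>

lemma A_pow_C_pow: "A [^] i \<otimes> C [^] int k = C [^] int k \<otimes> A [^] (i * \<alpha> ^ k)"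
proof (induction k arbitrary: i)
  case (Suc k)
  have "A [^] i \<otimes> C [^] int (Suc k) = (A [^] i \<otimes> C [^] int k) \<otimes> C"
    by (simp only: int_pow_Suc) (simp add: m_assoc)
  also have "\<dots> = C [^] int k \<otimes> (A [^] (i * \<alpha> ^ k) \<otimes> C)" by (simp add: Suc m_assoc)
  also have "A [^] (i * \<alpha> ^ k) \<otimes> C = C \<otimes> A [^] (i * \<alpha> ^ Suc k)"
    using int_pow_intertwine[OF A_mult_C, of "i * \<alpha> ^ k"] by (simp add: int_pow_pow mult_ac)
  also have "C [^] int k \<otimes> (C \<otimes> A [^] (i * \<alpha> ^ Suc k)) = C [^] int (Suc k) \<otimes> A [^] (i * \<alpha> ^ Suc k)"
    by (simp only: int_pow_Suc) (simp add: m_assoc)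
  finally show ?case .
qed simp

lemma C_pow_B_pow: "C [^] int k \<otimes> B [^] i = B [^] (i * \<beta> ^ k) \<otimes> C [^] int k"
proof -
  interpret s: macdonald G B A \<beta> \<alpha> by (rule swap)
  have "B [^] i \<otimes> inv (C [^] int k) = inv (C [^] int k) \<otimes> B [^] (i * \<beta> ^ k)"
    using s.A_pow_C_pow[of i k] by (simp add: gcomm_swap int_pow_inv)
  then show ?thesis
    by (metis B_closed C_closed int_pow_closed inv_closed inv_solve_left inv_solve_right m_assoc m_closed)
qed

text \<open>Because A B = B (A C), conjugating A^n by B amounts to collecting (A C)^n; each A picks
  up a power of \<alpha> for every C it passes, hence the geometric sum.\<close>

lemma AC_pow: "(A \<otimes> C) [^] int n = C [^] int n \<otimes> A [^] (\<alpha> * geom \<alpha> n)"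
proof (induction n)
  case (Suc n)
  have "(A \<otimes> C) [^] int (Suc n) = (A \<otimes> C) [^] int n \<otimes> (A \<otimes> C)"
    by (rule int_pow_Suc)
  also have "\<dots> = C [^] int n \<otimes> (A [^] (\<alpha> * geom \<alpha> n) \<otimes> (A [^] (1::int) \<otimes> C))" by (simp add: Suc m_assoc)
  also have "\<dots> = C [^] int n \<otimes> (A [^] (\<alpha> * geom \<alpha> n + 1) \<otimes> C [^] int 1)"
    by (subst int_pow_mult_assoc) simp_all
  also have "\<dots> = C [^] int (Suc n) \<otimes> A [^] (\<alpha> * geom \<alpha> (Suc n))"
    by (subst A_pow_C_pow, subst int_pow_mult_assoc)
      (simp_all add: geom_Suc' algebra_simps)
  finally show ?case .
qed simp

lemma A_pow_B: "A [^] int n \<otimes> B = B \<otimes> (C [^] int n \<otimes> A [^] (\<alpha> * geom \<alpha> n))"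
  using int_pow_intertwine[OF A_mult_B, of "int n"] by (simp add: AC_pow)

lemma B_pow_A: "B [^] int n \<otimes> A = A \<otimes> (C [^] (- int n) \<otimes> B [^] (\<beta> * geom \<beta> n))"
  using macdonald.A_pow_B[OF swap, of n] by (simp add: gcomm_swap int_pow_inv int_pow_neg)

lemma CA_pow: "(C [^] int t \<otimes> A [^] y) [^] int j = C [^] int (t * j) \<otimes> A [^] (y * geom (\<alpha> ^ t) j)"
proof (induction j)
  case (Suc j)
  let ?W = "C [^] int t \<otimes> A [^] y"
  have "?W [^] int (Suc j) = ?W [^] int j \<otimes> ?W" by (rule int_pow_Suc)
  also have "\<dots> = C [^] int (t * j) \<otimes> ((A [^] (y * geom (\<alpha> ^ t) j) \<otimes> C [^] int t) \<otimes> A [^] y)"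
    by (simp add: Suc m_assoc)
  also have "\<dots> = C [^] int (t * Suc j) \<otimes> A [^] (y * geom (\<alpha> ^ t) (Suc j))"
    by (simp add: A_pow_C_pow m_assoc int_pow_mult_assoc flip: int_pow_mult)
      (simp add: geom_Suc' algebra_simps)
  finally show ?case .
qed simp

text \<open>The word A C^r B = A B^k C^r is rewritten in two ways. Passing A to the right through
  C^r gives A^n, and A^n B is known; passing B to the left gives B^k, and B^k A is known. Cancelling
  A leaves the equation.\<close>

lemma B_pow_C_pow_eq:
  assumes n: "int n = \<alpha> ^ r" and k: "int k = \<beta> ^ r"
  shows "B [^] (\<beta> ^ (k + r) - \<beta> * geom \<beta> k) \<otimes> C [^] int (k + r)
    = C [^] int (n + r) \<otimes> A [^] (\<alpha> * geom \<alpha> n - \<alpha> ^ (n + r))"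
proof -
  let ?g = "\<alpha> * geom \<alpha> n" and ?h = "\<beta> * geom \<beta> k"
  let ?R = "C [^] int (n + r) \<otimes> A [^] (?g - \<alpha> ^ (n + r))"
  have 1: "A \<otimes> C [^] int r = C [^] int r \<otimes> A [^] int n"
    using A_pow_C_pow[of 1 r] n by simp
  have 2: "C [^] int r \<otimes> B = B [^] int k \<otimes> C [^] int r"
    using C_pow_B_pow[of r 1] k by simp
  have "A \<otimes> (B [^] int k \<otimes> C [^] int r) = (A \<otimes> C [^] int r) \<otimes> B"
    by (simp add: m_assoc flip: 2)
  also have "\<dots> = C [^] int r \<otimes> (A [^] int n \<otimes> B)" by (simp add: 1 m_assoc)
  also have "\<dots> = (C [^] int r \<otimes> B) \<otimes> (C [^] int n \<otimes> A [^] ?g)" by (simp add: A_pow_B m_assoc)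
  also have "\<dots> = B [^] int k \<otimes> (C [^] int (n + r) \<otimes> A [^] ?g)"
    by (simp add: 2 m_assoc int_pow_mult_assoc add.commute)
  also have "C [^] int (n + r) \<otimes> A [^] ?g = C [^] int (n + r) \<otimes> A [^] (\<alpha> ^ (n + r)) \<otimes> A [^] (?g - \<alpha> ^ (n + r))"
    by (simp add: m_assoc flip: int_pow_mult)
  also have "\<dots> = A \<otimes> ?R"
    using A_pow_C_pow[of 1 "n + r"] by (simp add: m_assoc flip: m_assoc[of A])
  also have "B [^] int k \<otimes> (A \<otimes> ?R) = A \<otimes> (C [^] (- int k) \<otimes> B [^] ?h \<otimes> ?R)"
    by (simp add: B_pow_A m_assoc flip: m_assoc[of "B [^] int k" A])
  finally have "B [^] int k \<otimes> C [^] int r = C [^] (- int k) \<otimes> B [^] ?h \<otimes> ?R" by simp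
  then have "C [^] int k \<otimes> (B [^] int k \<otimes> C [^] int r) = C [^] int k \<otimes> (C [^] (- int k) \<otimes> B [^] ?h \<otimes> ?R)"
    by simp
  also have "\<dots> = B [^] ?h \<otimes> ?R" by (simp add: m_assoc int_pow_mult_assoc)
  also have "C [^] int k \<otimes> (B [^] int k \<otimes> C [^] int r) = B [^] (\<beta> ^ (k + r)) \<otimes> C [^] int (k + r)"
  proof -
    have "C [^] int k \<otimes> (B [^] int k \<otimes> C [^] int r) = (C [^] int k \<otimes> B [^] int k) \<otimes> C [^] int r"
      by (simp add: m_assoc)
    also have "\<dots> = B [^] (int k * \<beta> ^ k) \<otimes> C [^] int (k + r)"
      by (simp add: C_pow_B_pow m_assoc int_pow_mult)
    finally show ?thesis by (simp add: k power_add mult.commute)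
  qed
  finally have "B [^] (- ?h) \<otimes> (B [^] (\<beta> ^ (k + r)) \<otimes> C [^] int (k + r)) = B [^] (- ?h) \<otimes> (B [^] ?h \<otimes> ?R)"
    by simp
  then show ?thesis by (simp add: int_pow_mult_assoc)
qed

text \<open>To remove C^s from B^x C^s = C^s W, the equation is brought to the form B^i C^(2s) =
  C^(2s) W and raised to the power F = \<beta>^(2s): then (B^i)^F C^(2s) is also C^(2s) B^i.\<close>

lemma key_relation:
  assumes n: "int n = \<alpha> ^ r" and k: "int k = \<beta> ^ r" and "k \<le> n" "odd \<beta>"
  obtains F where "odd F" "C [^] int ((n - k) * F) \<otimes>
      A [^] ((\<alpha> * geom \<alpha> n - \<alpha> ^ (n + r)) * geom (\<alpha> ^ (n - k)) F)
    = B [^] ((\<beta> ^ (k + r) - \<beta> * geom \<beta> k) * \<beta> ^ (k + r))"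
proof -
  define s where "s = k + r"
  define y where "y = \<alpha> * geom \<alpha> n - \<alpha> ^ (n + r)"
  define x where "x = \<beta> ^ s - \<beta> * geom \<beta> k"
  define W where "W = C [^] int (n - k) \<otimes> A [^] y"
  \<comment> \<open>The even exponent 2 s makes this power of \<beta> nonnegative for either sign,
    so that \<open>CA_pow\<close> applies to it.\<close>
  define F where "F = nat (\<beta> ^ (2 * s))"
  have [simp]: "W \<in> carrier G" by (simp add: W_def)
  have F: "int F = \<beta> ^ (2 * s)" by (simp add: F_def)
  then have "odd F" using assms(4) by (metis even_of_nat even_power)
  have 1: "B [^] x \<otimes> C [^] int s = C [^] int s \<otimes> W"
    using B_pow_C_pow_eq[OF n k] assms(3)
    by (simp add: x_def y_def s_def W_def int_pow_mult_assoc add.commute)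
  have "B [^] (x * \<beta> ^ s) \<otimes> C [^] int (2 * s) = (B [^] (x * \<beta> ^ s) \<otimes> C [^] int s) \<otimes> C [^] int s"
    by (simp add: m_assoc flip: int_pow_mult)
  also have "\<dots> = C [^] int s \<otimes> (C [^] int s \<otimes> W)"
    by (simp add: m_assoc 1 flip: C_pow_B_pow)
  also have "\<dots> = C [^] int (2 * s) \<otimes> W" by (simp add: int_pow_mult_assoc)
  finally have "(B [^] (x * \<beta> ^ s)) [^] int F \<otimes> C [^] int (2 * s) = C [^] int (2 * s) \<otimes> W [^] int F"
    by (rule int_pow_intertwine) simp_all
  then have "C [^] int (2 * s) \<otimes> B [^] (x * \<beta> ^ s) = C [^] int (2 * s) \<otimes> W [^] int F"
    by (simp only: C_pow_B_pow int_pow_pow B_closed F)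
  then have "B [^] (x * \<beta> ^ s) = W [^] int F" by simp
  then show thesis
    by (intro that[of F]) (use \<open>odd F\<close> in \<open>simp_all add: W_def CA_pow x_def y_def s_def\<close>)
qed

end

subsection \<open>Finite orders\<close>

text \<open>If it vanished, dividing by x would show that x divides 1.\<close>

lemma key_exponent_nonzero:
  assumes "\<bar>x\<bar> > (1::int)" "n > 0"
  shows "x * geom x n - x ^ (n + 2) \<noteq> 0"
proof
  obtain n' where n': "n = Suc n'" using assms(2) by (cases n) auto
  assume "x * geom x n - x ^ (n + 2) = 0"
  then have "x * (1 + x * geom x n' - x * x ^ n) = 0"
    by (simp add: n' geom_Suc' algebra_simps power2_eq_square)
  then have "1 + x * geom x n' - x * x ^ n = 0" using assms(1) by (metis abs_0 mult_eq_0_iff not_one_less_zero)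
  then have "x * (x ^ n - geom x n') = 1" by (simp add: algebra_simps)
  then show False using assms zmult_eq_1_iff by force
qed

context macdonald
begin

lemma A_pow_commutes_C:
  fixes i :: int
  assumes "A [^] i \<otimes> B = B \<otimes> A [^] i"
  shows "A [^] i \<otimes> C = C \<otimes> A [^] i"
proof -
  have AA: "A [^] i \<otimes> A = A \<otimes> A [^] i" by (rule commutes_int_pow) simp_all
  have iA: "A [^] i \<otimes> inv A = inv A \<otimes> A [^] i"
    using commutes_int_pow2[of A A i "-1"] by (simp add: int_pow_neg)
  have iB: "A [^] i \<otimes> inv B = inv B \<otimes> A [^] i"
    using assms by (metis A_closed B_closed int_pow_closed inv_closed inv_solve_left inv_solve_right m_assoc m_closed)
  have "A [^] i \<otimes> C = A [^] i \<otimes> inv A \<otimes> inv B \<otimes> A \<otimes> B" by (simp add: gcomm_def m_assoc)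
  also have "\<dots> = inv A \<otimes> (A [^] i \<otimes> inv B) \<otimes> A \<otimes> B" by (simp add: iA m_assoc)
  also have "\<dots> = inv A \<otimes> inv B \<otimes> (A [^] i \<otimes> A) \<otimes> B" by (simp add: iB m_assoc)
  also have "\<dots> = inv A \<otimes> inv B \<otimes> A \<otimes> (A [^] i \<otimes> B)" by (simp add: AA m_assoc)
  also have "\<dots> = C \<otimes> A [^] i" by (simp add: assms gcomm_def m_assoc)
  finally show ?thesis .
qed

text \<open>Commuting with A and B means commuting with C, whereas conjugation by C multiplies the
  exponent by \<alpha>.\<close>

lemma A_pow_eq_one_if_central:
  fixes i :: int
  assumes "A [^] i \<otimes> B = B \<otimes> A [^] i"
  shows "A [^] (i * (\<alpha> - 1)) = \<one>"
proof -
  have "C \<otimes> A [^] (i * \<alpha>) = C \<otimes> A [^] i"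
    using A_pow_C_pow[of i 1] A_pow_commutes_C[OF assms] by simp
  then have "A [^] (i * \<alpha>) = A [^] i" by simp
  then show ?thesis by (simp add: right_diff_distrib int_pow_diff)
qed

lemma A_pow_commutes_B_if:
  fixes i j :: int
  assumes "A [^] i = B [^] j"
  shows "A [^] i \<otimes> B = B \<otimes> A [^] i"
  unfolding assms by (rule commutes_int_pow) simp_all

text \<open>Evaluating the commutator of \<open>A [^] y\<close> and \<open>B [^] x\<close> in two ways shows that it lies in
  the powers of \<open>A\<close> and in the powers of \<open>B\<close>, so that it is central.\<close>

lemma central_power:
  fixes x y :: int
  assumes rel: "C [^] int t \<otimes> A [^] y = B [^] x"
  shows "A [^] (y * (\<alpha> ^ t - 1)) = B [^] (- x * (\<beta> ^ t - 1))"
proof -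
  let ?c = "C [^] int t"
  have ca: "A \<otimes> ?c = ?c \<otimes> A [^] (\<alpha> ^ t)" using A_pow_C_pow[of 1 t] by simp
  have cb: "?c \<otimes> B = B [^] (\<beta> ^ t) \<otimes> ?c" using C_pow_B_pow[of t 1] by simp
  \<comment> \<open>B^x = C^t A^y conjugates A as C^t does, because A^y commutes with A; in the same
    way A^y = C^-t B^x conjugates B as C^-t does.\<close>
  have "A \<otimes> B [^] x = ?c \<otimes> (A [^] (\<alpha> ^ t) \<otimes> A [^] y)"
    by (simp add: ca flip: rel m_assoc)
  also have "\<dots> = B [^] x \<otimes> A [^] (\<alpha> ^ t)"
    by (simp add: int_pow_commutes_self[of A "\<alpha> ^ t"] m_assoc flip: rel)
  finally have 1: "A [^] y \<otimes> B [^] x = B [^] x \<otimes> A [^] (y * \<alpha> ^ t)"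
    using int_pow_intertwine[of A "B [^] x" _ y] by (simp add: int_pow_pow mult.commute)
  have aY: "A [^] y = inv ?c \<otimes> B [^] x" by (simp add: l_inv_assoc flip: rel)
  have "B \<otimes> A [^] y = inv ?c \<otimes> (?c \<otimes> B \<otimes> inv ?c \<otimes> B [^] x)"
    by (simp add: aY m_assoc l_inv_assoc)
  also have "?c \<otimes> B \<otimes> inv ?c = B [^] (\<beta> ^ t)" by (simp add: cb m_assoc)
  also have "inv ?c \<otimes> (B [^] (\<beta> ^ t) \<otimes> B [^] x) = A [^] y \<otimes> B [^] (\<beta> ^ t)"
    by (simp add: aY m_assoc int_pow_commutes_self[of B "\<beta> ^ t"])
  finally have 2: "B [^] x \<otimes> A [^] y = A [^] y \<otimes> B [^] (x * \<beta> ^ t)"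
    using int_pow_intertwine[of B "A [^] y" _ x] by (simp add: int_pow_pow mult.commute)
  have "B [^] x \<otimes> A [^] y \<otimes> A [^] (y * (\<alpha> ^ t - 1)) = B [^] x \<otimes> A [^] (y * \<alpha> ^ t)"
    by (simp add: m_assoc right_diff_distrib flip: int_pow_mult)
  also have "\<dots> = A [^] y \<otimes> B [^] (x * \<beta> ^ t) \<otimes> B [^] (- x * (\<beta> ^ t - 1))"
    by (simp add: m_assoc right_diff_distrib flip: 1 int_pow_mult)
  also have "\<dots> = B [^] x \<otimes> A [^] y \<otimes> B [^] (- x * (\<beta> ^ t - 1))"
    by (simp only: 2)
  finally show ?thesis by simp
qed

text \<open>For t = 0 the relation itself equates nontrivial powers of A and B, otherwise
  \<open>central_power\<close> does. Such a common power commutes with both generators.\<close>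

lemma finite_orders_if_relation:
  fixes x y :: int
  assumes rel: "C [^] int t \<otimes> A [^] y = B [^] x" and "x \<noteq> 0" "y \<noteq> 0" "\<bar>\<alpha>\<bar> > 1" "\<bar>\<beta>\<bar> > 1"
  shows "\<exists>i j. i \<noteq> 0 \<and> j \<noteq> 0 \<and> A [^] (i::int) = \<one> \<and> B [^] (j::int) = \<one>"
proof -
  have "\<exists>i j. i \<noteq> 0 \<and> j \<noteq> 0 \<and> A [^] (i::int) = B [^] (j::int)"
  proof (cases "t = 0")
    case True
    then show ?thesis using assms by (intro exI[of _ y] exI[of _ x]) simp
  next
    case False
    have "z ^ t \<noteq> 1" if "\<bar>z\<bar> > 1" for z :: int
      using that False by (metis abs_1 one_less_power power_abs less_irrefl bot_nat_0.not_eq_extremum)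
    then show ?thesis using assms central_power[OF rel]
      by (intro exI[of _ "y * (\<alpha> ^ t - 1)"] exI[of _ "- x * (\<beta> ^ t - 1)"]) simp
  qed
  then obtain i j :: int where ij: "i \<noteq> 0" "j \<noteq> 0" "A [^] i = B [^] j" by blast
  have "A [^] (i * (\<alpha> - 1)) = \<one>"
    by (intro A_pow_eq_one_if_central A_pow_commutes_B_if[OF ij(3)])
  moreover have "B [^] (j * (\<beta> - 1)) = \<one>"
    by (intro macdonald.A_pow_eq_one_if_central[OF swap] macdonald.A_pow_commutes_B_if[OF swap ij(3)[symmetric]])
  ultimately show ?thesis using ij assms(4,5)
    by (intro exI[of _ "i * (\<alpha> - 1)"] exI[of _ "j * (\<beta> - 1)"]) auto
qed

lemma finite_orders_le:
  assumes "odd \<alpha>" "odd \<beta>" "\<bar>\<alpha>\<bar> > 1" "\<bar>\<beta>\<bar> > 1" "\<beta>\<^sup>2 \<le> \<alpha>\<^sup>2"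
  shows "\<exists>i j. i \<noteq> 0 \<and> j \<noteq> 0 \<and> A [^] (i::int) = \<one> \<and> B [^] (j::int) = \<one>"
proof -
  \<comment> \<open>r = 2 makes both squares natural whatever the signs; the assumption comparing
    them orders \<open>n\<close> and \<open>k\<close> as \<open>key_relation\<close>
    requires.\<close>
  define n k where "n = nat (\<alpha>\<^sup>2)" and "k = nat (\<beta>\<^sup>2)"
  have nk: "int n = \<alpha>\<^sup>2" "int k = \<beta>\<^sup>2" "k \<le> n" using assms(5) by (auto simp: n_def k_def)
  obtain F where F: "odd F" "C [^] int ((n - k) * F) \<otimes>
      A [^] ((\<alpha> * geom \<alpha> n - \<alpha> ^ (n + 2)) * geom (\<alpha> ^ (n - k)) F)
    = B [^] ((\<beta> ^ (k + 2) - \<beta> * geom \<beta> k) * \<beta> ^ (k + 2))"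
    using key_relation[OF nk assms(2)] by blast
  have "n > 0" "k > 0" using nk assms by (auto simp: n_def k_def)
  moreover have "geom (\<alpha> ^ (n - k)) F \<noteq> 0" using odd_geom[of "\<alpha> ^ (n - k)" F] F(1) assms(1) by force
  ultimately show ?thesis
    using assms key_exponent_nonzero[of \<alpha> n] key_exponent_nonzero[of \<beta> k]
    by (intro finite_orders_if_relation[OF F(2)]) auto
qed

lemma finite_orders:
  assumes "odd \<alpha>" "odd \<beta>" "\<bar>\<alpha>\<bar> > 1" "\<bar>\<beta>\<bar> > 1"
  obtains N where "N > 0" "A [^] int N = \<one>" "B [^] int N = \<one>"
proof -
  have "\<exists>i j. i \<noteq> 0 \<and> j \<noteq> 0 \<and> A [^] (i::int) = \<one> \<and> B [^] (j::int) = \<one>"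
    using finite_orders_le[OF assms] macdonald.finite_orders_le[OF swap assms(2,1,4,3)]
    by (meson linear)
  then obtain i j :: int where ij: "i \<noteq> 0" "j \<noteq> 0" "A [^] i = \<one>" "B [^] j = \<one>" by blast
  have "A [^] (i * j * (i * j)) = \<one>" "B [^] (j * i * (i * j)) = \<one>"
    using ij by (simp_all add: mult.assoc flip: int_pow_pow)
  moreover have "int (nat (i * j * (i * j))) = i * j * (i * j)" by simp
  moreover have "i * j * (i * j) > 0" using ij by (simp flip: power2_eq_square)
  ultimately show thesis by (intro that[of "nat (i * j * (i * j))"]) (simp_all add: mult.commute)
qed

end

section \<open>Counting elements of <A><C><B>\<close>

lemma (in group) card_cosets_of_powers:
  assumes H: "subgroup H G" "finite H" and b: "b \<in> carrier G" and n: "b [^] (n::nat) \<in> H" "n > 0"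
  shows "\<exists>d. d dvd n \<and> card {h \<otimes> b [^] i | h (i::nat). h \<in> H} = card H * d
    \<and> finite {h \<otimes> b [^] i | h (i::nat). h \<in> H}"
proof -
  interpret H: subgroup H G by fact
  \<comment> \<open>d is the number of distinct cosets H b^i. Their union need not be a subgroup, so
    the cosets are counted directly; d dividing n is what later controls the 2-part.\<close>
  define d where "d = (LEAST d::nat. d > 0 \<and> b [^] d \<in> H)"
  have d: "d > 0" "b [^] d \<in> H" unfolding d_def using n LeastI[of "\<lambda>d. d > 0 \<and> b [^] d \<in> H" n] by blast+
  have least: "b [^] e \<notin> H" if "e < d" "e > 0" for e
    using that not_less_Least[of e "\<lambda>d. d > 0 \<and> b [^] d \<in> H"] unfolding d_def by blast
  have split: "b [^] i = (b [^] d) [^] (i div d) \<otimes> b [^] (i mod d)" for i :: nat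
    using b by (simp add: nat_pow_pow nat_pow_mult)
  have pw: "(b [^] d) [^] (k::nat) \<in> H" for k using d(2) by (induction k) auto
  have "b [^] (n mod d) \<in> H"
  proof -
    have "b [^] (n mod d) = inv ((b [^] d) [^] (n div d)) \<otimes> b [^] n"
      using split[of n] b by (simp add: l_inv_assoc)
    then show ?thesis using pw n(1) by simp
  qed
  then have "d dvd n" using least[of "n mod d"] d(1) by (metis bot_nat_0.not_eq_extremum dvd_eq_mod_eq_0 mod_less_divisor)
  have im: "{h \<otimes> b [^] i | h (i::nat). h \<in> H} = (\<lambda>(h, i). h \<otimes> b [^] i) ` (H \<times> {..<d})"
  proof (intro subset_antisym subsetI)
    fix x assume "x \<in> {h \<otimes> b [^] i | h (i::nat). h \<in> H}"
    then obtain h i where x: "x = h \<otimes> b [^] (i::nat)" "h \<in> H" by blast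
    have "x = (h \<otimes> (b [^] d) [^] (i div d)) \<otimes> b [^] (i mod d)"
      using split[of i] b x by (simp add: m_assoc)
    then show "x \<in> (\<lambda>(h, i). h \<otimes> b [^] i) ` (H \<times> {..<d})"
      using x(2) pw d(1) by (intro image_eqI[of _ _ "(h \<otimes> (b [^] d) [^] (i div d), i mod d)"]) auto
  qed auto
  have le: "i = j" if e: "h \<otimes> b [^] i = k \<otimes> b [^] j" "h \<in> H" "k \<in> H" "i \<le> j" "j < d" for h k and i j :: nat
  proof -
    have "h \<otimes> b [^] i = (k \<otimes> b [^] (j - i)) \<otimes> b [^] i"
      using e b by (simp add: m_assoc nat_pow_mult)
    then have "h = k \<otimes> b [^] (j - i)" using e b by simp
    then have "b [^] (j - i) = inv k \<otimes> h" using e b by (simp add: l_inv_assoc)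
    then have "b [^] (j - i) \<in> H" using e by simp
    then show ?thesis using least[of "j - i"] e by force
  qed
  have "inj_on (\<lambda>(h, i). h \<otimes> b [^] i) (H \<times> {..<d})"
  proof (intro inj_onI, clarsimp)
    fix h k and i j :: nat assume e: "h \<in> H" "k \<in> H" "i < d" "j < d" "h \<otimes> b [^] i = k \<otimes> b [^] j"
    have "i = j" using le[of h i k j] le[of k j h i] e by (metis linear)
    then show "h = k \<and> i = j" using e b by simp
  qed
  then show ?thesis using \<open>d dvd n\<close> H(2) unfolding im by (auto simp: card_image)
qed

lemma (in group) int_pow_eq_nat_pow_mod:
  assumes "x \<in> carrier G" "x [^] int M = \<one>" "M > 0"
  shows "x [^] (i::int) = x [^] nat (i mod int M)"
proof -
  have "x [^] i = x [^] (int M * (i div int M) + i mod int M)" by (simp only: mult_div_mod_eq)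
  also have "\<dots> = (x [^] int M) [^] (i div int M) \<otimes> x [^] (i mod int M)"
    by (simp only: int_pow_mult int_pow_pow assms(1))
  also have "\<dots> = x [^] int (nat (i mod int M))" using assms by simp
  finally show ?thesis by (simp only: int_pow_int)
qed

context macdonald
begin

text \<open>Once A^N = 1, the formula for A^N B leaves C^N equal to a power of A.\<close>

lemma finite_orders3:
  assumes "odd \<alpha>" "odd \<beta>" "\<bar>\<alpha>\<bar> > 1" "\<bar>\<beta>\<bar> > 1"
  obtains M where "M > 0" "A [^] int M = \<one>" "B [^] int M = \<one>" "C [^] int M = \<one>"
proof -
  obtain N where N: "N > 0" "A [^] int N = \<one>" "B [^] int N = \<one>" using finite_orders[OF assms] by blast
  have "C [^] int N \<otimes> A [^] (\<alpha> * geom \<alpha> N) = \<one>"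
    using A_pow_B[of N] N by simp
  then have "C [^] int N = A [^] (- (\<alpha> * geom \<alpha> N))"
    by (simp add: int_pow_neg inv_equality[symmetric] eq_commute)
  then have "(C [^] int N) [^] int N = (A [^] int N) [^] (- (\<alpha> * geom \<alpha> N))"
    by (simp add: int_pow_pow mult.commute)
  then have "C [^] int (N * N) = \<one>" using N by (simp add: int_pow_pow)
  moreover have "A [^] int (N * N) = \<one>" "B [^] int (N * N) = \<one>"
    using N by (simp_all flip: int_pow_pow)
  ultimately show thesis using N by (intro that[of "N * N"]) simp_all
qed

end

locale finite_macdonald = macdonald +
  fixes M :: nat
  assumes gen: "carrier G = generate G {A, B}"
    and M_pos: "M > 0" and A_M: "A [^] int M = \<one>" and B_M: "B [^] int M = \<one>" and C_M: "C [^] int M = \<one>"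
begin

lemma finite_swap: "finite_macdonald G B A \<beta> \<alpha> M"
proof -
  have "carrier G = generate G {B, A}" by (simp only: gen insert_commute)
  moreover have "gcomm G B A [^] int M = \<one>" by (simp add: gcomm_swap int_pow_inv C_M)
  ultimately show ?thesis
    by (intro finite_macdonald.intro swap finite_macdonald_axioms.intro M_pos A_M B_M)
qed

text \<open>The relations depend on \<alpha> and \<beta> only modulo M. This is how both are later
  made positive.\<close>

lemma change_exponents: "finite_macdonald G A B (\<alpha> + int M * a) (\<beta> + int M * b) M"
proof -
  have "A [^] (\<alpha> + int M * a) = A [^] \<alpha>" "B [^] (\<beta> + int M * b) = B [^] \<beta>"
    by (simp_all add: int_pow_mult A_M B_M flip: int_pow_pow)
  then have "macdonald G A B (\<alpha> + int M * a) (\<beta> + int M * b)"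
    using rel_A rel_B by unfold_locales simp_all
  then show ?thesis
    by (intro finite_macdonald.intro finite_macdonald_axioms.intro gen M_pos A_M B_M C_M)
qed

text \<open>As C has finite order, a negative power of C is also a nonnegative one, so the
  restriction in \<open>A_pow_C_pow\<close> disappears and <C> normalizes <A>.\<close>

lemma C_pow_A_pow:
  fixes j k :: int
  shows "\<exists>k'. C [^] j \<otimes> A [^] k = A [^] (k'::int) \<otimes> C [^] j"
proof -
  define e where "e = nat ((- j) mod int M)"
  have e: "C [^] int e = inv (C [^] j)"
    using int_pow_eq_nat_pow_mod[OF C_closed C_M M_pos, of "- j"] by (simp add: e_def int_pow_neg int_pow_int)
  have "A [^] k \<otimes> inv (C [^] j) = inv (C [^] j) \<otimes> A [^] (k * \<alpha> ^ e)"
    using A_pow_C_pow[of k e] by (simp add: e)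
  then have "C [^] j \<otimes> A [^] k = A [^] (k * \<alpha> ^ e) \<otimes> C [^] j"
    by (metis A_closed C_closed int_pow_closed inv_closed inv_solve_left inv_solve_right m_assoc m_closed)
  then show ?thesis by blast
qed

lemma A_pow_C_pow_ex:
  fixes j k :: int
  shows "\<exists>k'. A [^] k \<otimes> C [^] j = C [^] j \<otimes> A [^] (k'::int)"
proof -
  have "C [^] int (nat (j mod int M)) = C [^] j"
    by (simp only: int_pow_int int_pow_eq_nat_pow_mod[OF C_closed C_M M_pos, of j])
  then show ?thesis using A_pow_C_pow[of k "nat (j mod int M)"] by (simp only:) blast
qed

text \<open>Only the exponent of C is followed here; the power of A is irrelevant modulo
  <A>.\<close>

lemma CA_int_pow:
  fixes e i j :: int
  shows "\<exists>i'. (C [^] j \<otimes> A [^] i) [^] e = C [^] (j * e) \<otimes> A [^] (i'::int)"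
proof -
  let ?W = "C [^] j \<otimes> A [^] i"
  have nat: "\<exists>i'. ?W [^] int n = C [^] (j * int n) \<otimes> A [^] (i'::int)" for n
  proof (induction n)
    case (Suc n)
    then obtain i' :: int where i': "?W [^] int n = C [^] (j * int n) \<otimes> A [^] i'" by blast
    obtain i'' :: int where i'': "A [^] i' \<otimes> C [^] j = C [^] j \<otimes> A [^] i''" using A_pow_C_pow_ex by blast
    have "?W [^] int (Suc n) = C [^] (j * int n) \<otimes> ((A [^] i' \<otimes> C [^] j) \<otimes> A [^] i)"
      by (simp only: int_pow_Suc i') (simp add: m_assoc)
    also have "\<dots> = C [^] (j * int (Suc n)) \<otimes> A [^] (i'' + i)"
      by (simp add: i'' m_assoc int_pow_mult_assoc flip: int_pow_mult) (simp add: algebra_simps)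
    finally show ?case by blast
  qed (auto intro: exI[of _ 0])
  show ?thesis
  proof (cases e rule: int_cases2)
    case (nonpos n)
    obtain i' :: int where i': "?W [^] int n = C [^] (j * int n) \<otimes> A [^] i'" using nat by blast
    obtain i'' :: int where i'': "A [^] (- i') \<otimes> C [^] (- (j * int n)) = C [^] (- (j * int n)) \<otimes> A [^] i''"
      using A_pow_C_pow_ex by blast
    have "?W [^] e = inv (?W [^] int n)" by (simp add: nonpos int_pow_neg)
    also have "\<dots> = A [^] (- i') \<otimes> C [^] (- (j * int n))"
      by (simp add: i' inv_mult_group int_pow_neg)
    finally show ?thesis using i'' by (auto simp: nonpos)
  qed (use nat in auto)
qed

definition AC_subgroup where "AC_subgroup = {A [^] (i::int) \<otimes> C [^] (j::int) | i j. True}"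

lemma AC_subgroup: "subgroup AC_subgroup G"
proof
  show "AC_subgroup \<subseteq> carrier G" by (auto simp: AC_subgroup_def)
  show "\<one> \<in> AC_subgroup" unfolding AC_subgroup_def by (auto intro!: exI[of _ 0])
next
  fix x y assume "x \<in> AC_subgroup" "y \<in> AC_subgroup"
  then obtain i j k l :: int where xy: "x = A [^] i \<otimes> C [^] j" "y = A [^] k \<otimes> C [^] l"
    unfolding AC_subgroup_def by blast
  obtain k' :: int where k': "C [^] j \<otimes> A [^] k = A [^] k' \<otimes> C [^] j" using C_pow_A_pow by blast
  have "x \<otimes> y = A [^] i \<otimes> ((C [^] j \<otimes> A [^] k) \<otimes> C [^] l)" by (simp add: xy m_assoc)
  also have "\<dots> = A [^] (i + k') \<otimes> C [^] (j + l)"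
    by (simp add: k' m_assoc int_pow_mult_assoc flip: int_pow_mult)
  finally show "x \<otimes> y \<in> AC_subgroup" unfolding AC_subgroup_def by blast
next
  fix x assume "x \<in> AC_subgroup"
  then obtain i j :: int where x: "x = A [^] i \<otimes> C [^] j" unfolding AC_subgroup_def by blast
  obtain k' :: int where k': "C [^] (- j) \<otimes> A [^] (- i) = A [^] k' \<otimes> C [^] (- j)" using C_pow_A_pow by blast
  have "inv x = C [^] (- j) \<otimes> A [^] (- i)" by (simp add: x inv_mult_group int_pow_neg)
  then show "inv x \<in> AC_subgroup" unfolding AC_subgroup_def k' by blast
qed

lemma A_pow_in [simp]: "A [^] (i::int) \<in> AC_subgroup"
  unfolding AC_subgroup_def by (rule CollectI, rule exI[of _ i], rule exI[of _ 0]) simp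

lemma C_pow_in [simp]: "C [^] (i::int) \<in> AC_subgroup"
  unfolding AC_subgroup_def by (rule CollectI, rule exI[of _ 0], rule exI[of _ i]) simp

text \<open>The critical generator is A, for which B^i A = A C^(-i) B^e puts the product back into
  the form <A><C><B>. Inverses of the generators are positive powers of them.\<close>

lemma AC_B_right_mult:
  assumes g: "g \<in> generate G {A, B}" and x: "x \<in> {h \<otimes> B [^] i | h (i::nat). h \<in> AC_subgroup}"
  shows "x \<otimes> g \<in> {h \<otimes> B [^] i | h (i::nat). h \<in> AC_subgroup}" (is "_ \<in> ?K")
proof -
  interpret H: subgroup AC_subgroup G by (rule AC_subgroup)
  have KI: "h \<otimes> B [^] i \<in> ?K" if "h \<in> AC_subgroup" for h and i :: int
    using that int_pow_eq_nat_pow_mod[OF B_closed B_M M_pos, of i] by auto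
  have B: "x \<otimes> B \<in> ?K" if "x \<in> ?K" for x
  proof -
    obtain h i where x: "x = h \<otimes> B [^] (i::nat)" "h \<in> AC_subgroup" using \<open>x \<in> ?K\<close> by blast
    have "x \<otimes> B = h \<otimes> B [^] Suc i" using x by (simp add: m_assoc)
    then show ?thesis using x(2) by blast
  qed
  have A: "x \<otimes> A \<in> ?K" if "x \<in> ?K" for x
  proof -
    obtain h i where x: "x = h \<otimes> B [^] (i::nat)" "h \<in> AC_subgroup" using \<open>x \<in> ?K\<close> by blast
    have "x \<otimes> A = h \<otimes> (B [^] int i \<otimes> A)" using x by (simp add: m_assoc int_pow_int)
    also have "\<dots> = (h \<otimes> (A [^] (1::int) \<otimes> C [^] (- int i))) \<otimes> B [^] (\<beta> * geom \<beta> i)"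
      using x by (simp add: B_pow_A m_assoc)
    finally show ?thesis using x(2) by (simp only:) (intro KI H.m_closed A_pow_in C_pow_in)
  qed
  have pw: "x \<otimes> g [^] (n::nat) \<in> ?K" if "x \<in> ?K" "g \<in> {A, B}" for x g n
  proof (induction n)
    case 0
    have "x \<in> carrier G" using that(1) by auto
    then show ?case using that(1) by simp
  next
    case (Suc n)
    have c: "x \<in> carrier G" "g \<in> carrier G" using that by auto
    have "x \<otimes> g [^] Suc n = (x \<otimes> g [^] n) \<otimes> g" using c by (simp add: m_assoc)
    then show ?case using Suc A B that(2) by auto
  qed
  have inv: "inv g = g [^] (M - 1)" if "g \<in> {A, B}" for g
  proof -
    have "g \<in> carrier G" "g [^] M = \<one>" using that A_M B_M by (auto simp: int_pow_int)
    moreover have "g [^] (M - 1) \<otimes> g = g [^] M" using M_pos by (cases M) simp_all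
    ultimately show ?thesis by (simp add: inv_equality)
  qed
  have K_sub: "?K \<subseteq> carrier G" by auto
  show ?thesis using g x
  proof (induction arbitrary: x rule: generate.induct)
    case one
    then have "x \<in> carrier G" using K_sub by blast
    then show ?case using one by simp
  next
    case (incl h)
    then show ?case using A B by blast
  next
    case (inv h)
    then show ?case using pw[OF inv.prems inv.hyps, of "M - 1"] \<open>\<And>g. g \<in> {A, B} \<Longrightarrow> inv g = g [^] (M - 1)\<close> by simp
  next
    case (eng h1 h2)
    have "h1 \<in> carrier G" "h2 \<in> carrier G" "x \<in> carrier G"
      using eng.hyps generate_in_carrier[of "{A, B}"] eng.prems K_sub by auto
    then show ?case using eng.IH(2)[OF eng.IH(1)[OF eng.prems]] by (simp add: m_assoc)
  qed
qed

lemma carrier_eq: "carrier G = {h \<otimes> B [^] i | h (i::nat). h \<in> AC_subgroup}" (is "_ = ?K")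
proof
  have "\<one> \<otimes> B [^] (0::nat) \<in> ?K" using subgroup.one_closed[OF AC_subgroup] by blast
  then have one: "\<one> \<in> ?K" by simp
  show "carrier G \<subseteq> ?K"
  proof
    fix g assume g: "g \<in> carrier G"
    then have "g \<in> generate G {A, B}" using gen by (rule back_subst[where P="\<lambda>S. g \<in> S"])
    then have "\<one> \<otimes> g \<in> ?K" using one by (rule AC_B_right_mult)
    then show "g \<in> ?K" by (simp only: l_one[OF g])
  qed
  show "?K \<subseteq> carrier G" using subgroup.subset[OF AC_subgroup] by auto
qed

text \<open>Three coset counts, along 1, <A>, <A><C> and G. The result is a divisibility and not an
  inequality, since only its 2-part will matter.\<close>

lemma order_factorization:
  assumes A: "A [^] (a::nat) = \<one>" "a > 0"
    and C: "C [^] (c::nat) = A [^] (i::int)" "c > 0"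
    and B: "B [^] (b::nat) \<in> AC_subgroup" "b > 0"
  shows "order G dvd a * c * b" and "finite (carrier G)"
proof -
  let ?A = "{A [^] (i::int) | i. True}"
  have sA: "subgroup ?A G"
  proof
    show "\<one> \<in> ?A" by (auto intro: exI[of _ 0])
    fix x y assume "x \<in> ?A" "y \<in> ?A"
    then show "x \<otimes> y \<in> ?A" by (auto simp flip: int_pow_mult)
  next
    fix x assume "x \<in> ?A"
    then show "inv x \<in> ?A" by (auto simp flip: int_pow_neg)
  qed auto
  have A': "?A = {h \<otimes> A [^] i | h (i::nat). h \<in> {\<one>}}"
  proof (intro subset_antisym subsetI)
    fix x assume "x \<in> ?A"
    then show "x \<in> {h \<otimes> A [^] i | h (i::nat). h \<in> {\<one>}}"
      using int_pow_eq_nat_pow_mod[OF A_closed A_M M_pos] by auto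
  next
    fix x assume "x \<in> {h \<otimes> A [^] i | h (i::nat). h \<in> {\<one>}}"
    then show "x \<in> ?A" by (auto simp flip: int_pow_int)
  qed
  have C': "AC_subgroup = {h \<otimes> C [^] i | h (i::nat). h \<in> ?A}"
  proof (intro subset_antisym subsetI)
    fix x assume "x \<in> AC_subgroup"
    then show "x \<in> {h \<otimes> C [^] i | h (i::nat). h \<in> ?A}"
      using int_pow_eq_nat_pow_mod[OF C_closed C_M M_pos] unfolding AC_subgroup_def by auto
  next
    fix x assume "x \<in> {h \<otimes> C [^] i | h (i::nat). h \<in> ?A}"
    then show "x \<in> AC_subgroup" unfolding AC_subgroup_def by (auto simp flip: int_pow_int)
  qed
  have "\<exists>d. d dvd a \<and> card ?A = card {\<one>} * d \<and> finite ?A"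
    unfolding A' by (rule card_cosets_of_powers[OF triv_subgroup _ A_closed _ A(2)]) (simp_all add: A(1))
  then obtain d0 where d0: "d0 dvd a" "card ?A = d0" "finite ?A" by auto
  have "C [^] c \<in> ?A" using C(1) by blast
  then have "\<exists>d. d dvd c \<and> card AC_subgroup = card ?A * d \<and> finite AC_subgroup"
    unfolding C' by (rule card_cosets_of_powers[OF sA d0(3) C_closed _ C(2)])
  then obtain d1 where d1: "d1 dvd c" "card AC_subgroup = card ?A * d1" "finite AC_subgroup" by blast
  obtain d2 where d2: "d2 dvd b" "card (carrier G) = card AC_subgroup * d2" "finite (carrier G)"
    using card_cosets_of_powers[OF AC_subgroup d1(3) B_closed B] unfolding carrier_eq[symmetric] by blast
  show "finite (carrier G)" by (rule d2(3))
  show "order G dvd a * c * b" using d0 d1 d2 by (simp add: order_def mult_dvd_mono)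
qed

end

subsection \<open>The 2-part of the order\<close>

text \<open>Twice the quantity is -(x - 1)^2 modulo 2^(3m) by the case j = 1 of
  \<open>two_power_dvd_key_exponent\<close>, and (x - 1)^2 has valuation 2m < 3m.\<close>

lemma key_exponent_valuation:
  fixes x :: int
  assumes "x - 1 = 2 ^ m * w" "odd w" "m \<ge> 1" "int n = x"
  obtains q where "odd q" "x * geom x n - x ^ (n + 1) = 2 ^ (2 * m - 1) * q"
proof -
  define y where "y = x * geom x n - x ^ (n + 1)"
  have "2 ^ (3 * m) dvd 2 * y + (x - 1)\<^sup>2"
    using two_power_dvd_key_exponent[of m x n 1] assms by (simp add: y_def add.commute)
  then obtain c where "2 * y + (x - 1)\<^sup>2 = 2 ^ (3 * m) * c" by blast
  moreover have "(2::int) ^ (3 * m) = 2 ^ (2 * m) * 2 ^ m" by (simp flip: power_add)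
  moreover have "(x - 1)\<^sup>2 = 2 ^ (2 * m) * w\<^sup>2"
    unfolding assms(1) by (simp add: power_mult_distrib mult.commute flip: power_mult)
  ultimately have "2 * y = 2 ^ (2 * m) * (2 ^ m * c - w\<^sup>2)" by (simp add: algebra_simps)
  also have "(2::int) ^ (2 * m) = 2 * 2 ^ (2 * m - 1)" using assms(3) by (simp flip: power_Suc)
  finally have "y = 2 ^ (2 * m - 1) * (2 ^ m * c - w\<^sup>2)" by simp
  then show thesis using assms(2,3) by (intro that[of "2 ^ m * c - w\<^sup>2"]) (simp_all add: y_def)
qed

locale dyadic_macdonald = finite_macdonald +
  fixes m :: nat and u v :: int
  assumes m_ge_1: "m \<ge> 1" and \<alpha>_eq: "\<alpha> - 1 = 2 ^ m * u" and \<beta>_eq: "\<beta> - 1 = 2 ^ m * v"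
    and odd_u: "odd u" and odd_v: "odd v" and \<alpha>_\<beta>: "2 ^ (2 * m) dvd \<alpha> - \<beta>"
begin

lemma dyadic_swap: "dyadic_macdonald G B A \<beta> \<alpha> M m v u"
  using m_ge_1 \<alpha>_eq \<beta>_eq odd_u odd_v \<alpha>_\<beta>
  by (intro dyadic_macdonald.intro finite_swap dyadic_macdonald_axioms.intro) (simp_all add: dvd_diff_commute)

lemma odd_\<alpha>: "odd \<alpha>" and odd_\<beta>: "odd \<beta>"
proof -
  have "even ((2::int) ^ m * x)" for x using m_ge_1 by simp
  then have "even (\<alpha> - 1)" "even (\<beta> - 1)" unfolding \<alpha>_eq \<beta>_eq by blast+
  then show "odd \<alpha>" "odd \<beta>" by simp_all
qed

text \<open>Taking r = 1, the exponent of C in \<open>key_relation\<close> is a multiple of n - k =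
  \<alpha> - \<beta>, where the hypothesis on this difference enters.\<close>

lemma relation_if_positive:
  assumes "0 < \<beta>" "\<beta> \<le> \<alpha>"
  obtains t and x y :: int where "C [^] int t \<otimes> A [^] (2 ^ (2 * m - 1) * y) = B [^] (2 ^ (2 * m - 1) * x)"
    "2 ^ (2 * m) dvd t" "odd x" "odd y"
proof -
  define n k where "n = nat \<alpha>" and "k = nat \<beta>"
  have nk: "int n = \<alpha>" "int k = \<beta>" "k \<le> n" using assms by (auto simp: n_def k_def)
  obtain F where F: "odd F" "C [^] int ((n - k) * F) \<otimes>
      A [^] ((\<alpha> * geom \<alpha> n - \<alpha> ^ (n + 1)) * geom (\<alpha> ^ (n - k)) F)
    = B [^] ((\<beta> ^ (k + 1) - \<beta> * geom \<beta> k) * \<beta> ^ (k + 1))"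
    using key_relation[of n 1 k] nk odd_\<beta> by auto
  obtain y where y: "odd y" "\<alpha> * geom \<alpha> n - \<alpha> ^ (n + 1) = 2 ^ (2 * m - 1) * y"
    using key_exponent_valuation[OF \<alpha>_eq odd_u m_ge_1 nk(1)] by blast
  obtain x where x: "odd x" "\<beta> * geom \<beta> k - \<beta> ^ (k + 1) = 2 ^ (2 * m - 1) * x"
    using key_exponent_valuation[OF \<beta>_eq odd_v m_ge_1 nk(2)] by blast
  have x': "\<beta> ^ (k + 1) - \<beta> * geom \<beta> k = 2 ^ (2 * m - 1) * (- x)" using x(2) by (simp add: algebra_simps)
  have "odd (geom (\<alpha> ^ (n - k)) F)" using odd_geom F(1) odd_\<alpha> by simp
  moreover have "2 ^ (2 * m) dvd n - k"
  proof -
    have "int (2 ^ (2 * m)) dvd int (n - k)" using \<alpha>_\<beta> nk by (simp add: of_nat_diff)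
    then show ?thesis by (simp only: int_dvd_int_iff)
  qed
  ultimately show thesis
    using F x(1) y(1) odd_\<beta> unfolding y(2) x' mult.assoc
    by (intro that[of "(n - k) * F" "y * geom (\<alpha> ^ (n - k)) F" "- x * \<beta> ^ (k + 1)"]) simp_all
qed

lemma relation:
  obtains t y and x :: int where "C [^] int t \<otimes> A [^] int (2 ^ (2 * m - 1) * y) = B [^] (2 ^ (2 * m - 1) * x)"
    "2 ^ (2 * m) dvd t" "odd x" "odd y"
proof -
  \<comment> \<open>Shifts by multiples of M leave the relations intact, and the factor 2^m P keeps
    the cofactors odd and the difference divisible by P. \<open>b\<close> makes \<beta> positive,
    and a - b = |\<alpha>| + |\<beta>| puts the new \<alpha> above the new \<beta>.\<close>
  define b where "b = nat (1 + \<bar>\<beta>\<bar>)"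
  define a where "a = nat (\<bar>\<alpha>\<bar> + \<bar>\<beta>\<bar>) + b"
  define P :: int where "P = 2 ^ (2 * m)"
  have P: "P > 0" "2 dvd P" using m_ge_1 by (simp_all add: P_def)
  let ?\<alpha> = "\<alpha> + int M * (2 ^ m * P * int a)" and ?\<beta> = "\<beta> + int M * (2 ^ m * P * int b)"
  have "dyadic_macdonald G A B ?\<alpha> ?\<beta> M m (u + int M * P * int a) (v + int M * P * int b)"
  proof (intro dyadic_macdonald.intro dyadic_macdonald_axioms.intro change_exponents m_ge_1)
    show "2 ^ (2 * m) dvd ?\<alpha> - ?\<beta>"
    proof -
      have "?\<alpha> - ?\<beta> = (\<alpha> - \<beta>) + P * (int M * 2 ^ m * (int a - int b))" by (simp add: algebra_simps)
      moreover have "P dvd \<alpha> - \<beta>" using \<alpha>_\<beta> by (simp add: P_def)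
      ultimately show ?thesis unfolding P_def[symmetric] by (metis dvd_add dvd_triv_left)
    qed
  qed (use \<alpha>_eq \<beta>_eq odd_u odd_v P in \<open>simp_all add: algebra_simps\<close>)
  then interpret d: dyadic_macdonald G A B ?\<alpha> ?\<beta> M m "u + int M * P * int a" "v + int M * P * int b" .
  have Q: "int M * (2 ^ m * P) \<ge> 1" using M_pos P by (smt (verit) mult_pos_pos of_nat_0_less_iff zero_less_power)
  have "0 < ?\<beta>"
  proof -
    have "int M * (2 ^ m * P) * int b \<ge> 1 * int b" using Q by (intro mult_right_mono) simp_all
    then show ?thesis by (simp add: b_def mult.assoc)
  qed
  moreover have "?\<beta> \<le> ?\<alpha>"
  proof -
    have "int M * (2 ^ m * P) * (int a - int b) \<ge> 1 * (int a - int b)"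
      using Q by (intro mult_right_mono) (simp_all add: a_def)
    then show ?thesis by (simp add: a_def algebra_simps)
  qed
  ultimately obtain t and x y :: int where
    *: "C [^] int t \<otimes> A [^] (2 ^ (2 * m - 1) * y) = B [^] (2 ^ (2 * m - 1) * x)"
      "2 ^ (2 * m) dvd t" "odd x" "odd y"
    using d.relation_if_positive by blast
  \<comment> \<open>The shift is even, which keeps the exponent odd, and a multiple of M, which
    keeps the power of A.\<close>
  define y' where "y' = y + int M * (2 * \<bar>y\<bar>)"
  have "int M * (2 * \<bar>y\<bar>) \<ge> 1 * (2 * \<bar>y\<bar>)" using M_pos by (intro mult_right_mono) simp_all
  then have "y' \<ge> 0" by (simp add: y'_def)
  have "A [^] (2 ^ (2 * m - 1) * y') = A [^] (2 ^ (2 * m - 1) * y)"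
  proof -
    have "2 ^ (2 * m - 1) * y' = 2 ^ (2 * m - 1) * y + int M * (2 ^ (2 * m - 1) * (2 * \<bar>y\<bar>))"
      by (simp add: y'_def algebra_simps)
    then show ?thesis by (simp add: int_pow_mult A_M flip: int_pow_pow[of A "int M"])
  qed
  moreover have "odd y'" using *(4) by (simp add: y'_def)
  ultimately show thesis using * \<open>y' \<ge> 0\<close>
    by (intro that[of t "nat y'" x]) (simp_all add: even_nat_iff)
qed

text \<open>Multiplying B^(P x) = C^t A^y by B on the right and moving that B to the front gives a
  second expression, B^(P (x - 2 p)) = C^(t + y) A^g. Equating the power x - 2 p of the first with
  the power x of the second puts C^(P q) into <A>; q is odd because x and y / P are odd and t / P is
  even.\<close>

lemma C_pow_in_A_powers:
  obtains q :: nat and i :: int where "odd q" "C [^] (2 ^ (2 * m - 1) * q) = A [^] i"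
proof -
  define P :: int where "P = 2 ^ (2 * m - 1)"
  have PP: "2 ^ (2 * m) = 2 * P" using m_ge_1 by (simp add: P_def flip: power_Suc)
  obtain t y0 and x :: int where rel0: "C [^] int t \<otimes> A [^] int (2 ^ (2 * m - 1) * y0) = B [^] (2 ^ (2 * m - 1) * x)"
    and t: "2 ^ (2 * m) dvd t" and xy0: "odd x" "odd y0"
    using relation by blast
  define y where "y = 2 ^ (2 * m - 1) * y0"
  have rel: "C [^] int t \<otimes> A [^] int y = B [^] (P * x)" using rel0 by (simp only: y_def P_def)
  let ?g = "\<alpha> * geom \<alpha> y"
  have "2 ^ (m + 2 * m) dvd \<beta> ^ t - 1"
    using two_power_dvd_power_diff[of m \<beta> "2 * m" t] \<beta>_eq m_ge_1 t by simp
  moreover have "(2::int) ^ (2 * m) dvd 2 ^ (m + 2 * m)" by (simp add: le_imp_power_dvd)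
  ultimately have "2 * P dvd \<beta> ^ t - 1" unfolding PP by (rule dvd_trans[rotated])
  then obtain p where p: "\<beta> ^ t - 1 = 2 * P * p" by blast
  have "B [^] (P * x + 1) = C [^] int t \<otimes> (A [^] int y \<otimes> B)"
    by (simp add: int_pow_mult m_assoc flip: rel)
  also have "\<dots> = (C [^] int t \<otimes> B) \<otimes> (C [^] int y \<otimes> A [^] ?g)" by (simp add: A_pow_B m_assoc)
  also have "C [^] int t \<otimes> B = B [^] (\<beta> ^ t) \<otimes> C [^] int t" using C_pow_B_pow[of t 1] by simp
  also have "B [^] (\<beta> ^ t) \<otimes> C [^] int t \<otimes> (C [^] int y \<otimes> A [^] ?g)
      = B [^] (\<beta> ^ t) \<otimes> (C [^] (int t + int y) \<otimes> A [^] ?g)"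
    by (simp add: m_assoc int_pow_mult_assoc)
  finally have "B [^] (- (\<beta> ^ t)) \<otimes> B [^] (P * x + 1) = C [^] (int t + int y) \<otimes> A [^] ?g"
    by (simp add: int_pow_mult_assoc)
  moreover have "- (\<beta> ^ t) + (P * x + 1) = P * (x - 2 * p)" using p by (simp add: algebra_simps)
  ultimately have rel2: "B [^] (P * (x - 2 * p)) = C [^] (int t + int y) \<otimes> A [^] ?g"
    by (simp flip: int_pow_mult)
  obtain i :: int where i: "B [^] (P * x * (x - 2 * p)) = C [^] (int t * (x - 2 * p)) \<otimes> A [^] i"
    using CA_int_pow[of "int t" "int y" "x - 2 * p"] by (auto simp: rel int_pow_pow)
  obtain j :: int where j: "B [^] (P * (x - 2 * p) * x) = C [^] ((int t + int y) * x) \<otimes> A [^] j"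
    using CA_int_pow[of "int t + int y" ?g x] by (auto simp: int_pow_pow simp flip: rel2)
  obtain t0 where t0: "int t = 2 * P * t0" using t PP by (metis dvdE of_nat_dvd_iff of_nat_numeral of_nat_power)
  define q where "q = 2 * t0 * (x - 2 * p) - (2 * t0 + int y0) * x"
  have "C [^] (int t * (x - 2 * p)) \<otimes> A [^] i = C [^] ((int t + int y) * x) \<otimes> A [^] j"
    using i j by (simp only: mult_ac)
  then have "C [^] (- ((int t + int y) * x)) \<otimes> (C [^] (int t * (x - 2 * p)) \<otimes> A [^] i) = A [^] j"
    by (simp add: int_pow_mult_assoc)
  then have "C [^] (P * q) \<otimes> A [^] i = A [^] j"
    by (simp add: int_pow_mult_assoc q_def t0 y_def P_def algebra_simps)
  then have "C [^] (P * q) = A [^] (j - i)"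
    by (simp add: int_pow_diff inv_solve_right' inv_solve_right)
  \<comment> \<open>The sign turns the exponent of C into a natural number.\<close>
  then have "C [^] (P * q * sgn q) = A [^] ((j - i) * sgn q)" by (simp flip: int_pow_pow)
  moreover have "q * sgn q = \<bar>q\<bar>" by (simp only: abs_sgn)
  then have "P * q * sgn q = int (2 ^ (2 * m - 1) * nat \<bar>q\<bar>)" by (simp add: P_def mult.assoc)
  moreover have "odd q" using xy0 by (simp add: q_def)
  ultimately show thesis
    by (intro that[of "nat \<bar>q\<bar>" "(j - i) * sgn q"]) (simp_all only: int_pow_int, simp add: even_nat_iff)
qed

text \<open>The bound for C, applied to A and to B, shows that an odd power of C^t lies in <B>.
  Raising C^t A^y = B^x to that power therefore puts a power of A into <B>; it is central and hence
  killed by \<alpha> - 1 = 2^m u. The factors for A, C and B are 2^m P, P and P, up to odd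
  numbers.\<close>

lemma order_dvd: "\<exists>q. odd q \<and> order G dvd 2 ^ (7 * m - 3) * q" and finite_carrier: "finite (carrier G)"
proof -
  define P :: nat where "P = 2 ^ (2 * m - 1)"
  obtain t y and x :: int
    where rel0: "C [^] int t \<otimes> A [^] int (2 ^ (2 * m - 1) * y) = B [^] (2 ^ (2 * m - 1) * x)"
    and t: "2 ^ (2 * m) dvd t" and xy: "odd x" "odd y"
    using relation by blast
  have rel: "C [^] int t \<otimes> A [^] int (P * y) = B [^] (int P * x)"
    using rel0 by (simp add: P_def)
  obtain c and i :: int where c: "odd c" "C [^] (P * c) = A [^] i"
    using C_pow_in_A_powers unfolding P_def by blast
  obtain c' and j :: int where "odd c'" "inv C [^] (P * c') = B [^] j"
    using dyadic_macdonald.C_pow_in_A_powers[OF dyadic_swap] unfolding P_def gcomm_swap by blast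
  then have c': "odd c'" "C [^] (P * c') = B [^] (- j)"
    by (simp_all add: nat_pow_inv int_pow_neg) (metis C_closed inv_inv nat_pow_closed)
  have "2 ^ (2 * m) = 2 * P" using m_ge_1 by (simp add: P_def flip: power_Suc)
  then obtain t0 where t0: "t = P * t0" using t by (metis dvdE mult.assoc mult.commute)
  define e where "e = c * c'"
  have "t * e = P * c' * (t0 * c)" by (simp add: t0 e_def mult_ac)
  then have "C [^] int (t * e) = (C [^] (P * c')) [^] int (t0 * c)"
    by (simp only: int_pow_int nat_pow_pow C_closed)
  then have "C [^] int (t * e) = B [^] (- j * int (t0 * c))"
    by (simp only: c' int_pow_pow B_closed)
  moreover have "C [^] int (t * e) \<otimes> A [^] (int (P * y) * geom (\<alpha> ^ t) e) = B [^] (int P * x * int e)"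
    using CA_pow[of t "int (P * y)" e] by (simp only: rel int_pow_pow B_closed)
  ultimately have "A [^] (int (P * y) * geom (\<alpha> ^ t) e) = B [^] (j * int (t0 * c) + int P * x * int e)"
    by (simp add: int_pow_mult int_pow_neg l_inv_assoc inv_solve_left')
  then have 1: "A [^] (int (P * y) * geom (\<alpha> ^ t) e * (\<alpha> - 1)) = \<one>"
    by (intro A_pow_eq_one_if_central A_pow_commutes_B_if)
  define a where "a = y * nat \<bar>geom (\<alpha> ^ t) e * u\<bar>"
  have "odd a" using xy odd_u odd_geom[of "\<alpha> ^ t" e] c c' odd_\<alpha> by (simp add: a_def e_def even_nat_iff)
  have "A [^] int (P * 2 ^ m * a) = \<one>"
  proof -
    let ?w = "geom (\<alpha> ^ t) e * u"
    have "?w * sgn ?w = \<bar>?w\<bar>" by (simp only: abs_sgn)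
    then have "int (P * 2 ^ m * a) = int P * 2 ^ m * int y * (?w * sgn ?w)"
      by (simp add: a_def)
    also have "\<dots> = int (P * y) * geom (\<alpha> ^ t) e * (\<alpha> - 1) * sgn ?w"
      unfolding \<alpha>_eq by (simp add: mult_ac)
    finally have "int (P * 2 ^ m * a) = int (P * y) * geom (\<alpha> ^ t) e * (\<alpha> - 1) * sgn ?w" .
    then show ?thesis using 1 by (simp only:) (simp flip: int_pow_pow)
  qed
  then have A: "A [^] (P * 2 ^ m * a) = \<one>" by (simp only: int_pow_int)
  define b where "b = nat \<bar>x\<bar>"
  have "odd b" using xy by (simp add: b_def even_nat_iff)
  have "B [^] int (P * b) \<in> AC_subgroup"
  proof -
    obtain k :: int where k: "B [^] (int P * x * sgn x) = C [^] (int t * sgn x) \<otimes> A [^] k"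
      using CA_int_pow[of "int t" "int (P * y)" "sgn x"] by (simp only: rel int_pow_pow B_closed) blast
    have "C [^] (int t * sgn x) \<otimes> A [^] k \<in> AC_subgroup"
      by (intro subgroup.m_closed[OF AC_subgroup] A_pow_in C_pow_in)
    moreover have "x * sgn x = \<bar>x\<bar>" by (simp only: abs_sgn)
    then have "int P * x * sgn x = int (P * b)" by (simp add: b_def mult.assoc)
    ultimately show ?thesis using k by (simp only:)
  qed
  then have B: "B [^] (P * b) \<in> AC_subgroup" by (simp only: int_pow_int)
  have pos: "P * 2 ^ m * a > 0" "P * c > 0" "P * b > 0"
    using \<open>odd a\<close> \<open>odd b\<close> c(1) by (auto simp: P_def intro: odd_pos)
  have "order G dvd P * 2 ^ m * a * (P * c) * (P * b)"
    by (rule order_factorization(1)[OF A pos(1) c(2) pos(2) B pos(3)])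
  moreover have "P * 2 ^ m * a * (P * c) * (P * b) = 2 ^ (7 * m - 3) * (a * c * b)"
  proof -
    have "7 * m - 3 = (2 * m - 1) + (2 * m - 1) + (2 * m - 1) + m" using m_ge_1 by simp
    then have "2 ^ (7 * m - 3) = P * P * P * 2 ^ m" unfolding P_def by (simp only: power_add)
    then show ?thesis by (simp add: mult_ac)
  qed
  moreover have "odd (a * c * b)" using \<open>odd a\<close> \<open>odd b\<close> c(1) by simp
  ultimately show "\<exists>q. odd q \<and> order G dvd 2 ^ (7 * m - 3) * q" by (intro exI[of _ "a * c * b"]) simp
  show "finite (carrier G)"
    by (rule order_factorization(2)[OF A pos(1) c(2) pos(2) B pos(3)])
qed

end

subsection \<open>Central series\<close>

context group
begin

lemma gcomm_closed [simp]: "x \<in> carrier G \<Longrightarrow> y \<in> carrier G \<Longrightarrow> gcomm G x y \<in> carrier G"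
  by (simp add: gcomm_def)

lemma gcomm_one [simp]: "x \<in> carrier G \<Longrightarrow> gcomm G x \<one> = \<one>" "x \<in> carrier G \<Longrightarrow> gcomm G \<one> x = \<one>"
  by (simp_all add: gcomm_def)

lemma gcomm_eq_one_if_commute:
  assumes "x \<otimes> y = y \<otimes> x" "x \<in> carrier G" "y \<in> carrier G"
  shows "gcomm G x y = \<one>"
  using assms by (simp add: gcomm_def m_assoc l_inv_assoc)

text \<open>The upper central series of P. The bound on the class comes from placing the generators
  in its fifth term.\<close>

fun ucs :: "'a set \<Rightarrow> nat \<Rightarrow> 'a set" where
  "ucs P 0 = {\<one>}"
| "ucs P (Suc n) = {x \<in> P. \<forall>g\<in>P. gcomm G x g \<in> ucs P n}"

definition normal_in :: "'a set \<Rightarrow> 'a set \<Rightarrow> bool" where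
  "normal_in N P \<longleftrightarrow> subgroup N G \<and> (\<forall>x\<in>N. \<forall>g\<in>P. inv g \<otimes> x \<otimes> g \<in> N)"

lemma normal_in_ucs: assumes P: "subgroup P G" shows "normal_in (ucs P n) P"
proof (induction n)
  case 0
  have "subgroup {\<one>} G" by (rule triv_subgroup)
  then show ?case using subgroup.mem_carrier[OF P] by (simp add: normal_in_def)
next
  case (Suc n)
  interpret P: subgroup P G by (rule P)
  let ?N = "ucs P n" and ?M = "ucs P (Suc n)"
  interpret N: subgroup ?N G using Suc by (simp add: normal_in_def)
  have conj: "inv g \<otimes> x \<otimes> g \<in> ?N" if "x \<in> ?N" "g \<in> P" for x g using that Suc by (simp add: normal_in_def)
  have "subgroup ?M G"
  proof
    fix x y assume xy: "x \<in> ?M" "y \<in> ?M"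
    have "gcomm G (x \<otimes> y) g \<in> ?N" if g: "g \<in> P" for g
    proof -
      have "gcomm G (x \<otimes> y) g = inv y \<otimes> gcomm G x g \<otimes> y \<otimes> gcomm G y g"
        using xy g by (simp add: gcomm_def inv_mult_group m_assoc r_inv_assoc)
      then show ?thesis using xy g conj by simp
    qed
    then show "x \<otimes> y \<in> ?M" using xy by simp
  next
    fix x assume x: "x \<in> ?M"
    have "gcomm G (inv x) g \<in> ?N" if g: "g \<in> P" for g
    proof -
      have "gcomm G (inv x) g = inv (inv x) \<otimes> inv (gcomm G x g) \<otimes> inv x"
        using x g by (simp add: gcomm_def inv_mult_group m_assoc r_inv_assoc)
      then show ?thesis using x g conj[of "inv (gcomm G x g)" "inv x"] by simp
    qed
    then show "inv x \<in> ?M" using x by simp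
  qed auto
  moreover have "inv g \<otimes> x \<otimes> g \<in> ?M" if x: "x \<in> ?M" and g: "g \<in> P" for x g
  proof -
    have "gcomm G (inv g \<otimes> x \<otimes> g) h \<in> ?N" if h: "h \<in> P" for h
    proof -
      have "gcomm G (inv g \<otimes> x \<otimes> g) h = inv g \<otimes> gcomm G x (g \<otimes> h \<otimes> inv g) \<otimes> g"
        using x g h by (simp add: gcomm_def inv_mult_group m_assoc l_inv_assoc r_inv_assoc)
      then show ?thesis using x g h conj by simp
    qed
    then show ?thesis using x g by simp
  qed
  ultimately show ?case unfolding normal_in_def by blast
qed

text \<open>Commutators with products and inverses expand into conjugates of commutators with the
  factors, and \<open>ucs P n\<close> is normalized by P.\<close>

lemma ucs_generatorsI:
  assumes E: "E \<subseteq> carrier G" and P: "P = generate G E" and x: "x \<in> P"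
    and comm: "\<And>g. g \<in> E \<Longrightarrow> gcomm G x g \<in> ucs P n"
  shows "x \<in> ucs P (Suc n)"
proof -
  interpret P: subgroup P G unfolding P by (rule generate_is_subgroup[OF E])
  interpret N: subgroup "ucs P n" G using normal_in_ucs[OF P.subgroup_axioms] by (simp add: normal_in_def)
  have conj: "inv g \<otimes> y \<otimes> g \<in> ucs P n" if "y \<in> ucs P n" "g \<in> P" for y g
    using that normal_in_ucs[OF P.subgroup_axioms, of n] by (simp add: normal_in_def)
  have inv: "gcomm G x (inv g) \<in> ucs P n" if "gcomm G x g \<in> ucs P n" "g \<in> P" for g
  proof -
    have "gcomm G x (inv g) = inv (inv g) \<otimes> inv (gcomm G x g) \<otimes> inv g"
      using x that by (simp add: gcomm_def inv_mult_group m_assoc r_inv_assoc)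
    then show ?thesis using conj[of "inv (gcomm G x g)" "inv g"] that by simp
  qed
  have "gcomm G x g \<in> ucs P n" if "g \<in> generate G E" for g using that
  proof (induction rule: generate.induct)
    case one
    then show ?case using x N.one_closed by simp
  next
    case (incl h)
    then show ?case by (rule comm)
  next
    case (inv h)
    then show ?case using \<open>\<And>g. gcomm G x g \<in> ucs P n \<Longrightarrow> g \<in> P \<Longrightarrow> gcomm G x (inv g) \<in> ucs P n\<close>
        comm generate.incl[of h E G] P by blast
  next
    case (eng h1 h2)
    then have h: "h1 \<in> P" "h2 \<in> P" by (simp_all add: P)
    have "gcomm G x (h1 \<otimes> h2) = gcomm G x h2 \<otimes> (inv h2 \<otimes> gcomm G x h1 \<otimes> h2)"
      using x h by (simp add: gcomm_def inv_mult_group m_assoc r_inv_assoc)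
    then show ?case using eng.IH h conj by simp
  qed
  then show ?thesis using x by (simp add: P)
qed

lemma ucs_mono: assumes "subgroup P G" shows "ucs P n \<subseteq> ucs P (Suc n)"
proof
  interpret P: subgroup P G by fact
  interpret N: subgroup "ucs P n" G using normal_in_ucs[OF assms] by (simp add: normal_in_def)
  fix x assume x: "x \<in> ucs P n"
  then have xP: "x \<in> P" by (cases n) auto
  have "gcomm G x g \<in> ucs P n" if g: "g \<in> P" for g
  proof -
    have "gcomm G x g = inv x \<otimes> (inv g \<otimes> x \<otimes> g)" using xP g by (simp add: gcomm_def m_assoc)
    moreover have "inv g \<otimes> x \<otimes> g \<in> ucs P n" using normal_in_ucs[OF assms, of n] x g by (simp add: normal_in_def)
    ultimately show ?thesis using x by simp
  qed
  then show "x \<in> ucs P (Suc n)" using xP by simp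
qed

lemma lcs_subgroup: assumes "subgroup P G" shows "subgroup (lcs G P i) G \<and> lcs G P i \<subseteq> P"
proof (induction i)
  case (Suc i)
  interpret P: subgroup P G by fact
  have *: "{gcomm G h k | h k. h \<in> lcs G P i \<and> k \<in> P} \<subseteq> P"
    using Suc by (auto simp: gcomm_def)
  have "generate G {gcomm G h k | h k. h \<in> lcs G P i \<and> k \<in> P} \<subseteq> P"
    using * assms by (rule generate_subgroup_incl)
  moreover have "subgroup (generate G {gcomm G h k | h k. h \<in> lcs G P i \<and> k \<in> P}) G"
    using * P.subset by (intro generate_is_subgroup) blast
  ultimately show ?case by (simp add: comm_subgroup_def)
qed (use assms in simp)

lemma gcomm_in_lcs: "h \<in> lcs G P i \<Longrightarrow> k \<in> P \<Longrightarrow> gcomm G h k \<in> lcs G P (Suc i)"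
  by (auto simp: comm_subgroup_def intro: generate.incl)

lemma lcs_Suc_trivial: assumes "subgroup P G" "lcs G P i = {\<one>}" shows "lcs G P (Suc i) = {\<one>}"
proof -
  have "{gcomm G h k | h k. h \<in> {\<one>} \<and> k \<in> P} = {\<one>}"
    using subgroup.one_closed[OF assms(1)] subgroup.mem_carrier[OF assms(1)] by force
  then show ?thesis
    using generate_subgroup_incl[OF _ triv_subgroup, of "{\<one>}"] generate.one[of G "{\<one>}"]
    by (auto simp: comm_subgroup_def assms(2))
qed

lemma lcs_subset_ucs:
  assumes P: "subgroup P G" "P = ucs P n" and "i \<le> n"
  shows "lcs G P i \<subseteq> ucs P (n - i)"
  using assms(3)
proof (induction i)
  case (Suc i)
  have s: "subgroup (ucs P (n - Suc i)) G" using normal_in_ucs[OF P(1)] by (simp add: normal_in_def)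
  have "n - i = Suc (n - Suc i)" using Suc by simp
  then have "{gcomm G h k | h k. h \<in> lcs G P i \<and> k \<in> P} \<subseteq> ucs P (n - Suc i)"
    using Suc by fastforce
  then show ?case using generate_subgroup_incl[OF _ s] by (simp add: comm_subgroup_def)
qed (use P in simp)

lemma lcs_trivial:
  assumes P: "subgroup P G" "P \<subseteq> ucs P n"
  shows "lcs G P n = {\<one>}"
proof -
  have "ucs P n \<subseteq> P" using subgroup.one_closed[OF P(1)] by (cases n) auto
  then have "lcs G P n \<subseteq> {\<one>}" using lcs_subset_ucs[of P n n] P by auto
  then show ?thesis using lcs_subgroup[OF P(1), of n] subgroup.one_closed by blast
qed

lemma nil_class_eqI:
  assumes P: "subgroup P G" "lcs G P (Suc c) = {\<one>}" "lcs G P c \<noteq> {\<one>}"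
  shows "nil_class G P = Suc c"
  unfolding nil_class_def
proof (rule Least_equality)
  fix d assume d: "lcs G P d = {\<one>}"
  show "Suc c \<le> d"
  proof (rule ccontr)
    assume "\<not> Suc c \<le> d"
    then have "d \<le> c" by simp
    then have "lcs G P c = {\<one>}"
      by (induction rule: dec_induct) (use d lcs_Suc_trivial[OF P(1)] in auto)
    then show False using P(3) by blast
  qed
qed (rule P(2))

end

lemma (in group_hom) hom_gcomm:
  assumes "x \<in> carrier G" "y \<in> carrier G" shows "h (gcomm G x y) = gcomm H (h x) (h y)"
  using assms by (simp add: gcomm_def)

lemma (in group_hom) lcs_image:
  assumes P: "subgroup P G" shows "lcs H (h ` P) i = h ` lcs G P i"
proof (induction i)
  case (Suc i)
  interpret P: subgroup P G by fact
  have c: "lcs G P i \<subseteq> carrier G" using G.lcs_subgroup[OF P] P.subset by blast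
  let ?E = "{gcomm G x k | x k. x \<in> lcs G P i \<and> k \<in> P}"
  have "{gcomm H x k | x k. x \<in> h ` lcs G P i \<and> k \<in> h ` P} = h ` ?E" (is "?F = _")
  proof (intro subset_antisym subsetI)
    fix y assume "y \<in> ?F"
    then obtain x k where "x \<in> lcs G P i" "k \<in> P" "y = gcomm H (h x) (h k)" by blast
    moreover from this have "y = h (gcomm G x k)" using c P.subset by (subst hom_gcomm) auto
    ultimately show "y \<in> h ` ?E" by blast
  next
    fix y assume "y \<in> h ` ?E"
    then obtain x k where "x \<in> lcs G P i" "k \<in> P" "y = h (gcomm G x k)" by blast
    moreover from this have "y = gcomm H (h x) (h k)" using c P.subset by (subst hom_gcomm[symmetric]) auto
    ultimately show "y \<in> ?F" by blast
  qed
  moreover have "?E \<subseteq> carrier G" using c P.subset by auto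
  ultimately show ?case using generate_img[of ?E] by (simp add: comm_subgroup_def Suc)
qed simp

lemma (in group_hom) nil_class_image:
  assumes P: "subgroup P G" and "inj_on h P" shows "nil_class H (h ` P) = nil_class G P"
proof -
  have "lcs H (h ` P) i = {\<one>\<^bsub>H\<^esub>} \<longleftrightarrow> lcs G P i = {\<one>}" for i
  proof -
    have s: "lcs G P i \<subseteq> P" and o: "\<one> \<in> lcs G P i"
      using G.lcs_subgroup[OF P, of i] subgroup.one_closed by blast+
    have "h ` lcs G P i = {\<one>\<^bsub>H\<^esub>} \<longleftrightarrow> lcs G P i = {\<one>}"
    proof
      assume *: "h ` lcs G P i = {\<one>\<^bsub>H\<^esub>}"
      have "x = \<one>" if "x \<in> lcs G P i" for x
        using * that assms(2) s o hom_one by (metis image_eqI inj_onD singletonD subsetD)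
      then show "lcs G P i = {\<one>}" using o by blast
    qed simp
    then show ?thesis by (simp add: lcs_image[OF P])
  qed
  then show ?thesis by (simp add: nil_class_def)
qed

lemma (in group) int_pow_dvd_in_subgroup:
  assumes "subgroup H G" "x [^] (d::int) \<in> H" "d dvd e" "x \<in> carrier G"
  shows "x [^] e \<in> H"
proof -
  obtain q where "e = d * q" using assms(3) by blast
  then have "x [^] e = (x [^] d) [^] q" using assms(4) by (simp add: int_pow_pow)
  then show ?thesis using subgroup_int_pow_closed[OF assms(1,2)] by simp
qed

section \<open>Commutators of the generators and the class\<close>

context macdonald
begin

abbreviation "P \<equiv> generate G {A, B}"

lemma subgroup_P: "subgroup P G" by (rule generate_is_subgroup) simp

lemma A_in_P: "A \<in> P" and B_in_P: "B \<in> P" by (auto intro: generate.incl)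

lemma C_in_P: "C \<in> P"
proof -
  interpret P: subgroup P G by (rule subgroup_P)
  show ?thesis using A_in_P B_in_P by (simp add: gcomm_def)
qed

lemma gcomm_C_pow_A: "gcomm G (C [^] int n) A = A [^] (1 - \<alpha> ^ n)"
proof -
  have "gcomm G (C [^] int n) A = inv (A \<otimes> C [^] int n) \<otimes> (C [^] int n \<otimes> A)"
    by (simp add: gcomm_def inv_mult_group m_assoc)
  also have "\<dots> = A [^] (- (\<alpha> ^ n)) \<otimes> A [^] (1::int)"
    using A_pow_C_pow[of 1 n] by (simp add: inv_mult_group m_assoc l_inv_assoc int_pow_neg)
  also have "\<dots> = A [^] (- (\<alpha> ^ n) + 1)" by (simp only: int_pow_mult A_closed)
  finally show ?thesis by simp
qed

lemma gcomm_A_pow_B: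
  "gcomm G (A [^] int n) B = C [^] int n \<otimes> A [^] (\<alpha> * geom \<alpha> n - int n * \<alpha> ^ n)"
proof -
  have "gcomm G (A [^] int n) B = A [^] (- int n) \<otimes> (inv B \<otimes> (A [^] int n \<otimes> B))"
    by (simp add: gcomm_def m_assoc int_pow_neg)
  also have "\<dots> = (A [^] (- int n) \<otimes> C [^] int n) \<otimes> A [^] (\<alpha> * geom \<alpha> n)"
    by (simp add: A_pow_B l_inv_assoc m_assoc)
  also have "\<dots> = C [^] int n \<otimes> A [^] (\<alpha> * geom \<alpha> n - int n * \<alpha> ^ n)"
    by (simp add: A_pow_C_pow m_assoc flip: int_pow_mult)
  finally show ?thesis .
qed

lemma gcomm_inv_in_ucs:
  assumes "gcomm G x g \<in> ucs P n" "x \<in> P" "g \<in> carrier G"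
  shows "gcomm G (inv x) g \<in> ucs P n"
proof -
  interpret P: subgroup P G by (rule subgroup_P)
  interpret N: subgroup "ucs P n" G using normal_in_ucs[OF subgroup_P] by (simp add: normal_in_def)
  have "gcomm G (inv x) g = inv (inv x) \<otimes> inv (gcomm G x g) \<otimes> inv x"
    using assms by (simp add: gcomm_def inv_mult_group m_assoc r_inv_assoc)
  moreover have "inv (inv x) \<otimes> inv (gcomm G x g) \<otimes> inv x \<in> ucs P n"
    using normal_in_ucs[OF subgroup_P, of n] N.m_inv_closed[OF assms(1)] P.m_inv_closed[OF assms(2)]
    unfolding normal_in_def by blast
  ultimately show ?thesis by simp
qed

lemma ucs_subgroup: "subgroup (ucs P n) G"
  using normal_in_ucs[OF subgroup_P] by (simp add: normal_in_def)

lemma ucsI: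
  assumes "x \<in> P" "gcomm G x A \<in> ucs P n" "gcomm G x B \<in> ucs P n"
  shows "x \<in> ucs P (Suc n)"
  by (rule ucs_generatorsI[OF _ HOL.refl assms(1)]) (use assms(2,3) in auto)

text \<open>A witness that the class is at least 5; \<open>lcs\<close> counts from 0, so index 4 is
  the fifth term. Commutation of A with B gives C, then with A gives A^(1 - \<alpha>), whose inverse
  is A^n; then [A^n, B] is C^n times a power of A, and a last commutator with A returns a power of
  A.\<close>

lemma power_difference_in_lcs:
  assumes n: "int n = \<alpha> - 1"
  shows "A [^] (1 - \<alpha> ^ n) \<in> lcs G P 4"
proof -
  have nums: "2 = Suc 1" "3 = Suc 2" by simp_all
  have "A \<in> lcs G P 0" using A_in_P by simp
  then have "C \<in> lcs G P 1" unfolding One_nat_def using B_in_P by (rule gcomm_in_lcs)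
  then have "gcomm G C A \<in> lcs G P 2" unfolding nums using A_in_P by (rule gcomm_in_lcs)
  moreover have "gcomm G C A = A [^] (1 - \<alpha>)" using gcomm_C_pow_A[of 1] by simp
  ultimately have "inv (A [^] (1 - \<alpha>)) \<in> lcs G P 2"
    using subgroup.m_inv_closed[OF conjunct1[OF lcs_subgroup[OF subgroup_P]]] by (simp only:)
  moreover have "inv (A [^] (1 - \<alpha>)) = A [^] int n" by (simp add: n flip: int_pow_neg)
  ultimately have "A [^] int n \<in> lcs G P 2" by (simp only:)
  then have x: "gcomm G (A [^] int n) B \<in> lcs G P 3" unfolding nums(2) using B_in_P by (rule gcomm_in_lcs)
  define e where "e = \<alpha> * geom \<alpha> n - int n * \<alpha> ^ n"
  have "gcomm G (C [^] int n \<otimes> A [^] e) A = A [^] (- e) \<otimes> (inv (A \<otimes> C [^] int n) \<otimes> (C [^] int n \<otimes> A [^] (e + 1)))"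
    by (simp add: gcomm_def inv_mult_group m_assoc int_pow_neg int_pow_mult)
  also have "\<dots> = A [^] (- e) \<otimes> (A [^] (- (\<alpha> ^ n)) \<otimes> A [^] (e + 1))"
    using A_pow_C_pow[of 1 n] by (simp add: inv_mult_group m_assoc l_inv_assoc int_pow_neg)
  also have "\<dots> = A [^] (- e + (- (\<alpha> ^ n) + (e + 1)))" by (simp only: int_pow_mult A_closed)
  finally have "gcomm G (gcomm G (A [^] int n) B) A = A [^] (1 - \<alpha> ^ n)"
    by (simp add: gcomm_A_pow_B e_def)
  moreover have "gcomm G (gcomm G (A [^] int n) B) A \<in> lcs G P 4"
    using gcomm_in_lcs[OF x A_in_P] by (simp only: Suc_numeral semiring_norm)
  ultimately show ?thesis by (simp only:)
qed

end

text \<open>Writing Z_i for the upper central series, centrality of A^(2^(2m-1)) starts the chain: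
  this power lies in Z_1, C^(2^m) in Z_2, A^(2^m) in Z_3, C in Z_4 and A in Z_5. Symmetry gives the
  same for B.\<close>

locale macdonald_class = macdonald +
  fixes m :: nat
  assumes m: "m \<ge> 1" and \<alpha>m: "2 ^ m dvd \<alpha> - 1" and \<beta>m: "2 ^ m dvd \<beta> - 1"
    and A_central: "A [^] ((2::int) ^ (2 * m - 1)) \<otimes> B = B \<otimes> A [^] ((2::int) ^ (2 * m - 1))"
    and B_central: "B [^] ((2::int) ^ (2 * m - 1)) \<otimes> A = A \<otimes> B [^] ((2::int) ^ (2 * m - 1))"
begin

lemma class_swap: "macdonald_class G B A \<beta> \<alpha> m"
  by (intro macdonald_class.intro swap macdonald_class_axioms.intro m \<alpha>m \<beta>m A_central B_central)

lemma P_swap: "generate G {B, A} = P" by (simp only: insert_commute)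

lemma A_pow_in_ucs_1: "A [^] ((2::int) ^ (2 * m - 1)) \<in> ucs P 1"
proof -
  have "A [^] ((2::int) ^ (2 * m - 1)) \<in> P" using subgroup_int_pow_closed[OF subgroup_P A_in_P] .
  moreover have "gcomm G (A [^] ((2::int) ^ (2 * m - 1))) A = \<one>"
    by (rule gcomm_eq_one_if_commute[OF commutes_int_pow]) simp_all
  moreover have "gcomm G (A [^] ((2::int) ^ (2 * m - 1))) B = \<one>"
    by (rule gcomm_eq_one_if_commute[OF A_central]) simp_all
  ultimately have "A [^] ((2::int) ^ (2 * m - 1)) \<in> ucs P (Suc 0)"
    by (intro ucsI) (simp_all only: ucs.simps singleton_iff)
  then show ?thesis by (simp only: One_nat_def)
qed

lemma gcomm_C_pow_A_in_ucs: "gcomm G (C [^] int (2 ^ m)) A \<in> ucs P 1"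
proof -
  have "2 ^ (m + m) dvd \<alpha> ^ (2 ^ m) - 1" by (rule two_power_dvd_power_diff[OF \<alpha>m m]) simp
  then have "2 ^ (2 * m - 1) dvd \<alpha> ^ (2 ^ m) - 1" by (rule dvd_trans[rotated]) (rule le_imp_power_dvd, simp)
  then have "2 ^ (2 * m - 1) dvd 1 - \<alpha> ^ (2 ^ m)" by (simp add: dvd_diff_commute)
  then show ?thesis unfolding gcomm_C_pow_A
    by (rule int_pow_dvd_in_subgroup[OF ucs_subgroup A_pow_in_ucs_1 _ A_closed])
qed

lemma C_pow_in_ucs_2: "C [^] int (2 ^ m) \<in> ucs P 2"
proof -
  have c: "C [^] int (2 ^ m) \<in> P" using subgroup_int_pow_closed[OF subgroup_P C_in_P] .
  \<comment> \<open>Symmetry speaks about the inverse of C, so the commutator with B is obtained for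
    the inverse power first.\<close>
  have "gcomm G (inv (C [^] int (2 ^ m))) B \<in> ucs P 1"
    using macdonald_class.gcomm_C_pow_A_in_ucs[OF class_swap]
    by (simp only: P_swap gcomm_swap int_pow_inv C_closed)
  then have "gcomm G (inv (inv (C [^] int (2 ^ m)))) B \<in> ucs P 1"
    by (rule gcomm_inv_in_ucs) (rule subgroup.m_inv_closed[OF subgroup_P c], rule B_closed)
  then have "gcomm G (C [^] int (2 ^ m)) B \<in> ucs P 1"
    by (simp only: inv_inv int_pow_closed C_closed)
  then have "C [^] int (2 ^ m) \<in> ucs P (Suc 1)"
    by (intro ucsI c gcomm_C_pow_A_in_ucs)
  then show ?thesis by (simp only: Suc_1)
qed

text \<open>[A^(2^m), B] is C^(2^m) A^e; splitting e as \<alpha> (geom - 2^m) + 2^m (\<alpha> -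
  \<alpha>^(2^m)) shows that 2^(2m-1) divides it, so both factors lie in Z_2.\<close>

lemma A_pow_in_ucs_3: "A [^] ((2::int) ^ m) \<in> ucs P 3"
proof -
  have 1: "2 ^ (2 * m - 1) dvd geom \<alpha> (2 ^ m) - 2 ^ m" by (rule two_power_dvd_geom_minus[OF \<alpha>m m])
  have 2: "2 ^ (2 * m - 1) dvd 2 ^ m * (\<alpha> - \<alpha> ^ 2 ^ m)"
  proof -
    have "2 ^ (m + 0) dvd \<alpha> ^ (2 ^ m) - 1" by (rule two_power_dvd_power_diff[OF \<alpha>m m]) simp
    then have "2 ^ m dvd \<alpha> ^ (2 ^ m) - 1" by simp
    with \<alpha>m have "2 ^ m dvd (\<alpha> - 1) - (\<alpha> ^ (2 ^ m) - 1)" by (rule dvd_diff)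
    then have "2 ^ m * 2 ^ m dvd 2 ^ m * (\<alpha> - \<alpha> ^ 2 ^ m)" by (intro mult_dvd_mono) simp_all
    moreover have "(2::int) ^ (2 * m - 1) dvd 2 ^ m * 2 ^ m"
      unfolding power_add[symmetric] by (rule le_imp_power_dvd) simp
    ultimately show ?thesis by (rule dvd_trans[rotated])
  qed
  have "2 ^ (2 * m - 1) dvd \<alpha> * (geom \<alpha> (2 ^ m) - 2 ^ m) + 2 ^ m * (\<alpha> - \<alpha> ^ 2 ^ m)"
    by (rule dvd_add[OF dvd_mult[OF 1] 2])
  also have "\<dots> = \<alpha> * geom \<alpha> (2 ^ m) - int (2 ^ m) * \<alpha> ^ 2 ^ m" by (simp add: algebra_simps)
  finally have "A [^] (\<alpha> * geom \<alpha> (2 ^ m) - int (2 ^ m) * \<alpha> ^ 2 ^ m) \<in> ucs P 1"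
    by (rule int_pow_dvd_in_subgroup[OF ucs_subgroup A_pow_in_ucs_1 _ A_closed])
  then have "A [^] (\<alpha> * geom \<alpha> (2 ^ m) - int (2 ^ m) * \<alpha> ^ 2 ^ m) \<in> ucs P 2"
    using ucs_mono[OF subgroup_P, of 1] unfolding Suc_1 by (rule subsetD[rotated])
  then have "gcomm G (A [^] int (2 ^ m)) B \<in> ucs P 2"
    unfolding gcomm_A_pow_B by (rule subgroup.m_closed[OF ucs_subgroup C_pow_in_ucs_2])
  moreover have "gcomm G (A [^] int (2 ^ m)) A = \<one>"
    by (rule gcomm_eq_one_if_commute[OF commutes_int_pow]) simp_all
  then have "gcomm G (A [^] int (2 ^ m)) A \<in> ucs P 2"
    by (simp only: subgroup.one_closed[OF ucs_subgroup])
  ultimately have "A [^] int (2 ^ m) \<in> ucs P (Suc 2)"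
    by (intro ucsI subgroup_int_pow_closed[OF subgroup_P A_in_P])
  then show ?thesis by (simp only: of_nat_power of_nat_numeral Suc_numeral semiring_norm)
qed

lemma gcomm_C_A_in_ucs: "gcomm G C A \<in> ucs P 3"
proof -
  have "2 ^ m dvd 1 - \<alpha>" using \<alpha>m by (simp add: dvd_diff_commute)
  then have "A [^] (1 - \<alpha>) \<in> ucs P 3"
    by (rule int_pow_dvd_in_subgroup[OF ucs_subgroup A_pow_in_ucs_3 _ A_closed])
  moreover have "gcomm G C A = A [^] (1 - \<alpha>)" using gcomm_C_pow_A[of 1] by simp
  ultimately show ?thesis by (simp only:)
qed

lemma C_in_ucs_4: "C \<in> ucs P 4"
proof -
  have "gcomm G (inv C) B \<in> ucs P 3"
    using macdonald_class.gcomm_C_A_in_ucs[OF class_swap] by (simp only: P_swap gcomm_swap)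
  then have "gcomm G (inv (inv C)) B \<in> ucs P 3"
    by (rule gcomm_inv_in_ucs) (rule subgroup.m_inv_closed[OF subgroup_P C_in_P], rule B_closed)
  then have "gcomm G C B \<in> ucs P 3" by (simp only: inv_inv C_closed)
  then have "C \<in> ucs P (Suc 3)" by (intro ucsI C_in_P gcomm_C_A_in_ucs)
  then show ?thesis by (simp only: Suc_numeral semiring_norm)
qed

lemma A_in_ucs_5: "A \<in> ucs P 5"
proof -
  have "gcomm G A A \<in> ucs P 4"
    using subgroup.one_closed[OF ucs_subgroup] by (simp only: gcomm_eq_one_if_commute[OF HOL.refl] A_closed)
  then have "A \<in> ucs P (Suc 4)" by (intro ucsI A_in_P C_in_ucs_4)
  then show ?thesis by (simp only: Suc_numeral semiring_norm)
qed

lemma lcs_5_trivial: "lcs G P 5 = {\<one>}"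
proof (rule lcs_trivial[OF subgroup_P])
  have "B \<in> ucs P 5" using macdonald_class.A_in_ucs_5[OF class_swap] by (simp only: P_swap)
  then show "P \<subseteq> ucs P 5"
    using A_in_ucs_5 by (intro generate_subgroup_incl[OF _ ucs_subgroup]) blast
qed

end

subsection \<open>A group of order $2^{7m-3}$\<close>

lemma two_power_dvd_power_shift:
  fixes x :: int
  assumes x: "2 ^ m dvd x - 1" "m \<ge> 1" and "2 ^ l dvd int i - int j"
  shows "2 ^ (m + l) dvd x ^ i - x ^ j"
proof -
  have le: "2 ^ (m + l) dvd x ^ j - x ^ i" if "i \<le> j" "2 ^ l dvd int j - int i" for i j
  proof -
    have "int (2 ^ l) dvd int (j - i)" using that by (simp add: of_nat_diff)
    then have "2 ^ l dvd j - i" by (simp only: int_dvd_int_iff)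
    then have "2 ^ (m + l) dvd x ^ (j - i) - 1" using x by (intro two_power_dvd_power_diff)
    moreover have "x ^ j - x ^ i = x ^ i * (x ^ (j - i) - 1)"
      using that(1) by (simp add: algebra_simps flip: power_add)
    ultimately show ?thesis by simp
  qed
  show ?thesis using le[of i j] le[of j i] assms(3) by (metis dvd_diff_commute linear)
qed

text \<open>On steps divisible by 2^(2m-1) the geometric sum is linear with slope 1 + 2^(m-1) modulo
  2^(3m-1). This makes the multiplication maps of the model respect its lattice.\<close>

lemma two_power_dvd_geom_shift:
  fixes x :: int
  assumes w: "x - 1 = 2 ^ m * w" "odd w" and m: "m \<ge> 1" and ij: "2 ^ (2 * m - 1) dvd int i - int j"
  shows "2 ^ (3 * m - 1) dvd x * (geom x i - geom x j) - (1 + 2 ^ (m - 1)) * (int i - int j)"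
proof -
  have N: "(2::int) ^ (3 * m - 1) = 2 ^ m * 2 ^ (2 * m - 1)" using m by (simp flip: power_add)
  have le: "2 ^ (3 * m - 1) dvd x * (geom x j - geom x i) - (1 + 2 ^ (m - 1)) * (int j - int i)"
    if "i \<le> j" "2 ^ (2 * m - 1) dvd int j - int i" for i j
  proof -
    define d where "d = j - i"
    have j: "j = i + d" using that(1) by (simp add: d_def)
    have dd: "2 ^ (2 * m - 1) dvd int d" using that by (simp add: d_def of_nat_diff)
    then have "int (2 ^ (2 * m - 1)) dvd int d" by simp
    then have "2 ^ (2 * m - 1) dvd d" by (simp only: int_dvd_int_iff)
    then have 1: "2 ^ (3 * m - 1) dvd geom x d - (1 + 2 ^ (m - 1)) * int d"
      by (rule two_power_dvd_geom_diff[OF w m])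
    have "2 ^ (m + 0) dvd x ^ Suc i - 1" using w(1) m by (intro two_power_dvd_power_diff) auto
    then have 2: "2 ^ (3 * m - 1) dvd (x ^ Suc i - 1) * int d"
      unfolding N using dd by (intro mult_dvd_mono) simp_all
    have "x * (geom x j - geom x i) - (1 + 2 ^ (m - 1)) * (int j - int i)
      = x ^ Suc i * (geom x d - (1 + 2 ^ (m - 1)) * int d) + (1 + 2 ^ (m - 1)) * ((x ^ Suc i - 1) * int d)"
      unfolding j geom_add by (simp add: algebra_simps)
    then show ?thesis using 1 2 by simp
  qed
  have "x * (geom x i - geom x j) - (1 + 2 ^ (m - 1)) * (int i - int j)
     = - (x * (geom x j - geom x i) - (1 + 2 ^ (m - 1)) * (int j - int i))" by (simp add: algebra_simps)
  then show ?thesis using le[of i j] le[of j i] ij by (metis dvd_diff_commute dvd_minus_iff linear)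
qed

text \<open>The exponent of A in \<open>B_pow_C_pow_eq\<close> for r = j, now as the obstruction to
  commutation in the model.\<close>

definition defect :: "int \<Rightarrow> nat \<Rightarrow> int" where
  "defect x j = x * geom x (nat (x ^ j)) - x ^ (j + nat (x ^ j))"

lemma defect_dvd:
  assumes w: "x - 1 = 2 ^ m * w" and m: "m \<ge> 1" and "x > 0"
  shows "2 ^ (2 * m - 1) dvd defect x j"
proof -
  have "2 ^ (3 * m) dvd 2 * defect x j + int j * (x - 1)\<^sup>2"
    using two_power_dvd_key_exponent[of m x "nat (x ^ j)" j] assms by (simp add: defect_def)
  then have "2 ^ (2 * m) dvd 2 * defect x j + int j * (x - 1)\<^sup>2"
    by (rule dvd_trans[rotated]) (simp add: le_imp_power_dvd)
  moreover have "(x - 1)\<^sup>2 = 2 ^ (2 * m) * w\<^sup>2"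
    unfolding w by (simp add: power_mult_distrib mult.commute flip: power_mult)
  ultimately have "2 ^ (2 * m) dvd 2 * defect x j" by (simp add: dvd_add_left_iff)
  moreover have "(2::int) ^ (2 * m) = 2 * 2 ^ (2 * m - 1)" using m by (simp flip: power_Suc)
  ultimately show ?thesis by simp
qed

text \<open>Doubled, the defects are -j (x - 1)^2 and -j (y - 1)^2 modulo 2^(3m), and the difference
  of the squares has x - y as a factor with a cofactor divisible by 2^m.\<close>

lemma defect_diff_dvd:
  assumes "2 ^ m dvd x - 1" "2 ^ m dvd y - 1" "m \<ge> 1" "x > 0" "y > 0" "2 ^ (2 * m) dvd x - y"
  shows "2 ^ (3 * m - 1) dvd defect x j - defect y j"
proof -
  have 1: "2 ^ (3 * m) dvd 2 * defect x j + int j * (x - 1)\<^sup>2" "2 ^ (3 * m) dvd 2 * defect y j + int j * (y - 1)\<^sup>2"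
    using two_power_dvd_key_exponent[of m x "nat (x ^ j)" j] two_power_dvd_key_exponent[of m y "nat (y ^ j)" j] assms
    by (simp_all add: defect_def)
  have "2 ^ (2 * m) * 2 ^ m dvd (x - y) * ((x - 1) + (y - 1))"
    using assms by (intro mult_dvd_mono dvd_add)
  then have 2: "2 ^ (3 * m) dvd (x - y) * ((x - 1) + (y - 1))" by (simp flip: power_add)
  have "2 * (defect x j - defect y j) = (2 * defect x j + int j * (x - 1)\<^sup>2) - (2 * defect y j + int j * (y - 1)\<^sup>2)
      - int j * ((x - y) * ((x - 1) + (y - 1)))"
    by (simp add: algebra_simps power2_eq_square)
  also have "2 ^ (3 * m) dvd \<dots>" by (intro dvd_diff dvd_mult 1 2)
  finally have "2 ^ (3 * m) dvd 2 * (defect x j - defect y j)" .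
  moreover have "(2::int) ^ (3 * m) = 2 * 2 ^ (3 * m - 1)" using assms(3) by (simp flip: power_Suc)
  ultimately show ?thesis by (simp only: dvd_mult_cancel_left) simp
qed

text \<open>i' is a natural representative of i - x^j modulo 2^(3m-1). Replacing i by i' + x^j
  changes nothing modulo that power, and splitting the sum at i' yields x^i' times the defect; x^i'
  is 1 modulo 2^m and the defect supplies the remaining 2^(2m-1).\<close>

lemma defect_shift:
  assumes w: "x - 1 = 2 ^ m * w" "odd w" and m: "m \<ge> 1" and "x > 0"
    and i': "int i' = int i + (2 ^ (3 * m - 1) - 1) * x ^ j"
  shows "2 ^ (3 * m - 1) dvd x * geom x i - x ^ (i + j) - x * geom x i' - defect x j"
proof -
  define N :: int where "N = 2 ^ (3 * m - 1)"
  define s where "s = nat (x ^ j)"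
  have s: "int s = x ^ j" using \<open>x > 0\<close> by (simp add: s_def)
  have N: "N = 2 ^ m * 2 ^ (2 * m - 1)" using m by (simp add: N_def flip: power_add)
  have x1: "2 ^ m dvd x - 1" using w by simp
  have e: "int i' + int s = int i + N * x ^ j" using i' s by (simp add: N_def algebra_simps)
  have e1: "2 ^ (2 * m - 1) dvd int i - int (i' + s)" using e N by simp
  have "N dvd x * (geom x i - geom x (i' + s)) - (1 + 2 ^ (m - 1)) * (int i - int (i' + s))"
    unfolding N_def by (rule two_power_dvd_geom_shift[OF w m e1])
  moreover have "N dvd int i - int (i' + s)" using e by simp
  ultimately have 1: "N dvd x * (geom x i - geom x (i' + s))" by (simp add: dvd_diff_left_iff)
  have 2: "N dvd x ^ i - x ^ (i' + s)"
    unfolding N using two_power_dvd_power_shift[OF x1 m e1] by (simp add: power_add)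
  have "2 ^ (m + 0) dvd x ^ i' - 1" using x1 m by (intro two_power_dvd_power_diff) auto
  then have 3: "N dvd (x ^ i' - 1) * defect x j"
    unfolding N using defect_dvd[OF w(1) m \<open>x > 0\<close>] by (intro mult_dvd_mono) simp_all
  have "x * geom x i - x ^ (i + j) - x * geom x i' - defect x j
    = x * (geom x i - geom x (i' + s)) - (x ^ i - x ^ (i' + s)) * x ^ j + (x ^ i' - 1) * defect x j"
    by (simp add: defect_def s_def[symmetric] geom_add power_add algebra_simps)
  then show ?thesis using 1 2 3 by (simp add: N_def)
qed

section \<open>Centralizers of transitive families of maps\<close>

text \<open>A map commuting with a transitive family is determined by its value at one point, so the
  maps in the centralizer act freely; surjectivity is encoded by \<open>base\<close> being a value.\<close>

locale transitive_maps =
  fixes S :: "'a set" and base :: 'a and Rs :: "('a \<Rightarrow> 'a) set"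
  assumes finite_S: "finite S" and base_in: "base \<in> S"
    and maps: "\<And>R x. R \<in> Rs \<Longrightarrow> x \<in> S \<Longrightarrow> R x \<in> S"
    and transitive: "\<And>U. base \<in> U \<Longrightarrow> (\<And>R x. R \<in> Rs \<Longrightarrow> x \<in> S \<Longrightarrow> x \<in> U \<Longrightarrow> R x \<in> U) \<Longrightarrow> S \<subseteq> U"
begin

text \<open>Being the identity outside S makes maps that agree on S equal as functions, with
  \<open>id\<close> as neutral element.\<close>

definition centralizer :: "('a \<Rightarrow> 'a) set" where
  "centralizer = {g. (\<forall>x. x \<notin> S \<longrightarrow> g x = x) \<and> (\<forall>x\<in>S. g x \<in> S) \<and>
     (\<forall>R\<in>Rs. \<forall>x\<in>S. g (R x) = R (g x)) \<and> base \<in> g ` S}"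

definition centralizer_group :: "('a \<Rightarrow> 'a) monoid" where
  "centralizer_group = \<lparr>carrier = centralizer, monoid.mult = (\<circ>), one = id\<rparr>"

lemma centralizer_image: "g \<in> centralizer \<Longrightarrow> g ` S = S"
proof
  assume g: "g \<in> centralizer"
  then show "g ` S \<subseteq> S" by (auto simp: centralizer_def)
  show "S \<subseteq> g ` S"
  proof (rule transitive)
    show "base \<in> g ` S" using g by (auto simp: centralizer_def)
    fix R x assume "R \<in> Rs" "x \<in> S" "x \<in> g ` S"
    then show "R x \<in> g ` S" using g maps by (auto simp: centralizer_def image_iff) metis
  qed
qed

lemma centralizer_bij: assumes g: "g \<in> centralizer" shows "bij g"
proof -
  have "inj_on g S" using centralizer_image[OF g] finite_S by (simp add: eq_card_imp_inj_on)
  then have "bij_betw g S S" using centralizer_image[OF g] by (simp add: bij_betw_def)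
  moreover have "bij_betw g (- S) (- S)"
    using g bij_betw_cong[of "- S" g id] by (auto simp: centralizer_def)
  ultimately have "bij_betw g (S \<union> - S) (S \<union> - S)" by (rule bij_betw_combine) auto
  then show ?thesis by simp
qed

lemma centralizer_eqI:
  assumes "g \<in> centralizer" "h \<in> centralizer" "g base = h base"
  shows "g = h"
proof
  fix x
  have "S \<subseteq> {x. g x = h x}"
    by (rule transitive) (use assms in \<open>auto simp: centralizer_def\<close>)
  then show "g x = h x" using assms by (cases "x \<in> S") (auto simp: centralizer_def)
qed

lemma group_centralizer: "group centralizer_group"
proof (rule groupI)
  fix g h assume "g \<in> carrier centralizer_group" "h \<in> carrier centralizer_group"
  then have gh: "g \<in> centralizer" "h \<in> centralizer" by (simp_all add: centralizer_group_def)
  then have "(g \<circ> h) ` S = S" by (simp add: centralizer_image flip: image_image image_comp)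
  then have "base \<in> (g \<circ> h) ` S" using base_in by simp
  then have "g \<circ> h \<in> centralizer" using gh unfolding centralizer_def by auto
  then show "g \<otimes>\<^bsub>centralizer_group\<^esub> h \<in> carrier centralizer_group" by (simp add: centralizer_group_def)
next
  fix g assume "g \<in> carrier centralizer_group"
  then have g: "g \<in> centralizer" by (simp add: centralizer_group_def)
  note b = centralizer_bij[OF g]
  let ?h = "inv_into UNIV g"
  have hS: "?h ` S = S" using centralizer_image[OF g] b by (metis bij_is_inj image_inv_f_f)
  have gh: "g (?h x) = x" for x using b by (simp add: bij_is_surj surj_f_inv_f)
  have hg: "?h (g x) = x" for x using b by (simp add: bij_is_inj inv_f_f)
  have "?h \<in> centralizer" unfolding centralizer_def
  proof (intro CollectI conjI ballI allI impI)
    fix x assume "x \<notin> S" then show "?h x = x" using g hg[of x] by (simp add: centralizer_def)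
  next
    fix x assume "x \<in> S" then show "?h x \<in> S" using hS by blast
  next
    fix R x assume R: "R \<in> Rs" "x \<in> S"
    then have "?h x \<in> S" using hS by blast
    then have "g (R (?h x)) = R x" using g R gh by (simp add: centralizer_def)
    then show "?h (R x) = R (?h x)" using hg by metis
  next
    show "base \<in> ?h ` S" using hS base_in by simp
  qed
  then show "\<exists>h\<in>carrier centralizer_group. h \<otimes>\<^bsub>centralizer_group\<^esub> g = \<one>\<^bsub>centralizer_group\<^esub>"
    using hg by (auto simp: centralizer_group_def fun_eq_iff intro!: bexI[of _ ?h])
qed (auto simp: centralizer_group_def centralizer_def base_in fun_eq_iff)

lemma centralizer_group_pow: "g [^]\<^bsub>centralizer_group\<^esub> (n::nat) = g ^^ n"
proof (induction n)
  case 0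
  then show ?case by (simp add: centralizer_group_def nat_pow_def)
next
  case (Suc n)
  have "g [^]\<^bsub>centralizer_group\<^esub> Suc n = g [^]\<^bsub>centralizer_group\<^esub> n \<otimes>\<^bsub>centralizer_group\<^esub> g"
    by (simp add: nat_pow_def)
  also have "\<dots> = g ^^ n \<circ> g" by (simp only: Suc) (simp add: centralizer_group_def)
  finally show ?case by (simp only: funpow_Suc_right)
qed

lemma card_centralizer_le: "finite centralizer" "card centralizer \<le> card S"
proof -
  have i: "inj_on (\<lambda>g. g base) centralizer" using centralizer_eqI by (auto intro!: inj_onI)
  have s: "(\<lambda>g. g base) ` centralizer \<subseteq> S" using base_in by (auto simp: centralizer_def)
  show "finite centralizer" using i s finite_S by (rule inj_on_finite)
  show "card centralizer \<le> card S" using i s finite_S by (rule card_inj_on_le)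
qed

end

text \<open>The map induced by f on the fibres of \<rho>, each fibre being represented by its value.
  Outside the range it is the identity, as \<open>centralizer\<close> requires.\<close>

definition lift_map :: "('t \<Rightarrow> 'x) \<Rightarrow> ('t \<Rightarrow> 't) \<Rightarrow> 'x \<Rightarrow> 'x" where
  "lift_map \<rho> f x = (if x \<in> range \<rho> then \<rho> (f (SOME t. \<rho> t = x)) else x)"

lemma lift_map_apply:
  assumes "\<And>t t'. \<rho> t = \<rho> t' \<Longrightarrow> \<rho> (f t) = \<rho> (f t')"
  shows "lift_map \<rho> f (\<rho> t) = \<rho> (f t)"
proof -
  have "\<rho> (SOME t'. \<rho> t' = \<rho> t) = \<rho> t" by (rule someI[of "\<lambda>t'. \<rho> t' = \<rho> t" t]) simp
  then have "\<rho> (f (SOME t'. \<rho> t' = \<rho> t)) = \<rho> (f t)" by (rule assms)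
  then show ?thesis by (simp add: lift_map_def)
qed

lemma lift_map_funpow:
  assumes "\<And>t t'. \<rho> t = \<rho> t' \<Longrightarrow> \<rho> (f t) = \<rho> (f t')"
  shows "(lift_map \<rho> f ^^ n) (\<rho> t) = \<rho> ((f ^^ n) t)"
proof (induction n)
  case (Suc n)
  have "lift_map \<rho> f (\<rho> ((f ^^ n) t)) = \<rho> (f ((f ^^ n) t))" by (rule lift_map_apply) (rule assms)
  then show ?case using Suc by simp
qed simp

section \<open>Multiplication of normal forms modulo a lattice\<close>

locale macdonald_model =
  fixes m a b :: nat and u v :: int
  assumes m_ge_2: "m \<ge> 2" and a_eq: "int a - 1 = 2 ^ m * u" and b_eq: "int b - 1 = 2 ^ m * v"
    and odd_u: "odd u" and odd_v: "odd v" and a_b: "2 ^ (2 * m) dvd int a - int b"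
    and a_pos: "a > 0" and b_pos: "b > 0"
begin

text \<open>N will be the order of A, and N = 2 z p. Thus z p = N / 2, so the coefficient z of the
  second coordinate in \<rho> expresses C^p = A^(N/2).\<close>

definition p :: nat where "p = 2 ^ (2 * m - 1)"
definition N :: nat where "N = 2 ^ (3 * m - 1)"
definition z :: nat where "z = 2 ^ (m - 1)"

definition gsum :: "nat \<Rightarrow> nat \<Rightarrow> nat" where "gsum x n = (\<Sum>i<n. x ^ i)"

text \<open>The triple \<open>(i, j, k)\<close> stands for \<open>B\<^sup>-\<^sup>i C\<^sup>j A\<^sup>k\<close>; \<open>\<rho>\<close> encodes the relations
  \<open>A\<^sup>N = 1\<close>, \<open>B\<^sup>p A\<^sup>p = 1\<close> and \<open>C\<^sup>p = A\<^sup>N\<^sup>/\<^sup>2\<close>. The maps starting with \<open>l\<close> are left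
  multiplications by \<open>A\<^sup>-\<^sup>1\<close>, \<open>B\<^sup>-\<^sup>1\<close>, \<open>C\<close>, those starting with \<open>r\<close> right multiplications
  by \<open>A\<close>, \<open>B\<close>, \<open>C\<close>. Only the commutation of \<open>la\<close> with \<open>rb\<close> is not a formal identity.\<close>

definition \<rho> :: "nat \<times> nat \<times> nat \<Rightarrow> nat \<times> nat \<times> nat" where
  "\<rho> = (\<lambda>(i, j, k). (i mod p, j mod p, (k + i + z * j) mod N))"

text \<open>Derived from A^-1 B^-i = B^-e C^i A^-1 with e = b gsum b i, and from A^-1 C^j = C^j
  A^(-a^j). The factor N - 1 replaces -1 modulo N, so that all coordinates stay natural.\<close>

definition la where "la = (\<lambda>(i, j, k). (b * gsum b i, i + j, k + (N - 1) * a ^ j))"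
definition lb where "lb = (\<lambda>(i::nat, j::nat, k::nat). (i + 1, j, k))"
definition lc where "lc = (\<lambda>(i, j::nat, k::nat). (b * i, j + 1, k))"
definition ra where "ra = (\<lambda>(i::nat, j::nat, k::nat). (i, j, k + 1))"
definition rb where "rb = (\<lambda>(i, j, k). (i + (N - 1) * b ^ j, j + k, a * gsum a k))"
definition rc where "rc = (\<lambda>(i::nat, j::nat, k). (i, j + 1, a * k))"

lemma int_gsum: "int (gsum x n) = geom (int x) n"
  by (simp add: gsum_def geom_def)

lemma \<rho>_eq_iff: "\<rho> (i, j, k) = \<rho> (i', j', k') \<longleftrightarrow>
  int p dvd int i - int i' \<and> int p dvd int j - int j' \<and>
  int N dvd (int k - int k') + (int i - int i') + int z * (int j - int j')"
proof -
  have mod_eq: "x mod n = y mod n \<longleftrightarrow> int n dvd int x - int y" for x y n :: nat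
    by (metis mod_eq_dvd_iff of_nat_eq_iff of_nat_mod)
  show ?thesis unfolding \<rho>_def by (simp add: mod_eq algebra_simps)
qed

lemma int_p: "int p = 2 ^ (2 * m - 1)" and int_N: "int N = 2 ^ (3 * m - 1)" and int_z: "int z = 2 ^ (m - 1)"
  by (simp_all add: p_def N_def z_def)

lemma p_dvd_N: "int p dvd int N"
  unfolding int_p int_N using m_ge_2 by (intro le_imp_power_dvd) simp

lemma N_eq: "int N = 2 * int z * int p" "int N = 2 ^ m * int p" "int (N - 1) = int N - 1"
proof -
  have "3 * m - 1 = m + (2 * m - 1)" using m_ge_2 by simp
  then show 1: "int N = 2 ^ m * int p" unfolding int_N int_p by (simp only: power_add)
  have "m = Suc (m - 1)" using m_ge_2 by simp
  then have "(2::int) ^ m = 2 * 2 ^ (m - 1)" by (metis power_Suc)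
  then show "int N = 2 * int z * int p" unfolding 1 int_z by simp
  show "int (N - 1) = int N - 1" by (simp add: N_def of_nat_diff)
qed

lemma m1: "m \<ge> 1" using m_ge_2 by simp

lemma pow_shift:
  assumes "int x - 1 = 2 ^ m * w" "int p dvd int i - int j"
  shows "int N dvd int x ^ i - int x ^ j"
proof -
  have "2 ^ (m + (2 * m - 1)) dvd int x ^ i - int x ^ j"
    using assms m1 by (intro two_power_dvd_power_shift) (simp_all add: int_p)
  then show ?thesis by (simp only: N_eq(2) int_p power_add)
qed

lemma gsum_shift:
  assumes "int x - 1 = 2 ^ m * w" "odd w" "int p dvd int i - int j"
  shows "int N dvd (int (x * gsum x i) - int (x * gsum x j)) - (1 + int z) * (int i - int j)"
  using two_power_dvd_geom_shift[OF assms(1,2) m1, of i j] assms(3)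
  by (simp add: int_p int_N int_z int_gsum right_diff_distrib)

lemma two_z: "int p dvd d \<Longrightarrow> int N dvd 2 * int z * d"
  unfolding N_eq(1) by (intro mult_dvd_mono) simp_all

text \<open>A change i - i' enters the third congruence as (1 + z)(i - i') through the geometric sum
  and as z (i - i') through the second coordinate, where i - i' is wanted. The excess 2 z (i - i')
  is a multiple of N = 2 z p.\<close>

lemma respects_la:
  assumes "\<rho> t = \<rho> t'" shows "\<rho> (la t) = \<rho> (la t')"
proof -
  obtain i j k i' j' k' where t: "t = (i, j, k)" "t' = (i', j', k')" by (cases t, cases t')
  have h: "int p dvd int i - int i'" "int p dvd int j - int j'"
    "int N dvd (int k - int k') + (int i - int i') + int z * (int j - int j')"
    using assms unfolding t \<rho>_eq_iff by auto
  define D where "D = int (b * gsum b i) - int (b * gsum b i')"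
  have D: "int N dvd D - (1 + int z) * (int i - int i')"
    unfolding D_def by (rule gsum_shift[OF b_eq odd_v h(1)])
  have E: "int N dvd int a ^ j - int a ^ j'" by (rule pow_shift[OF a_eq h(2)])
  have "int p dvd D - (1 + int z) * (int i - int i')" using p_dvd_N D by (rule dvd_trans)
  then have 1: "int p dvd D" using h(1) by (simp add: dvd_diff_left_iff)
  have 2: "int p dvd (int i - int i') + (int j - int j')" using h by (intro dvd_add)
  have "int N dvd ((int k - int k') + (int i - int i') + int z * (int j - int j'))
     + (int N - 1) * (int a ^ j - int a ^ j') + (D - (1 + int z) * (int i - int i'))
     + 2 * int z * (int i - int i')"
    by (rule dvd_add[OF dvd_add[OF dvd_add[OF h(3) dvd_mult[OF E]] D] two_z[OF h(1)]])
  also have "\<dots> = ((int k + (int N - 1) * int a ^ j) - (int k' + (int N - 1) * int a ^ j')) + D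
     + int z * ((int i + int j) - (int i' + int j'))"
    by (simp add: algebra_simps)
  finally show ?thesis using 1 2
    unfolding t la_def prod.case \<rho>_eq_iff D_def of_nat_add of_nat_power of_nat_mult N_eq(3)
    by (simp add: algebra_simps)
qed

lemma p_dvd_third:
  assumes "\<rho> (i, j, k) = \<rho> (i', j', k')"
  shows "int p dvd int k - int k'"
proof -
  have h: "int p dvd int i - int i'" "int p dvd int j - int j'"
    "int N dvd (int k - int k') + (int i - int i') + int z * (int j - int j')"
    using assms unfolding \<rho>_eq_iff by auto
  have "int p dvd (int k - int k') + ((int i - int i') + int z * (int j - int j'))"
    using dvd_trans[OF p_dvd_N h(3)] by (simp add: algebra_simps)
  moreover have "int p dvd (int i - int i') + int z * (int j - int j')" using h by (intro dvd_add dvd_mult)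
  ultimately show ?thesis by (simp only: dvd_add_left_iff)
qed

lemma respects_rb:
  assumes "\<rho> t = \<rho> t'" shows "\<rho> (rb t) = \<rho> (rb t')"
proof -
  obtain i j k i' j' k' where t: "t = (i, j, k)" "t' = (i', j', k')" by (cases t, cases t')
  have h: "int p dvd int i - int i'" "int p dvd int j - int j'"
    "int N dvd (int k - int k') + (int i - int i') + int z * (int j - int j')"
    using assms unfolding t \<rho>_eq_iff by auto
  have hk: "int p dvd int k - int k'" using assms unfolding t by (rule p_dvd_third)
  define D where "D = int (a * gsum a k) - int (a * gsum a k')"
  have D: "int N dvd D - (1 + int z) * (int k - int k')"
    unfolding D_def by (rule gsum_shift[OF a_eq odd_u hk])
  have E: "int N dvd int b ^ j - int b ^ j'" by (rule pow_shift[OF b_eq h(2)])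
  have 1: "int p dvd (int i - int i') + (int N - 1) * (int b ^ j - int b ^ j')"
    using h(1) dvd_trans[OF p_dvd_N E] by (intro dvd_add dvd_mult)
  have 2: "int p dvd (int j - int j') + (int k - int k')" using h hk by (intro dvd_add)
  have "int N dvd ((int k - int k') + (int i - int i') + int z * (int j - int j'))
     + (int N - 1) * (int b ^ j - int b ^ j') + (D - (1 + int z) * (int k - int k'))
     + 2 * int z * (int k - int k')"
    by (rule dvd_add[OF dvd_add[OF dvd_add[OF h(3) dvd_mult[OF E]] D] two_z[OF hk]])
  also have "\<dots> = D + ((int i + (int N - 1) * int b ^ j) - (int i' + (int N - 1) * int b ^ j'))
     + int z * ((int j + int k) - (int j' + int k'))"
    by (simp add: algebra_simps)
  finally show ?thesis using 1 2
    unfolding t rb_def prod.case \<rho>_eq_iff D_def of_nat_add of_nat_power of_nat_mult N_eq(3)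
    by (simp add: algebra_simps)
qed

lemma two_power_m_dvd: "int p dvd d \<Longrightarrow> int x - 1 = 2 ^ m * w \<Longrightarrow> int N dvd (int x - 1) * d"
  unfolding N_eq(2) by (intro mult_dvd_mono) simp_all

lemma respects_lb: "\<rho> t = \<rho> t' \<Longrightarrow> \<rho> (lb t) = \<rho> (lb t')"
  and respects_ra: "\<rho> t = \<rho> t' \<Longrightarrow> \<rho> (ra t) = \<rho> (ra t')"
  by (cases t; cases t'; simp add: lb_def ra_def \<rho>_eq_iff)+

lemma respects_lc:
  assumes "\<rho> t = \<rho> t'" shows "\<rho> (lc t) = \<rho> (lc t')"
proof -
  obtain i j k i' j' k' where t: "t = (i, j, k)" "t' = (i', j', k')" by (cases t, cases t')
  have h: "int p dvd int i - int i'" "int p dvd int j - int j'"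
    "int N dvd (int k - int k') + (int i - int i') + int z * (int j - int j')"
    using assms unfolding t \<rho>_eq_iff by auto
  have "int p dvd int b * (int i - int i')" using h(1) by simp
  moreover have "int N dvd ((int k - int k') + (int i - int i') + int z * (int j - int j'))
      + (int b - 1) * (int i - int i')"
    using h(3) two_power_m_dvd[OF h(1) b_eq] by (rule dvd_add)
  ultimately show ?thesis using h(2) by (simp add: t lc_def \<rho>_eq_iff algebra_simps)
qed

lemma respects_rc:
  assumes "\<rho> t = \<rho> t'" shows "\<rho> (rc t) = \<rho> (rc t')"
proof -
  obtain i j k i' j' k' where t: "t = (i, j, k)" "t' = (i', j', k')" by (cases t, cases t')
  have h: "int p dvd int i - int i'" "int p dvd int j - int j'"
    "int N dvd (int k - int k') + (int i - int i') + int z * (int j - int j')"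
    using assms unfolding t \<rho>_eq_iff by auto
  have hk: "int p dvd int k - int k'" using assms unfolding t by (rule p_dvd_third)
  have "int N dvd ((int k - int k') + (int i - int i') + int z * (int j - int j'))
      + (int a - 1) * (int k - int k')"
    using h(3) two_power_m_dvd[OF hk a_eq] by (rule dvd_add)
  then show ?thesis using h(1,2) by (simp add: t rc_def \<rho>_eq_iff algebra_simps)
qed

text \<open>The first coordinates differ by the defect of b and the third by that of a, modulo N,
  with opposite signs; these cancel by \<open>defect_diff_dvd\<close>. The second coordinates differ
  by a multiple of a^j - b^j, which 2 p divides, so that its product with z vanishes modulo
  N.\<close>

lemma la_rb: "\<rho> (la (rb t)) = \<rho> (rb (la t))"
proof -
  obtain i j k where t: "t = (i, j, k)" by (cases t)
  define i' k' where "i' = i + (N - 1) * b ^ j" and "k' = k + (N - 1) * a ^ j"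
  have i': "int i' = int i + (2 ^ (3 * m - 1) - 1) * int b ^ j"
    and k': "int k' = int k + (2 ^ (3 * m - 1) - 1) * int a ^ j"
    using N_eq(3) by (simp_all add: i'_def k'_def int_N)
  define D where "D = int b * geom (int b) i - int b ^ (i + j) - int b * geom (int b) i'"
  define E where "E = int a * geom (int a) k - int a ^ (k + j) - int a * geom (int a) k'"
  have D: "int N dvd D - defect (int b) j" unfolding D_def int_N
    using b_pos by (intro defect_shift[OF b_eq odd_v m1 _ i']) simp
  have E: "int N dvd E - defect (int a) j" unfolding E_def int_N
    using a_pos by (intro defect_shift[OF a_eq odd_u m1 _ k']) simp
  have F: "int N dvd defect (int a) j - defect (int b) j" unfolding int_N
    by (rule defect_diff_dvd) (use a_eq b_eq a_b m1 a_pos b_pos in auto)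
  have "int p dvd defect (int b) j" unfolding int_p
    using b_pos by (intro defect_dvd[OF b_eq m1]) simp
  then have pD: "int p dvd D" using dvd_trans[OF p_dvd_N D] by (simp add: dvd_diff_left_iff)
  have "int a - int b dvd int a ^ j - int b ^ j"
    by (simp add: power_diff_sumr2)
  then have ab: "2 ^ (2 * m) dvd int a ^ j - int b ^ j" using a_b by (rule dvd_trans[rotated])
  have two: "(2::int) ^ (2 * m) = 2 * int p" using m1 by (simp add: int_p flip: power_Suc)
  then have abp: "int p dvd int a ^ j - int b ^ j" using ab by (metis dvd_mult_right)
  have "int z * (2 * int p) dvd int z * (int a ^ j - int b ^ j)" using ab two by simp
  then have abN: "int N dvd int z * (int a ^ j - int b ^ j)" by (simp add: N_eq(1) mult_ac)
  have "int N dvd (E - defect (int a) j) - (D - defect (int b) j) + (defect (int a) j - defect (int b) j)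
      + int N * (int b ^ (i + j) - int a ^ (k + j)) * (-1)
      + (int N - 1) * (int z * (int a ^ j - int b ^ j)) * (-1)"
    by (intro dvd_add dvd_diff D E F dvd_mult2 dvd_mult[OF abN] dvd_triv_left)
  then have k: "int N dvd (E - D) - int N * (int b ^ (i + j) - int a ^ (k + j))
      - (int N - 1) * (int z * (int a ^ j - int b ^ j))"
    by (simp add: algebra_simps)
  have la: "la (rb t) = (b * gsum b i', i' + (j + k), a * gsum a k + (N - 1) * a ^ (j + k))"
    by (simp add: t la_def rb_def i'_def)
  have rb: "rb (la t) = (b * gsum b i + (N - 1) * b ^ (i + j), i + j + k', a * gsum a k')"
    by (simp add: t la_def rb_def k'_def)
  show ?thesis unfolding la rb \<rho>_eq_iff
  proof (intro conjI)
    have "int (b * gsum b i') - int (b * gsum b i + (N - 1) * b ^ (i + j)) = - D - int N * int b ^ (i + j)"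
      unfolding of_nat_add of_nat_mult of_nat_power N_eq(3) by (simp add: int_gsum D_def algebra_simps)
    moreover have "int p dvd - D - int N * int b ^ (i + j)" using pD p_dvd_N by simp
    ultimately show "int p dvd int (b * gsum b i') - int (b * gsum b i + (N - 1) * b ^ (i + j))" by simp
    have j: "int (i' + (j + k)) - int (i + j + k') = - ((int N - 1) * (int a ^ j - int b ^ j))"
      by (simp add: i' k' int_N algebra_simps)
    then show "int p dvd int (i' + (j + k)) - int (i + j + k')" using abp by simp
    have "int (a * gsum a k + (N - 1) * a ^ (j + k)) - int (a * gsum a k') +
      (int (b * gsum b i') - int (b * gsum b i + (N - 1) * b ^ (i + j))) +
      int z * (int (i' + (j + k)) - int (i + j + k'))
      = (E - D) - int N * (int b ^ (i + j) - int a ^ (k + j)) - (int N - 1) * (int z * (int a ^ j - int b ^ j))"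
      unfolding j unfolding of_nat_add of_nat_mult of_nat_power N_eq(3)
      by (simp add: int_gsum D_def E_def algebra_simps)
    then show "int N dvd int (a * gsum a k + (N - 1) * a ^ (j + k)) - int (a * gsum a k') +
      (int (b * gsum b i') - int (b * gsum b i + (N - 1) * b ^ (i + j))) +
      int z * (int (i' + (j + k)) - int (i + j + k'))" using k by simp
  qed
qed

end

section \<open>The regular permutation group, its orders and its class\<close>

context macdonald_model
begin

abbreviation "La \<equiv> lift_map \<rho> la"
abbreviation "Lb \<equiv> lift_map \<rho> lb"
abbreviation "Lc \<equiv> lift_map \<rho> lc"
abbreviation "Ra \<equiv> lift_map \<rho> ra"
abbreviation "Rb \<equiv> lift_map \<rho> rb"
abbreviation "Rc \<equiv> lift_map \<rho> rc"
abbreviation "base \<equiv> \<rho> (0, 0, 0)"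

lemma La: "La (\<rho> t) = \<rho> (la t)" by (rule lift_map_apply) (rule respects_la)
lemma Lb: "Lb (\<rho> t) = \<rho> (lb t)" by (rule lift_map_apply) (rule respects_lb)
lemma Lc: "Lc (\<rho> t) = \<rho> (lc t)" by (rule lift_map_apply) (rule respects_lc)
lemma Ra: "Ra (\<rho> t) = \<rho> (ra t)" by (rule lift_map_apply) (rule respects_ra)
lemma Rb: "Rb (\<rho> t) = \<rho> (rb t)" by (rule lift_map_apply) (rule respects_rb)
lemma Rc: "Rc (\<rho> t) = \<rho> (rc t)" by (rule lift_map_apply) (rule respects_rc)

lemma La_pow: "(La ^^ n) (\<rho> t) = \<rho> ((la ^^ n) t)" by (rule lift_map_funpow) (rule respects_la)
lemma Lb_pow: "(Lb ^^ n) (\<rho> t) = \<rho> ((lb ^^ n) t)" by (rule lift_map_funpow) (rule respects_lb)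
lemma Lc_pow: "(Lc ^^ n) (\<rho> t) = \<rho> ((lc ^^ n) t)" by (rule lift_map_funpow) (rule respects_lc)
lemma Ra_pow: "(Ra ^^ n) (\<rho> t) = \<rho> ((ra ^^ n) t)" by (rule lift_map_funpow) (rule respects_ra)
lemma Rb_pow: "(Rb ^^ n) (\<rho> t) = \<rho> ((rb ^^ n) t)" by (rule lift_map_funpow) (rule respects_rb)
lemma Rc_pow: "(Rc ^^ n) (\<rho> t) = \<rho> ((rc ^^ n) t)" by (rule lift_map_funpow) (rule respects_rc)

lemma la_funpow: "(la ^^ n) (0, 0, k) = (0, 0, k + n * (N - 1))"
  by (induction n) (simp_all add: la_def gsum_def)
lemma lb_funpow: "(lb ^^ n) (i, j, k) = (i + n, j, k)"
  by (induction n) (simp_all add: lb_def)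
lemma lc_funpow: "(lc ^^ n) (0, j, k) = (0, j + n, k)"
  by (induction n) (simp_all add: lc_def)
lemma ra_funpow: "(ra ^^ n) (i, j, k) = (i, j, k + n)"
  by (induction n) (simp_all add: ra_def)
lemma rb_funpow: "(rb ^^ n) (i, 0, 0) = (i + n * (N - 1), 0, 0)"
  by (induction n) (simp_all add: rb_def gsum_def)
lemma rc_funpow: "(rc ^^ n) (i, j, 0) = (i, j + n, 0)"
  by (induction n) (simp_all add: rc_def)

lemma p_pos: "p > 0" and N_pos: "N > 0" by (simp_all add: p_def N_def)

lemma range_\<rho>: "range \<rho> = {..<p} \<times> {..<p} \<times> {..<N}"
proof (intro subset_antisym subsetI)
  fix t assume "t \<in> {..<p} \<times> {..<p} \<times> {..<N}"
  then obtain x y w where t: "t = (x, y, w)" "x < p" "y < p" "w < N" by auto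
  \<comment> \<open>Modulo N this is w - (x + z y), undoing the twist in the third coordinate of
    \<rho>.\<close>
  let ?k = "w + (N - 1) * (x + z * y)"
  have "?k + x + z * y = w + N * (x + z * y)"
    using N_pos by (cases N) (simp_all add: algebra_simps)
  then have "(?k + x + z * y) mod N = w" using t(4) by (simp only:) simp
  then have "\<rho> (x, y, ?k) = t" using t by (simp add: \<rho>_def)
  then show "t \<in> range \<rho>" by (metis rangeI)
qed (use p_pos N_pos in \<open>auto simp: \<rho>_def\<close>)

lemma card_range_\<rho>: "card (range \<rho>) = 2 ^ (7 * m - 3)"
proof -
  have "7 * m - 3 = (2 * m - 1) + ((2 * m - 1) + (3 * m - 1))" using m_ge_2 by simp
  then have "2 ^ (7 * m - 3) = p * (p * N)" unfolding p_def N_def by (simp only: power_add)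
  then show ?thesis by (simp add: range_\<rho> card_cartesian_product)
qed

text \<open>(N - 1)^2 is 1 modulo N. As \<open>la\<close> and \<open>rb\<close> move by -1 at the
  origin, i (N - 1) of their steps amount to +i.\<close>

lemma \<rho>_negate_twice: "\<rho> (i * (N - 1) * (N - 1), j, k) = \<rho> (i, j, k)"
  and \<rho>_negate_twice': "\<rho> (i, j, k * (N - 1) * (N - 1)) = \<rho> (i, j, k)"
proof -
  have "int (x * (N - 1) * (N - 1)) - int x = int N * (int x * (int N - 2))" for x
    unfolding of_nat_mult N_eq(3) by (simp add: algebra_simps)
  then have *: "int N dvd int (x * (N - 1) * (N - 1)) - int x" for x by simp
  show "\<rho> (i * (N - 1) * (N - 1), j, k) = \<rho> (i, j, k)" "\<rho> (i, j, k * (N - 1) * (N - 1)) = \<rho> (i, j, k)"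
    unfolding \<rho>_eq_iff using *[of i] *[of k] dvd_trans[OF p_dvd_N *[of i]] by (simp_all del: of_nat_mult)
qed

sublocale transitive_maps "range \<rho>" base "{Ra, Rb, Rc}"
proof
  show "finite (range \<rho>)" by (simp add: range_\<rho>)
  show "base \<in> range \<rho>" by simp
  show "R x \<in> range \<rho>" if "R \<in> {Ra, Rb, Rc}" "x \<in> range \<rho>" for R x
    using that by (auto simp: Ra Rb Rc)
  fix U assume base: "base \<in> U"
    and step: "\<And>R x. R \<in> {Ra, Rb, Rc} \<Longrightarrow> x \<in> range \<rho> \<Longrightarrow> x \<in> U \<Longrightarrow> R x \<in> U"
  have pw: "(R ^^ n) (\<rho> t) \<in> U" if R: "R \<in> {Ra, Rb, Rc}" and t: "\<rho> t \<in> U" for R t n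
  proof -
    have "(R ^^ n) (\<rho> t) \<in> U \<inter> range \<rho>"
    proof (induction n)
      case (Suc n)
      then have "R ((R ^^ n) (\<rho> t)) \<in> U" using step R by blast
      moreover have "R ((R ^^ n) (\<rho> t)) \<in> range \<rho>" using Suc R by (auto simp: Ra Rb Rc)
      ultimately show ?case by simp
    qed (use t in simp)
    then show ?thesis by blast
  qed
  show "range \<rho> \<subseteq> U"
  proof
    fix x assume "x \<in> range \<rho>"
    then obtain i j k where x: "x = \<rho> (i, j, k)" by (metis imageE prod_cases3)
    \<comment> \<open>The normal form is built from the base point by right multiplication with
      powers of B, then of C, then of A.\<close>
    have "\<rho> (i * (N - 1) * (N - 1), 0, 0) \<in> U"
      using pw[of Rb "(0, 0, 0)" "i * (N - 1)"] base by (simp add: Rb_pow rb_funpow)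
    then have "\<rho> (i, 0, 0) \<in> U" by (simp only: \<rho>_negate_twice)
    then have "\<rho> (i, j, 0) \<in> U" using pw[of Rc "(i, 0, 0)" j] by (simp add: Rc_pow rc_funpow)
    then show "x \<in> U" using pw[of Ra "(i, j, 0)" k] by (simp add: x Ra_pow ra_funpow)
  qed
qed

lemma La_in: "La \<in> centralizer"
  unfolding centralizer_def
proof (intro CollectI conjI allI impI ballI)
  fix R x assume "R \<in> {Ra, Rb, Rc}" "x \<in> range \<rho>"
  moreover have "\<rho> (la (ra t)) = \<rho> (ra (la t))" "\<rho> (la (rc t)) = \<rho> (rc (la t))" for t
    by (cases t, simp add: la_def ra_def rc_def algebra_simps)+
  ultimately show "La (R x) = R (La x)"
    by (auto simp: La Ra Rb Rc la_rb)
next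
  have "la (0, 0, 1) = (0, 0, N)" using N_pos by (simp add: la_def gsum_def)
  moreover have "\<rho> (0, 0, N) = base" by (simp add: \<rho>_def)
  ultimately have "La (\<rho> (0, 0, 1)) = base" by (simp only: La)
  then show "base \<in> La ` range \<rho>" by (metis rangeI image_eqI)
next
  fix x assume "x \<in> range \<rho>" then show "La x \<in> range \<rho>" by (auto simp: La)
qed (simp add: lift_map_def)

lemma Lb_in: "Lb \<in> centralizer"
  unfolding centralizer_def
proof (intro CollectI conjI allI impI ballI)
  fix R x assume "R \<in> {Ra, Rb, Rc}" "x \<in> range \<rho>"
  moreover have "lb (ra t) = ra (lb t)" "lb (rc t) = rc (lb t)" "lb (rb t) = rb (lb t)" for t
    by (cases t, simp add: lb_def ra_def rc_def rb_def)+
  ultimately show "Lb (R x) = R (Lb x)"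
    by (auto simp: Lb Ra Rb Rc)
next
  \<comment> \<open>p N - 1 is a natural representative of -1 in the first coordinate, so it is sent
    to the base point.\<close>
  have "p * N \<ge> 1" using p_pos N_pos by simp
  then have "lb (p * N - 1, 0, 0) = (p * N, 0, 0)" by (simp add: lb_def)
  moreover have "\<rho> (p * N, 0, 0) = base" by (simp add: \<rho>_def)
  ultimately have "Lb (\<rho> (p * N - 1, 0, 0)) = base" by (simp only: Lb)
  then show "base \<in> Lb ` range \<rho>" by (metis rangeI image_eqI)
next
  fix x assume "x \<in> range \<rho>" then show "Lb x \<in> range \<rho>" by (auto simp: Lb)
qed (simp add: lift_map_def)

abbreviation "Q \<equiv> centralizer_group"

sublocale Q: group Q by (rule group_centralizer)

abbreviation "QA \<equiv> inv\<^bsub>Q\<^esub> La"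
abbreviation "QB \<equiv> inv\<^bsub>Q\<^esub> Lb"

lemma Q_carrier: "carrier Q = centralizer" and Q_mult: "g \<otimes>\<^bsub>Q\<^esub> h = g \<circ> h" and Q_one: "\<one>\<^bsub>Q\<^esub> = id"
  by (simp_all add: centralizer_group_def)

lemma Q_La [simp]: "La \<in> carrier Q" and Q_Lb [simp]: "Lb \<in> carrier Q"
  by (simp_all add: Q_carrier La_in Lb_in)

text \<open>Relations and orders in \<open>Q\<close> thus need checking at the base point only,
  where the formulas for powers collapse.\<close>

lemma Q_eqI: "g \<in> carrier Q \<Longrightarrow> h \<in> carrier Q \<Longrightarrow> g base = h base \<Longrightarrow> g = h"
  unfolding Q_carrier by (rule centralizer_eqI)

text \<open>Verified as C B^-1 A^-1 = A^-1 B^-1, which holds exactly on triples, before any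
  reduction modulo the lattice.\<close>

lemma Lc_eq: "gcomm Q QA QB = Lc"
proof -
  have "Lc \<circ> (Lb \<circ> La) = La \<circ> Lb"
  proof
    fix x
    have "lc (lb (la t)) = la (lb t)" for t
      by (cases t) (simp add: la_def lb_def lc_def gsum_def sum.lessThan_Suc_shift sum_distrib_left del: sum.lessThan_Suc)
    then show "(Lc \<circ> (Lb \<circ> La)) x = (La \<circ> Lb) x"
      by (cases "x \<in> range \<rho>") (auto simp: La Lb Lc, auto simp: lift_map_def)
  qed
  then have "Lc \<circ> (Lb \<otimes>\<^bsub>Q\<^esub> La) \<circ> inv\<^bsub>Q\<^esub> (Lb \<otimes>\<^bsub>Q\<^esub> La) = La \<otimes>\<^bsub>Q\<^esub> Lb \<otimes>\<^bsub>Q\<^esub> inv\<^bsub>Q\<^esub> (Lb \<otimes>\<^bsub>Q\<^esub> La)"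
    by (simp add: Q_mult)
  moreover have "(Lb \<otimes>\<^bsub>Q\<^esub> La) \<circ> inv\<^bsub>Q\<^esub> (Lb \<otimes>\<^bsub>Q\<^esub> La) = id"
    by (simp add: Q.r_inv flip: Q_mult[of "Lb \<otimes>\<^bsub>Q\<^esub> La"] Q_one)
  ultimately have "Lc = La \<otimes>\<^bsub>Q\<^esub> Lb \<otimes>\<^bsub>Q\<^esub> inv\<^bsub>Q\<^esub> (Lb \<otimes>\<^bsub>Q\<^esub> La)"
    by (simp add: comp_assoc)
  then show ?thesis by (simp add: gcomm_def Q.inv_mult_group Q.m_assoc)
qed

lemma Q_Lc [simp]: "Lc \<in> carrier Q"
  unfolding Lc_eq[symmetric] by (simp add: gcomm_def)

lemma Q_rel_A: "La \<otimes>\<^bsub>Q\<^esub> Lc = Lc \<otimes>\<^bsub>Q\<^esub> La [^]\<^bsub>Q\<^esub> a"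
proof (rule Q_eqI)
  show "(La \<otimes>\<^bsub>Q\<^esub> Lc) base = (Lc \<otimes>\<^bsub>Q\<^esub> La [^]\<^bsub>Q\<^esub> a) base"
    unfolding Q_mult centralizer_group_pow comp_apply La_pow la_funpow La Lc
    by (simp add: la_def lc_def gsum_def mult.commute)
qed simp_all

lemma Q_rel_B: "Lc \<otimes>\<^bsub>Q\<^esub> Lb = Lb [^]\<^bsub>Q\<^esub> b \<otimes>\<^bsub>Q\<^esub> Lc"
proof (rule Q_eqI)
  have "lc (lb (0, 0, 0)) = (b, 1, 0)" "lc (0, 0, 0) = (0, 1, 0)" by (simp_all add: lb_def lc_def)
  then show "(Lc \<otimes>\<^bsub>Q\<^esub> Lb) base = (Lb [^]\<^bsub>Q\<^esub> b \<otimes>\<^bsub>Q\<^esub> Lc) base"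
    by (simp add: Q_mult centralizer_group_pow Lb Lc Lb_pow lb_funpow)
qed simp_all

sublocale QM: macdonald Q QA QB "int a" "int b"
proof
  have "inv\<^bsub>Q\<^esub> Lc \<otimes>\<^bsub>Q\<^esub> La \<otimes>\<^bsub>Q\<^esub> Lc = La [^]\<^bsub>Q\<^esub> a"
    by (simp add: Q.m_assoc Q_rel_A Q.l_inv_assoc)
  then have "inv\<^bsub>Q\<^esub> (inv\<^bsub>Q\<^esub> Lc \<otimes>\<^bsub>Q\<^esub> La \<otimes>\<^bsub>Q\<^esub> Lc) = inv\<^bsub>Q\<^esub> (La [^]\<^bsub>Q\<^esub> a)" by simp
  then show "inv\<^bsub>Q\<^esub> gcomm Q QA QB \<otimes>\<^bsub>Q\<^esub> QA \<otimes>\<^bsub>Q\<^esub> gcomm Q QA QB = QA [^]\<^bsub>Q\<^esub> int a"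
    by (simp add: Lc_eq Q.inv_mult_group Q.m_assoc Q.nat_pow_inv int_pow_int)
  have "Lc \<otimes>\<^bsub>Q\<^esub> Lb \<otimes>\<^bsub>Q\<^esub> inv\<^bsub>Q\<^esub> Lc = Lb [^]\<^bsub>Q\<^esub> b"
    by (simp add: Q.m_assoc Q_rel_B)
  then have "inv\<^bsub>Q\<^esub> (Lc \<otimes>\<^bsub>Q\<^esub> Lb \<otimes>\<^bsub>Q\<^esub> inv\<^bsub>Q\<^esub> Lc) = inv\<^bsub>Q\<^esub> (Lb [^]\<^bsub>Q\<^esub> b)" by simp
  then show "gcomm Q QA QB \<otimes>\<^bsub>Q\<^esub> QB \<otimes>\<^bsub>Q\<^esub> inv\<^bsub>Q\<^esub> gcomm Q QA QB = QB [^]\<^bsub>Q\<^esub> int b"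
    by (simp add: Lc_eq Q.inv_mult_group Q.m_assoc Q.nat_pow_inv int_pow_int)
qed simp_all

text \<open>Products B^-i C^j A^k in the generated subgroup already reach every point from the base.
  Since elements are determined by their value there, this subgroup is everything and has as many
  elements as there are points.\<close>

lemma Q_generated: "carrier Q = generate Q {QA, QB}"
  and Q_order: "order Q = 2 ^ (7 * m - 3)"
proof -
  let ?H = "generate Q {QA, QB}"
  interpret H: subgroup ?H Q by (rule Q.generate_is_subgroup) simp
  have gen: "QA \<in> ?H" "QB \<in> ?H" by (auto intro: generate.incl)
  then have gen': "La \<in> ?H" "Lb \<in> ?H" using H.m_inv_closed[of QA] H.m_inv_closed[of QB] by simp_all
  have Lc': "Lc \<in> ?H" unfolding Lc_eq[symmetric] gcomm_def using gen gen' by simp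
  have pw: "g [^]\<^bsub>Q\<^esub> (n::nat) \<in> ?H" if "g \<in> ?H" for g n
  proof (induction n)
    case 0
    show ?case by (simp only: Q.nat_pow_0 H.one_closed)
  next
    case (Suc n)
    then show ?case by (simp only: Q.nat_pow_Suc H.m_closed that)
  qed
  have ex: "\<exists>h\<in>?H. h base = x" if "x \<in> range \<rho>" for x
  proof -
    obtain t where "x = \<rho> t" using \<open>x \<in> range \<rho>\<close> by blast
    then obtain i j k where x: "x = \<rho> (i, j, k)" by (cases t) simp
    let ?h = "Lb [^]\<^bsub>Q\<^esub> i \<otimes>\<^bsub>Q\<^esub> (Lc [^]\<^bsub>Q\<^esub> j \<otimes>\<^bsub>Q\<^esub> La [^]\<^bsub>Q\<^esub> (k * (N - 1)))"
    have "?h base = \<rho> (i, j, k * (N - 1) * (N - 1))"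
      unfolding Q_mult centralizer_group_pow comp_apply La_pow la_funpow Lc_pow lc_funpow Lb_pow lb_funpow by simp
    also have "\<dots> = x" by (simp only: \<rho>_negate_twice' x)
    finally show ?thesis by (rule bexI[of _ ?h]) (intro H.m_closed pw gen' Lc')
  qed
  show "carrier Q = ?H"
  proof
    show "carrier Q \<subseteq> ?H"
    proof
      fix g assume g: "g \<in> carrier Q"
      then have "g base \<in> range \<rho>" by (simp add: Q_carrier centralizer_def)
      then obtain h where h: "h \<in> ?H" "h base = g base" using ex by blast
      then have "g = h" by (intro Q_eqI[OF g]) (simp_all only: H.mem_carrier)
      then show "g \<in> ?H" using h(1) by (simp only:)
    qed
    show "?H \<subseteq> carrier Q" by (rule H.subset)
  qed
  have "range \<rho> \<subseteq> (\<lambda>g. g base) ` carrier Q"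
  proof
    fix x assume "x \<in> range \<rho>"
    then obtain h where h: "h \<in> ?H" "h base = x" using ex by blast
    then show "x \<in> (\<lambda>g. g base) ` carrier Q" using H.mem_carrier[OF h(1)] by (intro image_eqI[of _ _ h]) (simp_all only:)
  qed
  then have "card (range \<rho>) \<le> card (carrier Q)"
    using card_centralizer_le(1) by (intro surj_card_le) (simp_all add: Q_carrier)
  then show "order Q = 2 ^ (7 * m - 3)"
    using card_centralizer_le(2) by (simp add: order_def Q_carrier card_range_\<rho>)
qed

lemma ord_eqI:
  assumes "g \<in> carrier Q" "\<And>n. (g ^^ n) base = base \<longleftrightarrow> d dvd n"
  shows "group.ord Q g = d"
proof -
  have "\<one>\<^bsub>Q\<^esub> base = base" by (simp add: Q_one)
  then have "g [^]\<^bsub>Q\<^esub> n = \<one>\<^bsub>Q\<^esub> \<longleftrightarrow> (g ^^ n) base = base" for n :: nat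
    using Q_eqI[of "g [^]\<^bsub>Q\<^esub> n" "\<one>\<^bsub>Q\<^esub>"] assms(1)
    by (metis Q.nat_pow_closed Q.one_closed centralizer_group_pow)
  then show ?thesis using assms(2) by (simp add: Q.ord_unique[OF assms(1)])
qed

lemma ord_QA: "group.ord Q QA = 2 ^ (3 * m - 1)"
proof -
  have "\<rho> (0, 0, n * (N - 1)) = base \<longleftrightarrow> N dvd n" for n
  proof -
    have "\<rho> (0, 0, n * (N - 1)) = base \<longleftrightarrow> int N dvd int n * (int N - 1)"
      by (simp only: \<rho>_eq_iff) (simp flip: N_eq(3))
    also have "\<dots> \<longleftrightarrow> int N dvd int N * int n - int n" by (simp add: algebra_simps)
    also have "\<dots> \<longleftrightarrow> int N dvd int n" by (simp add: dvd_diff_right_iff)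
    finally show ?thesis by simp
  qed
  then have "group.ord Q La = N" by (intro ord_eqI) (simp_all add: La_pow la_funpow)
  then show ?thesis by (simp add: N_def)
qed

lemma ord_QB: "group.ord Q QB = 2 ^ (3 * m - 1)"
proof -
  have "\<rho> (n, 0, 0) = base \<longleftrightarrow> N dvd n" for n
    using p_dvd_N by (simp only: \<rho>_eq_iff) (auto intro: dvd_trans)
  then have "group.ord Q Lb = N" by (intro ord_eqI) (simp_all add: Lb_pow lb_funpow)
  then show ?thesis by (simp add: N_def)
qed

text \<open>For the triple (0, n, 0) the third congruence reads 2 z p | z n, which doubles the
  period p of the second coordinate.\<close>

lemma ord_QC: "group.ord Q (gcomm Q QA QB) = 2 ^ (2 * m)"
proof -
  have "\<rho> (0, n, 0) = base \<longleftrightarrow> 2 * p dvd n" for n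
  proof -
    have "\<rho> (0, n, 0) = base \<longleftrightarrow> int p dvd int n \<and> int z * (2 * int p) dvd int z * int n"
      by (simp only: \<rho>_eq_iff N_eq(1)) (simp add: mult_ac)
    also have "\<dots> \<longleftrightarrow> int p dvd int n \<and> int (2 * p) dvd int n" by (simp add: z_def)
    also have "\<dots> \<longleftrightarrow> p dvd n \<and> 2 * p dvd n" by (simp only: int_dvd_int_iff)
    also have "\<dots> \<longleftrightarrow> 2 * p dvd n" by (auto dest: dvd_mult_right)
    finally show ?thesis .
  qed
  then have "group.ord Q Lc = 2 * p" by (intro ord_eqI) (simp_all add: Lc_pow lc_funpow)
  moreover have "2 * p = 2 ^ (2 * m)" using m1 by (simp add: p_def flip: power_Suc)
  ultimately show ?thesis by (simp add: Lc_eq)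
qed

lemma QA_pow_p: "QA [^]\<^bsub>Q\<^esub> int p = QB [^]\<^bsub>Q\<^esub> (- int p)"
proof -
  have "Lb [^]\<^bsub>Q\<^esub> p \<otimes>\<^bsub>Q\<^esub> La [^]\<^bsub>Q\<^esub> p = \<one>\<^bsub>Q\<^esub>"
  proof (rule Q_eqI)
    have "p + p * (N - 1) = N * p" using N_pos by (cases N) simp_all
    then have "\<rho> (p, 0, p * (N - 1)) = base" by (simp add: \<rho>_def add.commute)
    then show "(Lb [^]\<^bsub>Q\<^esub> p \<otimes>\<^bsub>Q\<^esub> La [^]\<^bsub>Q\<^esub> p) base = \<one>\<^bsub>Q\<^esub> base"
      unfolding Q_mult centralizer_group_pow comp_apply La_pow la_funpow Lb_pow lb_funpow by (simp add: Q_one)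
  qed simp_all
  then have "Lb [^]\<^bsub>Q\<^esub> p = inv\<^bsub>Q\<^esub> (La [^]\<^bsub>Q\<^esub> p)"
    by (intro Q.inv_equality[symmetric]) simp_all
  then show ?thesis
    by (simp add: Q.nat_pow_inv Q.int_pow_neg int_pow_int)
qed

sublocale QC: macdonald_class Q QA QB "int a" "int b" m
proof
  show "QA [^]\<^bsub>Q\<^esub> ((2::int) ^ (2 * m - 1)) \<otimes>\<^bsub>Q\<^esub> QB = QB \<otimes>\<^bsub>Q\<^esub> QA [^]\<^bsub>Q\<^esub> ((2::int) ^ (2 * m - 1))"
    unfolding int_p[symmetric] by (rule QM.A_pow_commutes_B_if[OF QA_pow_p])
  have "QB [^]\<^bsub>Q\<^esub> int p = QA [^]\<^bsub>Q\<^esub> (- int p)"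
    using QA_pow_p by (simp add: Q.int_pow_neg)
  then show "QB [^]\<^bsub>Q\<^esub> ((2::int) ^ (2 * m - 1)) \<otimes>\<^bsub>Q\<^esub> QA = QA \<otimes>\<^bsub>Q\<^esub> QB [^]\<^bsub>Q\<^esub> ((2::int) ^ (2 * m - 1))"
    unfolding int_p[symmetric] by (rule macdonald.A_pow_commutes_B_if[OF QM.swap])
qed (use m1 a_eq b_eq in auto)

text \<open>With n = a - 1, the number is n geom a n, and geom a n is n times a 2-adic unit because
  4 divides n. The valuation is therefore exactly 2m, which is below 3m - 1 as m \<ge> 2.\<close>

lemma power_difference_valuation: "\<not> int N dvd int a ^ (a - 1) - 1"
proof
  assume N: "int N dvd int a ^ (a - 1) - 1"
  define n where "n = int (a - 1)"
  have n: "n = int a - 1" "n = 2 ^ m * u" using a_pos a_eq by (simp_all add: n_def of_nat_diff)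
  obtain K where "6 * geom (1 + n) (a - 1) = 6 * n + 3 * n * (n - 1) * n
    + n * (n - 1) * (n - 2) * n\<^sup>2 + 6 * n ^ 3 * K"
    using geom_mod_cube[of n "a - 1"] n_def by blast
  moreover have "1 + n = int a" using n by simp
  ultimately have 6: "6 * geom (int a) (a - 1) = n * (6 + 3 * (n - 1) * n + (n - 1) * (n - 2) * n\<^sup>2 + 6 * n\<^sup>2 * K)"
    by (simp add: algebra_simps power2_eq_square power3_eq_cube)
  have "4 dvd n"
  proof -
    have "(2::int) ^ 2 dvd 2 ^ m" using m_ge_2 by (rule le_imp_power_dvd)
    then show ?thesis using n(2) by simp
  qed
  then obtain l where l: "n = 4 * l" by blast
  define s where "s = 3 + 2 * (3 * (n - 1) * l + (n - 1) * (n - 2) * n * l + 6 * n * l * K)"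
  have "6 * geom (int a) (a - 1) = n * (2 * s)"
    unfolding 6 s_def power2_eq_square by (subst (2 4 7) l) (simp add: algebra_simps)
  then have "3 * geom (int a) (a - 1) = n * s" by simp
  then have "3 * (int a ^ (a - 1) - 1) = n * (n * s)"
    using geom_mult_diff[of "int a" "a - 1"] n(1) by (metis mult.left_commute)
  also have "\<dots> = 2 ^ (2 * m) * (u * u * s)"
  proof -
    have "(2::int) ^ (2 * m) = 2 ^ m * 2 ^ m" by (simp only: mult_2 power_add)
    then show ?thesis unfolding n(2) by (simp only: mult_ac)
  qed
  finally have "int N dvd 2 ^ (2 * m) * (u * u * s)" using N by (metis dvd_mult)
  moreover have "2 ^ (2 * m) * 2 dvd int N"
    unfolding int_N power_Suc2[symmetric] using m_ge_2 by (intro le_imp_power_dvd) simp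
  ultimately have "2 ^ (2 * m) * 2 dvd 2 ^ (2 * m) * (u * u * s)" by (rule dvd_trans[rotated])
  then have "even (u * u * s)" by (subst (asm) dvd_mult_cancel_left) simp
  moreover have "odd s" by (simp add: s_def)
  ultimately show False using odd_u by simp
qed

lemma Q_nil_class: "nil_class Q (carrier Q) = 5"
proof -
  have "subgroup (carrier Q) Q" by (rule Q.subgroup_self)
  moreover have "lcs Q (carrier Q) (Suc 4) = {\<one>\<^bsub>Q\<^esub>}"
    using QC.lcs_5_trivial unfolding Q_generated[symmetric] by (simp only: Suc_numeral semiring_norm)
  moreover have "lcs Q (carrier Q) 4 \<noteq> {\<one>\<^bsub>Q\<^esub>}"
  proof
    assume "lcs Q (carrier Q) 4 = {\<one>\<^bsub>Q\<^esub>}"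
    moreover have "QA [^]\<^bsub>Q\<^esub> (1 - int a ^ (a - 1)) \<in> lcs Q (carrier Q) 4"
      using QM.power_difference_in_lcs[of "a - 1"] a_pos unfolding Q_generated[symmetric] by (simp only: of_nat_diff Suc_leI)
    ultimately have "QA [^]\<^bsub>Q\<^esub> (1 - int a ^ (a - 1)) = \<one>\<^bsub>Q\<^esub>" by (simp only: singleton_iff)
    then have "int N dvd 1 - int a ^ (a - 1)"
      using Q.int_pow_eq_id[of QA] ord_QA by (simp add: N_def)
    then show False using power_difference_valuation by (simp add: dvd_diff_commute)
  qed
  ultimately have "nil_class Q (carrier Q) = Suc 4" by (rule Q.nil_class_eqI)
  then show ?thesis by simp
qed

end

subsection \<open>The presented group\<close>

lemma pclass_eq_iff: "pclass \<alpha> \<beta> u = pclass \<alpha> \<beta> v \<longleftrightarrow> peq \<alpha> \<beta> u v"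
  unfolding pclass_def using peq.refl peq.sym peq.trans by blast

lemma peq_append:
  assumes "peq \<alpha> \<beta> u u'" "peq \<alpha> \<beta> v v'" shows "peq \<alpha> \<beta> (u @ v) (u' @ v')"
proof -
  have "peq \<alpha> \<beta> (u @ v) (u' @ v)" using peq.cong[OF assms(1), of "[]" v] by simp
  moreover have "peq \<alpha> \<beta> (u' @ v) (u' @ v')" using peq.cong[OF assms(2), of u' "[]"] by simp
  ultimately show ?thesis by (rule peq.trans)
qed

lemma Gpres_mult: "pclass \<alpha> \<beta> u \<otimes>\<^bsub>Gpres \<alpha> \<beta>\<^esub> pclass \<alpha> \<beta> v = pclass \<alpha> \<beta> (u @ v)"
proof -
  have "peq \<alpha> \<beta> (x @ y) w \<Longrightarrow> peq \<alpha> \<beta> u x \<Longrightarrow> peq \<alpha> \<beta> v y \<Longrightarrow> peq \<alpha> \<beta> (u @ v) w" for x y w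
    using peq_append peq.trans by blast
  then show ?thesis unfolding Gpres_def pclass_def by (auto intro: peq.refl)
qed

lemma Gpres_one: "\<one>\<^bsub>Gpres \<alpha> \<beta>\<^esub> = pclass \<alpha> \<beta> []"
  and Gpres_carrier: "carrier (Gpres \<alpha> \<beta>) = range (pclass \<alpha> \<beta>)"
  by (simp_all add: Gpres_def)

lemma pclass_closed [simp]: "pclass \<alpha> \<beta> w \<in> carrier (Gpres \<alpha> \<beta>)"
  by (simp add: Gpres_carrier)

definition word_inverse :: "gword \<Rightarrow> gword" where
  "word_inverse w = rev (map (\<lambda>x. (fst x, \<not> snd x)) w)"

lemma peq_word_inverse: "peq \<alpha> \<beta> (word_inverse w @ w) []"
proof (induction w)
  case Nil
  then show ?case by (simp add: word_inverse_def peq.refl)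
next
  case (Cons x w)
  have "peq \<alpha> \<beta> [(fst x, \<not> snd x), x] []" using peq.cancel[of \<alpha> \<beta> "(fst x, \<not> snd x)"] by simp
  then have "peq \<alpha> \<beta> (word_inverse w @ [(fst x, \<not> snd x), x] @ w) (word_inverse w @ [] @ w)"
    by (rule peq.cong)
  then have "peq \<alpha> \<beta> (word_inverse (x # w) @ x # w) (word_inverse w @ w)" by (simp add: word_inverse_def)
  then show ?case using Cons by (rule peq.trans)
qed

lemma group_Gpres: "group (Gpres \<alpha> \<beta>)"
proof (rule groupI)
  fix x assume "x \<in> carrier (Gpres \<alpha> \<beta>)"
  then obtain w where x: "x = pclass \<alpha> \<beta> w" by (auto simp: Gpres_carrier)
  show "\<exists>y\<in>carrier (Gpres \<alpha> \<beta>). y \<otimes>\<^bsub>Gpres \<alpha> \<beta>\<^esub> x = \<one>\<^bsub>Gpres \<alpha> \<beta>\<^esub>"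
    by (rule bexI[of _ "pclass \<alpha> \<beta> (word_inverse w)"])
      (simp_all add: x Gpres_mult Gpres_one pclass_eq_iff peq_word_inverse)
qed (auto simp: Gpres_carrier Gpres_mult Gpres_one)

lemma Gpres_inv: "inv\<^bsub>Gpres \<alpha> \<beta>\<^esub> pclass \<alpha> \<beta> w = pclass \<alpha> \<beta> (word_inverse w)"
proof -
  interpret group "Gpres \<alpha> \<beta>" by (rule group_Gpres)
  show ?thesis
    by (rule inv_equality) (simp_all add: Gpres_mult Gpres_one pclass_eq_iff peq_word_inverse)
qed

lemma concat_replicate_commute: "concat (replicate n w) @ w = w @ concat (replicate n w)"
  by (induction n) simp_all

lemma Gpres_pow: "pclass \<alpha> \<beta> w [^]\<^bsub>Gpres \<alpha> \<beta>\<^esub> (n::nat) = pclass \<alpha> \<beta> (concat (replicate n w))"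
proof -
  interpret group "Gpres \<alpha> \<beta>" by (rule group_Gpres)
  show ?thesis
    by (induction n) (simp_all add: Gpres_one Gpres_mult concat_replicate_commute)
qed

lemma Gpres_wpow:
  assumes "w' = word_inverse w"
  shows "pclass \<alpha> \<beta> w [^]\<^bsub>Gpres \<alpha> \<beta>\<^esub> (k::int) = pclass \<alpha> \<beta> (wpow w w' k)"
proof -
  interpret group "Gpres \<alpha> \<beta>" by (rule group_Gpres)
  show ?thesis
  proof (cases "0 \<le> k")
    case True
    then show ?thesis using int_pow_int[of "Gpres \<alpha> \<beta>" "pclass \<alpha> \<beta> w" "nat k"]
      by (simp add: wpow_def Gpres_pow)
  next
    case False
    then have "pclass \<alpha> \<beta> w [^]\<^bsub>Gpres \<alpha> \<beta>\<^esub> k = inv\<^bsub>Gpres \<alpha> \<beta>\<^esub> (pclass \<alpha> \<beta> w [^]\<^bsub>Gpres \<alpha> \<beta>\<^esub> nat (- k))"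
      using int_pow_neg_int[of "pclass \<alpha> \<beta> w" "nat (- k)"] by simp
    also have "\<dots> = pclass \<alpha> \<beta> w' [^]\<^bsub>Gpres \<alpha> \<beta>\<^esub> nat (- k)"
      by (simp add: assms Gpres_inv flip: nat_pow_inv)
    finally show ?thesis using False by (simp add: wpow_def Gpres_pow)
  qed
qed

lemma word_inverse_generators:
  "word_inverse wA = wAi" "word_inverse wB = wBi" "word_inverse wC = wCi"
  by (simp_all add: word_inverse_def wA_def wAi_def wB_def wBi_def wC_def wCi_def)

lemma gcomm_Gpres: "gcomm (Gpres \<alpha> \<beta>) (pclass \<alpha> \<beta> wA) (pclass \<alpha> \<beta> wB) = pclass \<alpha> \<beta> wC"
  by (simp add: gcomm_def Gpres_inv Gpres_mult word_inverse_generators wC_def)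

lemma macdonald_Gpres: "macdonald (Gpres \<alpha> \<beta>) (pclass \<alpha> \<beta> wA) (pclass \<alpha> \<beta> wB) \<alpha> \<beta>"
proof -
  interpret group "Gpres \<alpha> \<beta>" by (rule group_Gpres)
  show ?thesis
    using peq.rel1[of \<alpha> \<beta>] peq.rel2[of \<alpha> \<beta>]
    by unfold_locales (simp_all add: gcomm_Gpres Gpres_inv Gpres_mult word_inverse_generators
        Gpres_wpow[OF word_inverse_generators(1)[symmetric]] Gpres_wpow[OF word_inverse_generators(2)[symmetric]]
        pclass_eq_iff)
qed

lemma Gpres_generated:
  "carrier (Gpres \<alpha> \<beta>) = generate (Gpres \<alpha> \<beta>) {pclass \<alpha> \<beta> wA, pclass \<alpha> \<beta> wB}" (is "_ = ?H")
proof
  interpret group "Gpres \<alpha> \<beta>" by (rule group_Gpres)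
  interpret H: subgroup ?H "Gpres \<alpha> \<beta>" by (rule generate_is_subgroup) simp
  show "?H \<subseteq> carrier (Gpres \<alpha> \<beta>)" by (rule H.subset)
  have AB: "pclass \<alpha> \<beta> wA \<in> ?H" "pclass \<alpha> \<beta> wB \<in> ?H" by (auto intro: generate.incl)
  have ABi: "pclass \<alpha> \<beta> wAi \<in> ?H" "pclass \<alpha> \<beta> wBi \<in> ?H"
    using H.m_inv_closed[OF AB(1)] H.m_inv_closed[OF AB(2)] by (simp_all only: Gpres_inv word_inverse_generators)
  have "pclass \<alpha> \<beta> w \<in> ?H" for w
  proof (induction w)
    case Nil
    then show ?case using H.one_closed by (simp only: Gpres_one)
  next
    case (Cons x w)
    have "[x] \<in> {wA, wAi, wB, wBi}" by (cases x) (auto simp: wA_def wAi_def wB_def wBi_def)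
    then have "pclass \<alpha> \<beta> [x] \<in> ?H" using AB ABi by auto
    then have "pclass \<alpha> \<beta> [x] \<otimes>\<^bsub>Gpres \<alpha> \<beta>\<^esub> pclass \<alpha> \<beta> w \<in> ?H" using Cons by (rule H.m_closed)
    then show ?case by (simp add: Gpres_mult)
  qed
  then show "carrier (Gpres \<alpha> \<beta>) \<subseteq> ?H" by (auto simp: Gpres_carrier)
qed

section \<open>Evaluating words: the universal property of the presentation\<close>

context macdonald
begin

definition letter :: "bool \<times> bool \<Rightarrow> 'a" where
  "letter x = (let g = (if fst x then B else A) in if snd x then inv g else g)"

fun eval_word :: "gword \<Rightarrow> 'a" where
  "eval_word [] = \<one>"
| "eval_word (x # w) = letter x \<otimes> eval_word w"

lemma letter_closed [simp]: "letter x \<in> carrier G"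
  by (simp add: letter_def Let_def)

lemma eval_word_closed [simp]: "eval_word w \<in> carrier G"
  by (induction w) simp_all

lemma eval_word_append: "eval_word (u @ v) = eval_word u \<otimes> eval_word v"
  by (induction u) (simp_all add: m_assoc)

lemma eval_word_concat_replicate: "eval_word (concat (replicate n w)) = eval_word w [^] n"
proof (induction n)
  case (Suc n)
  have "concat (replicate (Suc n) w) = concat (replicate n w) @ w" by (simp add: concat_replicate_commute)
  then show ?case using Suc by (simp only: eval_word_append nat_pow_Suc)
qed simp

lemma eval_word_generators:
  "eval_word wA = A" "eval_word wAi = inv A" "eval_word wB = B" "eval_word wBi = inv B"
  "eval_word wC = C" "eval_word wCi = inv C"
  by (simp_all add: wA_def wAi_def wB_def wBi_def wC_def wCi_def letter_def gcomm_def inv_mult_group m_assoc)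

lemma eval_word_wpow:
  assumes "eval_word w' = inv (eval_word w)"
  shows "eval_word (wpow w w' k) = eval_word w [^] k"
proof (cases "0 \<le> k")
  case True
  then have "\<not> k < 0" by simp
  then show ?thesis
    by (simp only: wpow_def eval_word_concat_replicate int_pow_def2 True if_True if_False)
next
  case False
  then have k: "k < 0" by simp
  have "eval_word (wpow w w' k) = inv (eval_word w) [^] nat (- k)"
    by (simp only: wpow_def eval_word_concat_replicate assms False if_False)
  also have "\<dots> = eval_word w [^] k"
    by (simp only: int_pow_def2 k if_True nat_pow_inv eval_word_closed)
  finally show ?thesis .
qed

lemma eval_word_peq: "peq \<alpha> \<beta> u v \<Longrightarrow> eval_word u = eval_word v"
proof (induction rule: peq.induct)
  case (cancel x)
  then show ?case by (simp add: letter_def Let_def)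
next
  case rel1
  then show ?case using rel_A
    by (simp add: eval_word_append eval_word_generators eval_word_wpow m_assoc)
next
  case rel2
  then show ?case using rel_B
    by (simp add: eval_word_append eval_word_generators eval_word_wpow m_assoc)
next
  case (cong u v p q)
  then show ?case by (simp add: eval_word_append)
qed simp_all

definition presentation_hom :: "gword set \<Rightarrow> 'a" where
  "presentation_hom S = eval_word (SOME w. w \<in> S)"

lemma presentation_hom_pclass: "presentation_hom (pclass \<alpha> \<beta> w) = eval_word w"
proof -
  have "(SOME v. v \<in> pclass \<alpha> \<beta> w) \<in> pclass \<alpha> \<beta> w"
    by (rule someI[of _ w]) (simp add: pclass_def peq.refl)
  then have "peq \<alpha> \<beta> w (SOME v. v \<in> pclass \<alpha> \<beta> w)" by (simp add: pclass_def)
  then show ?thesis using eval_word_peq by (simp add: presentation_hom_def)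
qed

lemma group_hom_presentation: "group_hom (Gpres \<alpha> \<beta>) G presentation_hom"
proof -
  have "presentation_hom \<in> hom (Gpres \<alpha> \<beta>) G"
    by (rule homI) (auto simp: Gpres_carrier presentation_hom_pclass Gpres_mult eval_word_append)
  then show ?thesis using group_Gpres is_group by (simp add: group_hom_def group_hom_axioms_def)
qed

end

section \<open>Two-parts and Sylow subgroups under a map with odd kernel\<close>

lemma (in group) ord_two_part:
  assumes "finite (carrier G)" "x \<in> carrier G"
  shows "ord (two_part G x) = 2 ^ multiplicity 2 (ord x)"
proof -
  define n k where "n = ord x" and "k = multiplicity 2 n"
  define e where "e = (SOME e::nat. [e = 1] (mod 2 ^ k) \<and> [e = 0] (mod (n div 2 ^ k)))"
  have "n > 0" unfolding n_def using ord_ge_1[OF assms] by simp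
  have n: "n = 2 ^ k * (n div 2 ^ k)" by (simp add: k_def multiplicity_dvd)
  have "odd (n div 2 ^ k)"
    using multiplicity_decompose[of n 2] \<open>n > 0\<close> by (simp add: k_def)
  then have "coprime (2 ^ k) (n div 2 ^ k)" by simp
  then have "\<exists>e::nat. [e = 1] (mod 2 ^ k) \<and> [e = 0] (mod (n div 2 ^ k))"
    by (rule binary_chinese_remainder_nat)
  then have e: "[e = 1] (mod 2 ^ k)" "[e = 0] (mod (n div 2 ^ k))"
    unfolding e_def by (metis (mono_tags, lifting) someI_ex)+
  have dvd: "n div 2 ^ k dvd e" using e(2) by (simp add: cong_0_iff)
  have "coprime e (2 ^ k)" using e(1) by (metis cong_imp_coprime cong_sym coprime_1_left)
  have "two_part G x = x [^] e" by (simp add: two_part_def Let_def e_def n_def k_def)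
  moreover have "ord (x [^] e) = 2 ^ k"
  proof (cases "e = 0")
    \<comment> \<open>The choice operator can return e = 0 only when x has odd order, and then the
      2-part is trivial.\<close>
    case True
    then have "k = 0" using \<open>coprime e (2 ^ k)\<close> by (cases k) simp_all
    then show ?thesis using True by simp
  next
    case False
    \<comment> \<open>e is prime to 2^k and divisible by the odd part of n, so the common divisor is
      exactly that odd part.\<close>
    have "gcd n e = gcd (2 ^ k * (n div 2 ^ k)) e" using n by simp
    also have "\<dots> = gcd (n div 2 ^ k) e"
      using \<open>coprime e (2 ^ k)\<close> by (simp add: gcd_mult_left_left_cancel coprime_commute)
    also have "\<dots> = n div 2 ^ k" using dvd by (simp add: gcd_nat.absorb1)
    finally have g: "gcd n e = n div 2 ^ k" .
    have "n div 2 ^ k > 0" using n \<open>n > 0\<close> by (metis gr0I mult_0_right)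
    then have "n div (n div 2 ^ k) = 2 ^ k" by (subst n) simp
    then show ?thesis using ord_pow_gen[OF assms(2), of e] False g by (simp add: n_def)
  qed
  ultimately show ?thesis by (simp add: n_def k_def)
qed

lemma (in group) pow_card_subgroup:
  assumes "subgroup H G" "finite H" "x \<in> H"
  shows "x [^] card H = \<one>"
proof -
  interpret H: group "G\<lparr>carrier := H\<rparr>" using assms(1) by (rule subgroup.subgroup_is_group) (rule is_group)
  have "x [^]\<^bsub>G\<lparr>carrier := H\<rparr>\<^esub> order (G\<lparr>carrier := H\<rparr>) = \<one>\<^bsub>G\<lparr>carrier := H\<rparr>\<^esub>"
    using assms by (intro H.pow_order_eq_1) simp_all
  then show ?thesis by (simp add: order_def flip: nat_pow_consistent)
qed

locale odd_kernel_hom = group_hom +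
  fixes e :: nat
  assumes fin: "finite (carrier G)" and surj: "h ` carrier G = carrier H"
    and order_H: "order H = 2 ^ e" and order_G: "\<exists>q. odd q \<and> order G dvd 2 ^ e * q"
begin

text \<open>|G| is 2^e times the order of the kernel and divides 2^e q, so the kernel order divides
  the odd number q.\<close>

lemma odd_kernel: "odd (card (kernel G H h))" and order_eq: "order G = 2 ^ e * card (kernel G H h)"
proof -
  have "(\<lambda>U. the_elem (h ` U)) \<in> iso (G Mod kernel G H h) H"
    using FactGroup_iso_set[OF surj] .
  then have "card (rcosets kernel G H h) = card (carrier H)"
    by (auto simp: iso_def FactGroup_def dest: bij_betw_same_card)
  then show *: "order G = 2 ^ e * card (kernel G H h)"
    using G.lagrange[OF subgroup_kernel] order_H by (simp add: order_def)
  obtain q where q: "odd q" "order G dvd 2 ^ e * q" using order_G by blast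
  then have "card (kernel G H h) dvd q" using * by simp
  then show "odd (card (kernel G H h))" using q(1) dvd_trans by blast
qed

lemma multiplicity_order: "multiplicity 2 (order G) = e"
proof -
  have "multiplicity 2 (2 ^ e * card (kernel G H h)) = e"
    using odd_kernel by (simp add: multiplicity_times_same[symmetric] prime_elem_multiplicity_mult_distrib
        not_dvd_imp_multiplicity_0 odd_pos)
  then show ?thesis by (simp add: order_eq)
qed

text \<open>The order of x is a multiple of 2^r and divides 2^r times the order of the kernel, which
  is odd.\<close>

lemma multiplicity_ord:
  assumes x: "x \<in> carrier G" and r: "group.ord H (h x) = 2 ^ r"
  shows "multiplicity 2 (group.ord G x) = r"
proof -
  let ?k = "card (kernel G H h)"
  have "h (x [^]\<^bsub>G\<^esub> G.ord x) = \<one>\<^bsub>H\<^esub>" by (simp only: G.pow_ord_eq_1[OF x] hom_one)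
  then have "h x [^]\<^bsub>H\<^esub> G.ord x = \<one>\<^bsub>H\<^esub>" by (simp only: hom_nat_pow[OF x])
  then have "2 ^ r dvd G.ord x" using x r H.pow_eq_id[of "h x"] by simp
  then obtain s where s: "G.ord x = 2 ^ r * s" by blast
  have "h (x [^]\<^bsub>G\<^esub> (2 ^ r :: nat)) = \<one>\<^bsub>H\<^esub>" using x H.pow_ord_eq_1[of "h x"] r by (simp add: hom_nat_pow)
  then have "x [^]\<^bsub>G\<^esub> (2 ^ r :: nat) \<in> kernel G H h" using x by (simp add: kernel_def)
  then have "(x [^]\<^bsub>G\<^esub> (2 ^ r :: nat)) [^]\<^bsub>G\<^esub> ?k = \<one>\<^bsub>G\<^esub>"
    using fin by (intro G.pow_card_subgroup[OF subgroup_kernel]) (auto simp: kernel_def intro: rev_finite_subset)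
  then have "x [^]\<^bsub>G\<^esub> (2 ^ r * ?k) = \<one>\<^bsub>G\<^esub>" using x by (simp add: G.nat_pow_pow)
  then have "G.ord x dvd 2 ^ r * ?k" using x G.pow_eq_id by blast
  then have "s dvd ?k" using s by simp
  then have "odd s" using odd_kernel dvd_trans by blast
  then show ?thesis using s
    by (simp add: prime_elem_multiplicity_mult_distrib not_dvd_imp_multiplicity_0 odd_pos)
qed

lemma ord_two_part_eq:
  assumes "x \<in> carrier G" "group.ord H (h x) = 2 ^ r"
  shows "group.ord G (two_part G x) = 2 ^ r"
  using G.ord_two_part[OF fin assms(1)] multiplicity_ord[OF assms] by simp

text \<open>An element of P in the kernel has order dividing both a power of 2 and an odd number, so
  h is injective on P; equal cardinalities make it onto.\<close>

lemma sylow2_image: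
  assumes "sylow2 G P"
  shows "card P = 2 ^ e" "inj_on h P" "h ` P = carrier H"
proof -
  have P: "subgroup P G" and cP: "card P = 2 ^ e"
    using assms by (simp_all add: sylow2_def multiplicity_order)
  interpret P: subgroup P G by (rule P)
  have fP: "finite P" using fin P.subset by (rule rev_finite_subset)
  have triv: "x = \<one>\<^bsub>G\<^esub>" if x: "x \<in> P" "h x = \<one>\<^bsub>H\<^esub>" for x
  proof -
    have "x \<in> kernel G H h" using x by (simp add: kernel_def)
    then have "x [^]\<^bsub>G\<^esub> card (kernel G H h) = \<one>\<^bsub>G\<^esub>"
      using fin by (intro G.pow_card_subgroup[OF subgroup_kernel]) (auto simp: kernel_def intro: rev_finite_subset)
    moreover have "x [^]\<^bsub>G\<^esub> card P = \<one>\<^bsub>G\<^esub>" using G.pow_card_subgroup[OF P fP x(1)] .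
    ultimately have "G.ord x dvd card (kernel G H h)" "G.ord x dvd 2 ^ e"
      using x G.pow_eq_id[of x] cP by simp_all
    moreover have "coprime (card (kernel G H h)) (2 ^ e)" using odd_kernel by simp
    ultimately have "G.ord x = 1" by (metis coprime_common_divisor_nat)
    then show ?thesis using G.ord_eq_1 x by simp
  qed
  show "inj_on h P"
  proof (rule inj_onI)
    fix x y assume xy: "x \<in> P" "y \<in> P" "h x = h y"
    then have "h (x \<otimes>\<^bsub>G\<^esub> inv\<^bsub>G\<^esub> y) = \<one>\<^bsub>H\<^esub>" by simp
    then have "x \<otimes>\<^bsub>G\<^esub> inv\<^bsub>G\<^esub> y = \<one>\<^bsub>G\<^esub>" using xy by (intro triv) simp_all
    then show "x = y" using xy by (metis G.inv_closed G.inv_equality G.inv_inv P.mem_carrier)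
  qed
  then have "card (h ` P) = card (carrier H)" using cP order_H by (simp add: card_image order_def)
  moreover have "finite (carrier H)" using order_H by (metis H.order_gt_0_iff_finite zero_less_numeral zero_less_power)
  moreover have "h ` P \<subseteq> carrier H" by auto
  ultimately show "h ` P = carrier H" by (simp add: card_subset_eq)
  show "card P = 2 ^ e" by (rule cP)
qed

end

section \<open>Comparing the presented group with the model\<close>

lemma two_power_odd_decomposition:
  fixes x :: int
  assumes "x \<noteq> 0" "multiplicity 2 x = m"
  obtains u where "x = 2 ^ m * u" "odd u"
proof -
  have "2 ^ m dvd x" unfolding assms(2)[symmetric] by (rule multiplicity_dvd)
  then obtain u where u: "x = 2 ^ m * u" by blast
  have "odd u"
  proof
    assume "even u"
    then have "2 ^ m * 2 dvd 2 ^ m * u" by (intro mult_dvd_mono) simp_all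
    then have "2 ^ Suc m dvd x" by (simp add: u mult.commute)
    then show False using power_dvd_iff_le_multiplicity[of x 2 "Suc m"] assms by simp
  qed
  then show thesis using u that by blast
qed

text \<open>m > 1 gives 4 | x - 1, which excludes 0 and -1, the values for which the finiteness
  argument breaks down.\<close>

lemma abs_gt_one_if_dvd:
  fixes x :: int
  assumes "x \<noteq> 1" "x - 1 = 2 ^ m * u" "m > 1"
  shows "odd x" "\<bar>x\<bar> > 1"
proof -
  have "(2::int) ^ 2 dvd 2 ^ m" using assms(3) by (intro le_imp_power_dvd) simp
  then have "4 dvd x - 1" unfolding assms(2) by simp
  then show "odd x" "\<bar>x\<bar> > 1" using assms(1) by presburger+
qed

theorem theorem15p1:
  fixes \<alpha> \<beta> :: int and m :: nat and P :: "gword set set"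
  assumes "\<alpha> \<noteq> 1" and "\<beta> \<noteq> 1"
    and "multiplicity 2 (\<alpha> - 1) = m" and "multiplicity 2 (\<beta> - 1) = m" and "m > 1"
    and "\<alpha> = \<beta> \<or> 2 * m \<le> multiplicity 2 (\<alpha> - \<beta>)"
    and "sylow2 (Gpres \<alpha> \<beta>) P"
  shows "card P = 2 ^ (7 * m - 3)
    \<and> nil_class (Gpres \<alpha> \<beta>) P = 5
    \<and> group.ord (Gpres \<alpha> \<beta>) (two_part (Gpres \<alpha> \<beta>) (pclass \<alpha> \<beta> wA)) = 2 ^ (3 * m - 1)
    \<and> group.ord (Gpres \<alpha> \<beta>) (two_part (Gpres \<alpha> \<beta>) (pclass \<alpha> \<beta> wB)) = 2 ^ (3 * m - 1)
    \<and> group.ord (Gpres \<alpha> \<beta>) (two_part (Gpres \<alpha> \<beta>) (pclass \<alpha> \<beta> wC)) = 2 ^ (2 * m)"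
proof -
  obtain u where u: "\<alpha> - 1 = 2 ^ m * u" "odd u"
    using two_power_odd_decomposition[OF _ assms(3)] assms(1) by auto
  obtain v where v: "\<beta> - 1 = 2 ^ m * v" "odd v"
    using two_power_odd_decomposition[OF _ assms(4)] assms(2) by auto
  have \<alpha>\<beta>: "2 ^ (2 * m) dvd \<alpha> - \<beta>"
    using assms(6) by (metis diff_self dvd_0_right le_imp_power_dvd multiplicity_dvd dvd_trans)

  interpret G: macdonald "Gpres \<alpha> \<beta>" "pclass \<alpha> \<beta> wA" "pclass \<alpha> \<beta> wB" \<alpha> \<beta>
    by (rule macdonald_Gpres)
  obtain M where M: "M > 0" "pclass \<alpha> \<beta> wA [^]\<^bsub>Gpres \<alpha> \<beta>\<^esub> int M = \<one>\<^bsub>Gpres \<alpha> \<beta>\<^esub>"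
      "pclass \<alpha> \<beta> wB [^]\<^bsub>Gpres \<alpha> \<beta>\<^esub> int M = \<one>\<^bsub>Gpres \<alpha> \<beta>\<^esub>"
      "G.C [^]\<^bsub>Gpres \<alpha> \<beta>\<^esub> int M = \<one>\<^bsub>Gpres \<alpha> \<beta>\<^esub>"
    using G.finite_orders3 abs_gt_one_if_dvd[OF assms(1) u(1) assms(5)] abs_gt_one_if_dvd[OF assms(2) v(1) assms(5)]
    by blast
  have "m \<ge> 1" using assms(5) by simp
  then interpret D: dyadic_macdonald "Gpres \<alpha> \<beta>" "pclass \<alpha> \<beta> wA" "pclass \<alpha> \<beta> wB" \<alpha> \<beta> M m u v
    by (intro dyadic_macdonald.intro finite_macdonald.intro finite_macdonald_axioms.intro
        dyadic_macdonald_axioms.intro macdonald_Gpres Gpres_generated M u v \<alpha>\<beta>)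

  \<comment> \<open>The shifts 2^m s and 2^m t are large enough to make \<open>a\<close> and
    \<open>b\<close> positive. They are multiples of 2^(3m-1), the order of both generators of the
    model, so the model satisfies the relations for \<alpha> and \<beta> as well.\<close>
  define s t where "s = 2 ^ (2 * m) * (\<bar>\<alpha>\<bar> + 1)" and "t = 2 ^ (2 * m) * (\<bar>\<beta>\<bar> + 1)"
  define a b where "a = nat (\<alpha> + 2 ^ m * s)" and "b = nat (\<beta> + 2 ^ m * t)"
  have pos: "x + 2 ^ m * (2 ^ (2 * m) * (\<bar>x\<bar> + 1)) > 0" for x :: int
  proof -
    have "1 * (\<bar>x\<bar> + 1) \<le> 2 ^ m * 2 ^ (2 * m) * (\<bar>x\<bar> + 1)"
      by (intro mult_right_mono) (simp_all flip: power_add)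
    then have "\<bar>x\<bar> + 1 \<le> 2 ^ m * (2 ^ (2 * m) * (\<bar>x\<bar> + 1))" by (simp only: mult_1 mult.assoc)
    then show ?thesis by linarith
  qed
  have a: "int a = \<alpha> + 2 ^ m * s" "a > 0" and b: "int b = \<beta> + 2 ^ m * t" "b > 0"
    using pos[of \<alpha>] pos[of \<beta>] by (simp_all add: a_def b_def s_def t_def)
  have st: "2 ^ (2 * m) dvd s" "2 ^ (2 * m) dvd t" "even s" "even t"
    using assms(5) by (simp_all add: s_def t_def)
  interpret Q: macdonald_model m a b "u + s" "v + t"
  proof
    show "2 ^ (2 * m) dvd int a - int b"
    proof -
      have "int a - int b = (\<alpha> - \<beta>) + (2 ^ m * s - 2 ^ m * t)" by (simp add: a b)
      then show ?thesis using \<alpha>\<beta> st by simp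
    qed
  qed (use a b u v st assms(5) in \<open>simp_all add: algebra_simps\<close>)
  have "2 ^ (3 * m - 1) dvd 2 ^ m * s" "2 ^ (3 * m - 1) dvd 2 ^ m * t"
  proof -
    have "(2::int) ^ (3 * m - 1) dvd 2 ^ (m + 2 * m)" by (rule le_imp_power_dvd) simp
    moreover have "(2::int) ^ (m + 2 * m) dvd 2 ^ m * s" "(2::int) ^ (m + 2 * m) dvd 2 ^ m * t"
      unfolding power_add using st by (intro mult_dvd_mono; simp)+
    ultimately show "2 ^ (3 * m - 1) dvd 2 ^ m * s" "2 ^ (3 * m - 1) dvd 2 ^ m * t"
      by (auto intro: dvd_trans)
  qed
  then have "Q.QA [^]\<^bsub>Q.Q\<^esub> \<alpha> = Q.QA [^]\<^bsub>Q.Q\<^esub> int a" "Q.QB [^]\<^bsub>Q.Q\<^esub> \<beta> = Q.QB [^]\<^bsub>Q.Q\<^esub> int b"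
    using Q.Q.int_pow_eq[of Q.QA \<alpha> "int a"] Q.Q.int_pow_eq[of Q.QB \<beta> "int b"] Q.ord_QA Q.ord_QB a(1) b(1)
    by simp_all
  then have "macdonald Q.Q Q.QA Q.QB \<alpha> \<beta>"
    using Q.QM.rel_A Q.QM.rel_B by unfold_locales simp_all
  then interpret R: macdonald Q.Q Q.QA Q.QB \<alpha> \<beta> .

  let ?h = R.presentation_hom
  interpret h: group_hom "Gpres \<alpha> \<beta>" Q.Q ?h by (rule R.group_hom_presentation)
  have hA: "?h (pclass \<alpha> \<beta> wA) = Q.QA" and hB: "?h (pclass \<alpha> \<beta> wB) = Q.QB"
    and hC: "?h (pclass \<alpha> \<beta> wC) = gcomm Q.Q Q.QA Q.QB"
    by (simp_all only: R.presentation_hom_pclass R.eval_word_generators)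
  have surj: "?h ` carrier (Gpres \<alpha> \<beta>) = carrier Q.Q"
  proof -
    have "?h ` carrier (Gpres \<alpha> \<beta>) = generate Q.Q (?h ` {pclass \<alpha> \<beta> wA, pclass \<alpha> \<beta> wB})"
      unfolding Gpres_generated by (rule h.generate_img[symmetric]) simp
    then show ?thesis by (simp only: image_insert image_empty hA hB Q.Q_generated)
  qed
  interpret h: odd_kernel_hom "Gpres \<alpha> \<beta>" Q.Q ?h "7 * m - 3"
    by unfold_locales (rule D.finite_carrier surj Q.Q_order D.order_dvd)+
  have "subgroup P (Gpres \<alpha> \<beta>)" using assms(7) by (simp add: sylow2_def)
  then have "nil_class (Gpres \<alpha> \<beta>) P = 5"
    using h.nil_class_image[OF _ h.sylow2_image(2)[OF assms(7)]] h.sylow2_image(3)[OF assms(7)] Q.Q_nil_class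
    by simp
  moreover have "group.ord (Gpres \<alpha> \<beta>) (two_part (Gpres \<alpha> \<beta>) (pclass \<alpha> \<beta> wA)) = 2 ^ (3 * m - 1)"
    by (rule h.ord_two_part_eq) (simp_all only: pclass_closed hA Q.ord_QA)
  moreover have "group.ord (Gpres \<alpha> \<beta>) (two_part (Gpres \<alpha> \<beta>) (pclass \<alpha> \<beta> wB)) = 2 ^ (3 * m - 1)"
    by (rule h.ord_two_part_eq) (simp_all only: pclass_closed hB Q.ord_QB)
  moreover have "group.ord (Gpres \<alpha> \<beta>) (two_part (Gpres \<alpha> \<beta>) (pclass \<alpha> \<beta> wC)) = 2 ^ (2 * m)"
    by (rule h.ord_two_part_eq) (simp_all only: pclass_closed hC Q.ord_QC)
  ultimately show ?thesis using h.sylow2_image(1)[OF assms(7)] by blast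
qed

end
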